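(* Assume $\mathsf M$ is $\Delta$-absorbing. Let $p\in\mathbb N^*$, let $g:\mathbf X\times\mathbf A\to\mathbb R^p$ be bounded measurable with $g(x,a)=0$ for $(x,a)\in\Delta\times\mathbf A$, and let $\alpha\in\mathbb R^p$. Then every extreme point of $\mathcal O(g,\alpha)$ is a convex combination of at most $p+1$ extreme points of $\mathcal O$, and consequently $\mathrm{ext}(\mathcal O(g,\alpha))\subseteq\mathcal O_{\mathbb C_{p+1}}(g,\alpha)$.
   Context: Model. $(\mathbf X,\mathfrak X)$ is a measurable space (state space), $\mathbf A$ is a Borel space (action space) with Borel $\sigma$-algebra $\mathfrak B(\mathbf A)$; for each $x\in\mathbf X$, $\mathbf A(x)\subseteq\mathbf A$ is a nonempty measurable set of admissible actions; $\mathbf K=\{(x,a)\in\mathbf X\times\mathbf A: a\in\mathbf A(x)\}$; $Q$ is a stochastic kernel on $\mathbf X$ given $(\mathbf X\times\mathbf A,\mathfrak X\otimes\mathfrak B(\mathbf A))$; $\eta$ is a probability measure on $\mathbf X$; $r:\mathbf X\times\mathbf A\to\mathbb R^d$ ($d\ge1$) is bounded measurable. The model $\mathsf M=(\mathbf X,\mathbf A,\{\mathbf A(x)\}_{x},Q,\eta,r)$ satisfies the measurability conditions: $\mathbf K\in\mathfrak X\otimes\mathfrak B(\mathbf A)$, and there is a measurable $\theta:\mathbf X\to\mathbf A$ with $\theta(x)\in\mathbf A(x)$ for all $x$. Policies. $\mathbf H_0=\mathbf X$, $\mathbf H_n=\mathbf H_{n-1}\times\mathbf A\times\mathbf X$.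 A policy $\pi=\{\pi_n\}_{n\ge0}$ is a sequence of stochastic kernels $\pi_n$ on $\mathbf A$ given $\mathbf H_n$ with $\pi_n(\mathbf A(x_n)|h_n)=1$ for all $h_n=(x_0,a_0,\dots,x_n)$; $\mathbf\Pi$ is the set of all policies. For $\pi\in\mathbf\Pi$, $\mathbb P_\pi$ is the unique probability on $\Omega=(\mathbf X\times\mathbf A)^\infty$ (product $\sigma$-algebra, coordinate processes $X_n,A_n$, histories $H_n$) with $X_0\sim\eta$, $\mathbb P_\pi(A_n\in\cdot\,|H_n)=\pi_n(\cdot|H_n)$ and $\mathbb P_\pi(X_{n+1}\in\cdot\,|H_n,A_n)=Q(\cdot|X_n,A_n)$; $\mathbb E_\pi$ is its expectation. $\mathbb S$ is the set of stochastic kernels $\varphi$ on $\mathbf A$ given $\mathbf X$ with $\varphi(\mathbf A(x)|x)=1$ for all $x$. For $p\ge1$, $\mathbb C_p$ is the set of $\varphi\in\mathbb S$ of the form $\varphi(da|x)=\sum_{i=1}^p\beta_i(x)\delta_{\phi_i(x)}(da)$ with measurable $\phi_i:\mathbf X\to\mathbf A$ and measurable $\beta=(\beta_1,\dots,\beta_p):\mathbf X\to\{b\in\mathbb R_+^p:\sum_ib_i=1\}$; each $\varphi\in\mathbb C_p$ is identified with the chattering stationary policy (of order $p$) $\pi_n(\cdot|h_n)=\varphi(\cdot|x_n)$. Absorbing models. For $\Delta\in\mathfrak X$ let $T_\Delta=\min\{n\ge0:X_n\in\Delta\}$ ($\min\emptyset=\infty$). $\mathsf M$ is $\Delta$-absorbing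 if $Q(\Delta|x,a)=1$ and $r(x,a)=0$ for all $(x,a)\in\Delta\times\mathbf A$, and $\mathbb E_\pi[T_\Delta]<\infty$ for all $\pi\in\mathbf\Pi$. Occupation measures. For a $\Delta$-absorbing model and $\pi\in\mathbf\Pi$, $\mu_\pi(\Gamma)=\mathbb E_\pi\big[\sum_{t\ge0}\mathbf 1_{\{T_\Delta>t\}}\mathbf 1_{\{(X_t,A_t)\in\Gamma\}}\big]$ for $\Gamma\in\mathfrak X\otimes\mathfrak B(\mathbf A)$; $\mathcal O=\{\mu_\pi:\pi\in\mathbf\Pi\}$ and $\mathcal O_\Lambda=\{\mu_\pi:\pi\in\Lambda\}$. For a measure $\mu$ and vector function $f$, $\mu(f)=(\int f_1d\mu,\dots,\int f_pd\mu)$. Constraint sets: $\mathcal H(g,\alpha)=\{\mu\in\mathcal M(\mathbf X\times\mathbf A):\mu(g)=\alpha\}$ (with $\mathcal M$ the finite signed measures), $\mathcal O(g,\alpha)=\mathcal O\cap\mathcal H(g,\alpha)$, $\mathcal O_\Lambda(g,\alpha)=\mathcal O_\Lambda\cap\mathcal H(g,\alpha)$. $\mathrm{ext}(\cdot)$ denotes the set of extreme points. *)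

theory Defs
  imports "HOL-Probability.Probability"
begin

text \<open>Path space Omega = (X x A)^infinity; a path is omega :: nat => 'x * 'a,
  with X_n = fst (omega n) and A_n = snd (omega n).\<close>

definition path_space :: "'x measure \<Rightarrow> 'a measure \<Rightarrow> (nat \<Rightarrow> 'x \<times> 'a) measure" where
  "path_space MX MA = PiM UNIV (\<lambda>_. MX \<Otimes>\<^sub>M MA)"

text \<open>History space H_n = X x (A x X)^n, represented (isomorphically) as
  (((x_0,a_0),...,(x_{n-1},a_{n-1})), x_n).\<close>

definition hist_space :: "'x measure \<Rightarrow> 'a measure \<Rightarrow> nat \<Rightarrow> ((nat \<Rightarrow> 'x \<times> 'a) \<times> 'x) measure" where
  "hist_space MX MA n = (PiM {..<n} (\<lambda>_. MX \<Otimes>\<^sub>M MA)) \<Otimes>\<^sub>M MX"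

definition hist :: "nat \<Rightarrow> (nat \<Rightarrow> 'x \<times> 'a) \<Rightarrow> (nat \<Rightarrow> 'x \<times> 'a) \<times> 'x" where
  "hist n \<omega> = (restrict \<omega> {..<n}, fst (\<omega> n))"

definition is_policy :: "'x measure \<Rightarrow> 'a measure \<Rightarrow> ('x \<Rightarrow> 'a set)
    \<Rightarrow> (nat \<Rightarrow> (nat \<Rightarrow> 'x \<times> 'a) \<times> 'x \<Rightarrow> 'a measure) \<Rightarrow> bool" where
  "is_policy MX MA Aset \<pi> \<longleftrightarrow>
     (\<forall>n. \<pi> n \<in> hist_space MX MA n \<rightarrow>\<^sub>M prob_algebra MA \<and>
          (\<forall>h\<in>space (hist_space MX MA n). emeasure (\<pi> n h) (Aset (snd h)) = 1))"

text \<open>P is the strategic probability measure P_pi: X_0 ~ eta,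
  P(A_n in . | H_n) = pi_n(. | H_n), P(X_{n+1} in . | H_n, A_n) = Q(. | X_n, A_n).
  The conditional distributions are expressed through their defining identities
  on generating rectangles.\<close>

definition is_strategic_measure :: "'x measure \<Rightarrow> 'a measure \<Rightarrow> ('x \<times> 'a \<Rightarrow> 'x measure)
    \<Rightarrow> 'x measure \<Rightarrow> (nat \<Rightarrow> (nat \<Rightarrow> 'x \<times> 'a) \<times> 'x \<Rightarrow> 'a measure)
    \<Rightarrow> (nat \<Rightarrow> 'x \<times> 'a) measure \<Rightarrow> bool" where
  "is_strategic_measure MX MA Q \<eta> \<pi> P \<longleftrightarrow>
     prob_space P \<and> sets P = sets (path_space MX MA) \<and>
     distr P MX (\<lambda>\<omega>. fst (\<omega> 0)) = \<eta> \<and>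
     (\<forall>n B C. B \<in> sets (hist_space MX MA n) \<longrightarrow> C \<in> sets MA \<longrightarrow>
        measure P {\<omega> \<in> space P. hist n \<omega> \<in> B \<and> snd (\<omega> n) \<in> C}
          = (\<integral>\<omega>. indicator B (hist n \<omega>) * measure (\<pi> n (hist n \<omega>)) C \<partial>P)) \<and>
     (\<forall>n B C D. B \<in> sets (hist_space MX MA n) \<longrightarrow> C \<in> sets MA \<longrightarrow> D \<in> sets MX \<longrightarrow>
        measure P {\<omega> \<in> space P. hist n \<omega> \<in> B \<and> snd (\<omega> n) \<in> C \<and> fst (\<omega> (Suc n)) \<in> D}
          = (\<integral>\<omega>. indicator B (hist n \<omega>) * indicator C (snd (\<omega> n)) * measure (Q (\<omega> n)) D \<partial>P))"

definition hit_time :: "'x set \<Rightarrow> (nat \<Rightarrow> 'x \<times> 'a) \<Rightarrow> enat" where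
  "hit_time \<Delta> \<omega> = (if \<exists>n. fst (\<omega> n) \<in> \<Delta> then enat (LEAST n. fst (\<omega> n) \<in> \<Delta>) else \<infinity>)"

definition is_model :: "'x measure \<Rightarrow> 'a::polish_space set \<Rightarrow> ('x \<Rightarrow> 'a set)
    \<Rightarrow> ('x \<times> 'a \<Rightarrow> 'x measure) \<Rightarrow> 'x measure \<Rightarrow> ('x \<times> 'a \<Rightarrow> real ^ 'd) \<Rightarrow> bool" where
  "is_model MX Asp Aset Q \<eta> r \<longleftrightarrow>
     Asp \<in> sets borel \<and>
     (\<forall>x\<in>space MX. Aset x \<noteq> {} \<and> Aset x \<subseteq> Asp \<and> Aset x \<in> sets borel) \<and>
     Q \<in> MX \<Otimes>\<^sub>M restrict_space borel Asp \<rightarrow>\<^sub>M prob_algebra MX \<and>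
     prob_space \<eta> \<and> sets \<eta> = sets MX \<and>
     r \<in> borel_measurable (MX \<Otimes>\<^sub>M restrict_space borel Asp) \<and>
     (\<exists>c. \<forall>z\<in>space MX \<times> Asp. norm (r z) \<le> c) \<and>
     {(x, a). x \<in> space MX \<and> a \<in> Aset x} \<in> sets (MX \<Otimes>\<^sub>M restrict_space borel Asp) \<and>
     (\<exists>\<theta>. \<theta> \<in> MX \<rightarrow>\<^sub>M restrict_space borel Asp \<and> (\<forall>x\<in>space MX. \<theta> x \<in> Aset x))"

definition is_absorbing :: "'x measure \<Rightarrow> 'a::polish_space set \<Rightarrow> ('x \<Rightarrow> 'a set)
    \<Rightarrow> ('x \<times> 'a \<Rightarrow> 'x measure) \<Rightarrow> 'x measure \<Rightarrow> ('x \<times> 'a \<Rightarrow> real ^ 'd) \<Rightarrow> 'x set \<Rightarrow> bool" where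
  "is_absorbing MX Asp Aset Q \<eta> r \<Delta> \<longleftrightarrow>
     \<Delta> \<in> sets MX \<and>
     (\<forall>x\<in>\<Delta>. \<forall>a\<in>Asp. emeasure (Q (x, a)) \<Delta> = 1 \<and> r (x, a) = 0) \<and>
     (\<forall>\<pi> P. is_policy MX (restrict_space borel Asp) Aset \<pi> \<longrightarrow>
        is_strategic_measure MX (restrict_space borel Asp) Q \<eta> \<pi> P \<longrightarrow>
        (\<integral>\<^sup>+\<omega>. ennreal_of_enat (hit_time \<Delta> \<omega>) \<partial>P) < \<infinity>)"

definition occ_measure :: "'x measure \<Rightarrow> 'a measure \<Rightarrow> 'x set \<Rightarrow> (nat \<Rightarrow> 'x \<times> 'a) measure
    \<Rightarrow> ('x \<times> 'a) measure" where
  "occ_measure MX MA \<Delta> P = measure_of (space (MX \<Otimes>\<^sub>M MA)) (sets (MX \<Otimes>\<^sub>M MA))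
     (\<lambda>\<Gamma>. \<integral>\<^sup>+\<omega>. (\<Sum>t. indicator {\<omega>. enat t < hit_time \<Delta> \<omega> \<and> \<omega> t \<in> \<Gamma>} \<omega>) \<partial>P)"

definition occ_set :: "'x measure \<Rightarrow> 'a measure \<Rightarrow> ('x \<Rightarrow> 'a set) \<Rightarrow> ('x \<times> 'a \<Rightarrow> 'x measure)
    \<Rightarrow> 'x measure \<Rightarrow> 'x set \<Rightarrow> ('x \<times> 'a) measure set" where
  "occ_set MX MA Aset Q \<eta> \<Delta> =
     {occ_measure MX MA \<Delta> P | \<pi> P. is_policy MX MA Aset \<pi> \<and> is_strategic_measure MX MA Q \<eta> \<pi> P}"

definition is_chattering :: "'x measure \<Rightarrow> 'a measure \<Rightarrow> ('x \<Rightarrow> 'a set) \<Rightarrow> nat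
    \<Rightarrow> ('x \<Rightarrow> 'a measure) \<Rightarrow> bool" where
  "is_chattering MX MA Aset q \<phi> \<longleftrightarrow>
     \<phi> \<in> MX \<rightarrow>\<^sub>M prob_algebra MA \<and>
     (\<forall>x\<in>space MX. emeasure (\<phi> x) (Aset x) = 1) \<and>
     (\<exists>f \<beta>. (\<forall>i<q. f i \<in> MX \<rightarrow>\<^sub>M MA \<and> \<beta> i \<in> borel_measurable MX) \<and>
        (\<forall>x\<in>space MX. (\<forall>i<q. 0 \<le> \<beta> i x) \<and> (\<Sum>i<q. \<beta> i x) = 1 \<and>
           (\<forall>C\<in>sets MA. measure (\<phi> x) C = (\<Sum>i<q. \<beta> i x * indicator C (f i x)))))"

definition occ_set_chattering :: "'x measure \<Rightarrow> 'a measure \<Rightarrow> ('x \<Rightarrow> 'a set) \<Rightarrow> ('x \<times> 'a \<Rightarrow> 'x measure)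
    \<Rightarrow> 'x measure \<Rightarrow> 'x set \<Rightarrow> nat \<Rightarrow> ('x \<times> 'a) measure set" where
  "occ_set_chattering MX MA Aset Q \<eta> \<Delta> q =
     {occ_measure MX MA \<Delta> P | \<phi> P. is_chattering MX MA Aset q \<phi> \<and>
        is_strategic_measure MX MA Q \<eta> (\<lambda>n h. \<phi> (snd h)) P}"

definition constr_set :: "nat \<Rightarrow> (nat \<Rightarrow> 'b \<Rightarrow> real) \<Rightarrow> (nat \<Rightarrow> real) \<Rightarrow> 'b measure set" where
  "constr_set p g \<alpha> = {\<mu>. \<forall>i<p. (\<integral>z. g i z \<partial>\<mu>) = \<alpha> i}"

text \<open>Convex combinations of (finite) measures on a common sigma-algebra, as in the
  vector space of finite signed measures.\<close>

definition is_mix :: "'b measure \<Rightarrow> 'b measure \<Rightarrow> real \<Rightarrow> 'b measure \<Rightarrow> 'b measure \<Rightarrow> bool" where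
  "is_mix M \<mu> t \<mu>1 \<mu>2 \<longleftrightarrow>
     (\<forall>\<Gamma>\<in>sets M. emeasure \<mu> \<Gamma> = ennreal t * emeasure \<mu>1 \<Gamma> + ennreal (1 - t) * emeasure \<mu>2 \<Gamma>)"

definition ext_points :: "'b measure \<Rightarrow> 'b measure set \<Rightarrow> 'b measure set" where
  "ext_points M S = {\<mu> \<in> S. \<not> (\<exists>\<mu>1\<in>S. \<exists>\<mu>2\<in>S. \<exists>t. 0 < t \<and> t < 1 \<and> \<mu>1 \<noteq> \<mu>2 \<and> is_mix M \<mu> t \<mu>1 \<mu>2)}"

end

theory Submission
  imports Defs "HOL-Library.Function_Algebras"
begin

text \<open>
  Dubins' theorem bounds the number of extreme points needed to represent an extreme point of a
  section of a convex set by \<open>p\<close> hyperplanes, provided the set meets every line in a compact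
  segment. No topology on the set of occupation measures is needed for this: a finite measure that
  solves the characteristic equation and is dominated by a multiple of occupation measures is itself
  an occupation measure. Indeed, disintegrate it along a kernel \<open>\<phi>\<close>; what is left of its state
  marginal after \<open>k\<close> steps of \<open>\<phi>\<close> is bounded by a sum over \<open>m\<close> of the survival probabilities of the
  policies that switch to \<open>\<phi>\<close> at time \<open>m\<close>. Each of these vanishes as \<open>k\<close> grows, because the model
  is absorbing under that policy, and dominated convergence applies.

  An extreme occupation measure is deterministic: tilting its kernel at a single time \<open>n\<close> by the
  densities \<open>1 \<plusminus> (c a - E c)\<close>, where \<open>c\<close> is an injective real coding of the actions, splits it
  as a midpoint, so the conditional variance of \<open>c\<close> vanishes. A mixture of \<open>p + 1\<close> deterministic
  occupation measures then disintegrates along a chattering kernel of order \<open>p + 1\<close>.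
\<close>


section \<open>Disintegration over a standard Borel space\<close>

text \<open>Actions enter only through an injective measurable coding into [0,1] with a measurable
  decoder, so conditional laws reduce to distribution functions on the line. Occupation measures
  enter Dubins' theorem as vectors of set values, so that rays and functionals make sense
  coordinatewise. The obstacle is to show that rays end. A point beyond \<nu> on the ray from \<mu>
  is a difference of measures; while it is nonnegative, it satisfies the same linear equation and
  stays below a multiple of \<mu> + \<nu>. If nonnegativity never failed, \<mu> would lie below
  \<nu>, and \<nu> - \<mu> would solve the homogeneous equation; the iteration that gives uniqueness
  then forces it to vanish. Equations are tested only on functions below the indicator of the
  complement of \<Delta>. This keeps integrals finite, so that terms can be cancelled in
  \<open>ennreal\<close>; negative coefficients are moved to the other side. Passing to Markov
  policies loses nothing: since \<Delta> is absorbing, the occupation measure depends only on the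
  laws of the pairs (X_n, A_n).\<close>

lemma base4_digit:
  fixes b :: "nat \<Rightarrow> nat"
  assumes b: "\<And>i. b i \<le> 1"
  shows "odd \<lfloor>4 ^ Suc j * (\<Sum>i. real (b i) * (1/4) ^ Suc i)\<rfloor> \<longleftrightarrow> b j = 1"
proof -
  let ?t = "\<lambda>i. real (b i) * (1/4) ^ Suc i"
  have sm: "summable ?t"
  proof (rule summable_comparison_test')
    show "summable (\<lambda>i. (1/4::real) ^ Suc i)"
      by (subst summable_Suc_iff) (simp add: summable_geometric)
    show "norm (?t i) \<le> (1/4) ^ Suc i" if "0 \<le> i" for i
    proof -
      have "real (b i) \<le> 1" using b[of i] by simp
      then show ?thesis by (simp add: mult_left_le_one_le abs_mult)
    qed
  qed
  \<comment> \<open>\<open>N k\<close> is the integer with base-4 digits \<open>b 0\<close>, ...,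
    \<open>b k\<close>; all digits but the last contribute a multiple of 4, so its parity reads off
    \<open>b k\<close>.\<close>
  define N where "N = rec_nat (b 0) (\<lambda>j n. 4 * n + b (Suc j))"
  have N: "4 ^ Suc k * (\<Sum>i<Suc k. ?t i) = real (N k)" for k
  proof (induction k)
    case (Suc k)
    have "4 ^ Suc (Suc k) * (\<Sum>i<Suc (Suc k). ?t i)
        = 4 * (4 ^ Suc k * (\<Sum>i<Suc k. ?t i)) + 4 ^ Suc (Suc k) * ?t (Suc k)"
      by (simp add: algebra_simps)
    also have "4 ^ Suc (Suc k) * ?t (Suc k) = real (b (Suc k))"
      by (simp add: power_one_over)
    finally show ?case using Suc by (simp add: N_def)
  qed (simp add: N_def)
  have oddN: "odd (N k) \<longleftrightarrow> b k = 1" for k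
    using b[of k] by (cases k) (auto simp: N_def le_Suc_eq)
  define T where "T = 4 ^ Suc j * (\<Sum>i. ?t (i + Suc j))"
  have split: "4 ^ Suc j * (\<Sum>i. ?t i) = real (N j) + T"
    unfolding T_def N[symmetric] by (subst suminf_split_initial_segment[OF sm, of "Suc j"]) (simp add: algebra_simps)
  have sm': "summable (\<lambda>i. ?t (i + Suc j))"
    using sm by (rule summable_ignore_initial_segment)
  have T0: "0 \<le> T"
    unfolding T_def by (intro mult_nonneg_nonneg suminf_nonneg sm') auto
  \<comment> \<open>The scaled tail is at most 1/3. Digits 0 and 1 in base 4 leave this gap below 1,
    so the floor is exact even when all later digits are 1.\<close>
  have geo: "(\<lambda>i. (1/4::real) ^ Suc (i + Suc j)) sums ((1/4) ^ Suc (Suc j) * (1 / (1 - 1/4)))"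
    using sums_mult[OF geometric_sums[of "1/4::real"], of "(1/4) ^ Suc (Suc j)"]
    by (simp add: power_add mult_ac)
  have "(\<Sum>i. ?t (i + Suc j)) \<le> (\<Sum>i. (1/4::real) ^ Suc (i + Suc j))"
  proof (intro suminf_le sm' sums_summable[OF geo])
    show "?t (i + Suc j) \<le> (1/4) ^ Suc (i + Suc j)" for i
      using b[of "i + Suc j"] by (intro mult_left_le_one_le) auto
  qed
  also have "\<dots> = (1/4) ^ Suc (Suc j) * (4/3)"
    using sums_unique[OF geo] by simp
  finally have "T \<le> 4 ^ Suc j * ((1/4) ^ Suc (Suc j) * (4/3))"
    unfolding T_def by (intro mult_left_mono) auto
  also have "\<dots> < 1" by (simp add: power_one_over)
  finally have "\<lfloor>4 ^ Suc j * (\<Sum>i. ?t i)\<rfloor> = int (N j)"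
    unfolding split using T0 by (intro floor_unique) auto
  then show ?thesis using oddN[of j] by simp
qed

text \<open>The point \<open>a\<close> is encoded by the base-4 expansion whose digits record which balls
  \<open>ball (d n) (1/2^k)\<close> around a dense sequence contain it; the decoder recovers \<open>a\<close> as a limit
  of centres, so no measurability of images is needed.\<close>

lemma polish_real_coding:
  fixes A :: "'a::polish_space set"
  assumes A: "A \<in> sets borel" "A \<noteq> {}"
  obtains f :: "'a \<Rightarrow> real" and g :: "real \<Rightarrow> 'a"
  where "f \<in> borel_measurable (restrict_space borel A)" "\<And>a. 0 \<le> f a" "\<And>a. f a \<le> 1"
    "g \<in> borel \<rightarrow>\<^sub>M restrict_space borel A" "\<And>a. a \<in> A \<Longrightarrow> g (f a) = a"
proof -
  obtain D :: "'a set" where D: "countable D" "\<And>X. open X \<Longrightarrow> X \<noteq> {} \<Longrightarrow> \<exists>d\<in>D. d \<in> X"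
    by (rule countable_dense_setE) blast
  have "D \<noteq> {}" using D(2)[of UNIV] by auto
  define d where "d = from_nat_into D"
  have dense: "\<exists>n. dist (d n) a < e" if "0 < e" for a e
  proof -
    have "ball a e \<noteq> {}" using that by simp
    then obtain x where "x \<in> D" "x \<in> ball a e" using D(2)[of "ball a e"] by blast
    then show ?thesis using from_nat_into_surj[OF D(1), of x] by (auto simp: d_def dist_commute)
  qed
  obtain a0 where a0: "a0 \<in> A" using A by auto
  define b :: "nat \<Rightarrow> 'a \<Rightarrow> nat" where
    "b j a = of_bool (dist (d (snd (prod_decode j))) a < (1/2) ^ fst (prod_decode j))" for j a
  define f where "f a = (\<Sum>i. real (b i a) * (1/4::real) ^ Suc i)" for a
  define bit where "bit j u \<longleftrightarrow> odd \<lfloor>4 ^ Suc j * (u::real)\<rfloor>" for j u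
  \<comment> \<open>\<open>c k u\<close> is the first centre whose ball of radius
    \<open>(1/2) ^ k\<close> is recorded in \<open>u\<close>; for \<open>u = f a\<close> one exists
    by density and lies within \<open>(1/2) ^ k\<close> of \<open>a\<close>.\<close>
  define c where "c k u = d (LEAST n. bit (prod_encode (k, n)) u)" for k u
  \<comment> \<open>On codes whose centres are not Cauchy the sequence is replaced by a constant, so
    \<open>h\<close> converges everywhere and its limit is measurable.\<close>
  define h where "h k u = (if Cauchy (\<lambda>k. c k u) then c k u else a0)" for k u
  define G where "G u = lim (\<lambda>k. h k u)" for u
  \<comment> \<open>Limits outside \<open>A\<close> are sent to \<open>a0\<close>, so that the
    decoder takes values in \<open>A\<close> on the whole line.\<close>
  define g where "g u = (if G u \<in> A then G u else a0)" for u
  have [measurable]: "b j \<in> borel \<rightarrow>\<^sub>M count_space UNIV" for j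
    unfolding b_def by measurable
  have f_meas: "f \<in> borel_measurable borel"
    unfolding f_def by measurable
  have b1: "b i a \<le> 1" for i a by (simp add: b_def)
  have geo: "(\<lambda>i. (1/4::real) ^ Suc i) sums (1/3)"
    using sums_mult[OF geometric_sums[of "1/4::real"], of "1/4"] by simp
  have tle: "real (b i a) * (1/4::real) ^ Suc i \<le> (1/4) ^ Suc i" for i a
    using b1[of i a] by (intro mult_left_le_one_le) auto
  have sm: "summable (\<lambda>i. real (b i a) * (1/4::real) ^ Suc i)" for a
    by (rule summable_comparison_test'[OF sums_summable[OF geo], of 0]) (use tle in auto)
  have f0: "0 \<le> f a" for a unfolding f_def by (intro suminf_nonneg sm) auto
  have f1: "f a \<le> 1" for a
  proof -
    have "f a \<le> (\<Sum>i. (1/4::real) ^ Suc i)"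
      unfolding f_def by (intro suminf_le sm tle sums_summable[OF geo])
    then show ?thesis using sums_unique[OF geo] by simp
  qed
  have [measurable]: "Measurable.pred borel (bit j)" for j
  proof -
    have "Measurable.pred borel (\<lambda>u. odd \<lfloor>4 ^ Suc j * (u::real)\<rfloor>)" by measurable
    then show ?thesis by (simp add: bit_def[abs_def])
  qed
  have bit: "bit j (f a) \<longleftrightarrow> b j a = 1" for j a
    unfolding bit_def f_def by (rule base4_digit) (rule b1)
  have bit': "bit (prod_encode (k, n)) (f a) \<longleftrightarrow> dist (d n) a < (1/2) ^ k" for k n a
    by (simp add: bit b_def of_bool_def)
  have c_meas[measurable]: "c k \<in> borel_measurable borel" for k
  proof -
    have "(\<lambda>u. LEAST n. bit (prod_encode (k, n)) u) \<in> borel \<rightarrow>\<^sub>M count_space UNIV"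
      by measurable
    from measurable_compose[OF this, of d borel] show ?thesis by (simp add: c_def[abs_def])
  qed
  have Cauchy_meas[measurable]: "Measurable.pred borel (\<lambda>u. Cauchy (\<lambda>k. c k u))"
    by measurable
  have h_meas: "h k \<in> borel_measurable borel" for k
    unfolding h_def by measurable
  have h_lim: "(\<lambda>k. h k u) \<longlonglongrightarrow> G u" for u
    unfolding G_def h_def
    by (cases "Cauchy (\<lambda>k. c k u)") (auto simp: convergent_LIMSEQ_iff[symmetric] Cauchy_convergent_iff)
  have [measurable]: "G \<in> borel_measurable borel"
    by (rule borel_measurable_LIMSEQ_metric[OF h_meas h_lim])
  have "g \<in> borel_measurable borel"
    unfolding g_def using A(1) by measurable
  then have g_meas: "g \<in> borel \<rightarrow>\<^sub>M restrict_space borel A"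
    by (intro measurable_restrict_space2) (auto simp: g_def a0)
  have Gf: "G (f a) = a" for a
  proof -
    have dist: "dist (c k (f a)) a < (1/2) ^ k" for k
    proof -
      obtain n where n: "dist (d n) a < (1/2) ^ k" using dense[of "(1/2)^k" a] by auto
      then have "bit (prod_encode (k, n)) (f a)" by (simp add: bit')
      then have "bit (prod_encode (k, LEAST n. bit (prod_encode (k, n)) (f a))) (f a)" by (rule LeastI)
      then show ?thesis by (simp add: bit' c_def)
    qed
    have "(\<lambda>k. dist (c k (f a)) a) \<longlonglongrightarrow> 0"
    proof (rule tendsto_sandwich[OF _ _ tendsto_const])
      show "(\<lambda>k. (1/2::real) ^ k) \<longlonglongrightarrow> 0" by (intro LIMSEQ_power_zero) simp
      show "\<forall>\<^sub>F k in sequentially. dist (c k (f a)) a \<le> (1/2) ^ k"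
        by (intro always_eventually allI less_imp_le dist)
    qed simp
    then have lim: "(\<lambda>k. c k (f a)) \<longlonglongrightarrow> a" by (rule tendsto_dist_iff[THEN iffD2])
    then have "Cauchy (\<lambda>k. c k (f a))" by (rule LIMSEQ_imp_Cauchy)
    then show ?thesis using limI[OF lim] by (simp add: G_def h_def)
  qed
  show thesis
  proof (rule that[of f g])
    show "f \<in> borel_measurable (restrict_space borel A)"
      using f_meas by (rule measurable_restrict_space1)
    show "g (f a) = a" if "a \<in> A" for a using that by (simp add: g_def Gf)
  qed (fact f0 f1 g_meas)+
qed

text \<open>The semidirect product m(dx) \<phi>(da|x): the laws of (x, a) for fixed x are integrated
  against \<open>m\<close>. The argument \<open>N\<close> supplies the product
  sigma-algebra.\<close>

definition ksemi :: "('x \<times> 'a) measure \<Rightarrow> 'x measure \<Rightarrow> ('x \<Rightarrow> 'a measure) \<Rightarrow> ('x \<times> 'a) measure" where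
  "ksemi N m \<phi> = m \<bind> (\<lambda>x. distr (\<phi> x) N (Pair x))"

lemma measurable_ksemi_kernel:
  assumes "sets m = sets M" "\<phi> \<in> M \<rightarrow>\<^sub>M prob_algebra A"
  shows "(\<lambda>x. distr (\<phi> x) (M \<Otimes>\<^sub>M A) (Pair x)) \<in> m \<rightarrow>\<^sub>M prob_algebra (M \<Otimes>\<^sub>M A)"
proof -
  have [measurable]: "\<phi> \<in> M \<rightarrow>\<^sub>M prob_algebra A" by fact
  have "(\<lambda>x. distr (\<phi> x) (M \<Otimes>\<^sub>M A) (Pair x)) \<in> M \<rightarrow>\<^sub>M prob_algebra (M \<Otimes>\<^sub>M A)" by measurable
  then show ?thesis using assms(1) by (simp cong: measurable_cong_sets)
qed

lemma sets_ksemi: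
  assumes "sets m = sets M" "\<phi> \<in> M \<rightarrow>\<^sub>M prob_algebra A" "space M \<noteq> {}"
  shows "sets (ksemi (M \<Otimes>\<^sub>M A) m \<phi>) = sets (M \<Otimes>\<^sub>M A)"
  unfolding ksemi_def using assms(3) sets_eq_imp_space_eq[OF assms(1)] by (subst sets_bind) auto

lemma nn_integral_ksemi:
  assumes m: "sets m = sets M" and \<phi>: "\<phi> \<in> M \<rightarrow>\<^sub>M prob_algebra A"
    and f[measurable]: "f \<in> borel_measurable (M \<Otimes>\<^sub>M A)"
  shows "(\<integral>\<^sup>+z. f z \<partial>ksemi (M \<Otimes>\<^sub>M A) m \<phi>) = (\<integral>\<^sup>+x. \<integral>\<^sup>+a. f (x, a) \<partial>\<phi> x \<partial>m)"
  unfolding ksemi_def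
proof (subst nn_integral_bind[OF f measurable_prob_algebraD[OF measurable_ksemi_kernel[OF m \<phi>]]],
    intro nn_integral_cong)
  fix x assume "x \<in> space m"
  then have x: "x \<in> space M" using sets_eq_imp_space_eq[OF m] by simp
  then have s: "sets (\<phi> x) = sets A" using measurable_space[OF \<phi>, of x] by (simp add: space_prob_algebra)
  show "(\<integral>\<^sup>+z. f z \<partial>distr (\<phi> x) (M \<Otimes>\<^sub>M A) (Pair x)) = (\<integral>\<^sup>+a. f (x, a) \<partial>\<phi> x)"
    using x s by (subst nn_integral_distr) (auto cong: measurable_cong_sets)
qed

lemma emeasure_ksemi:
  assumes m: "sets m = sets M" and \<phi>: "\<phi> \<in> M \<rightarrow>\<^sub>M prob_algebra A" and "space M \<noteq> {}"
    and \<Gamma>: "\<Gamma> \<in> sets (M \<Otimes>\<^sub>M A)"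
  shows "emeasure (ksemi (M \<Otimes>\<^sub>M A) m \<phi>) \<Gamma> = (\<integral>\<^sup>+x. emeasure (\<phi> x) {a \<in> space A. (x, a) \<in> \<Gamma>} \<partial>m)"
proof -
  have "emeasure (ksemi (M \<Otimes>\<^sub>M A) m \<phi>) \<Gamma> = (\<integral>\<^sup>+z. indicator \<Gamma> z \<partial>ksemi (M \<Otimes>\<^sub>M A) m \<phi>)"
    using \<Gamma> sets_ksemi[OF assms(1-3)] by (subst nn_integral_indicator) auto
  also have "\<dots> = (\<integral>\<^sup>+x. \<integral>\<^sup>+a. indicator \<Gamma> (x, a) \<partial>\<phi> x \<partial>m)"
    using \<Gamma> by (intro nn_integral_ksemi m \<phi>) auto
  also have "\<dots> = (\<integral>\<^sup>+x. emeasure (\<phi> x) {a \<in> space A. (x, a) \<in> \<Gamma>} \<partial>m)"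
  proof (intro nn_integral_cong)
    fix x assume "x \<in> space m"
    then have x: "x \<in> space M" using sets_eq_imp_space_eq[OF m] by simp
    then have s: "sets (\<phi> x) = sets A" using measurable_space[OF \<phi>, of x] by (simp add: space_prob_algebra)
    have "{a \<in> space A. (x, a) \<in> \<Gamma>} = Pair x -` \<Gamma>"
      using sets.sets_into_space[OF \<Gamma>] by (auto simp: space_pair_measure)
    then have "{a \<in> space A. (x, a) \<in> \<Gamma>} \<in> sets (\<phi> x)" using \<Gamma> s by (simp add: sets_Pair1)
    then have "(\<integral>\<^sup>+a. indicator {a \<in> space A. (x, a) \<in> \<Gamma>} a \<partial>\<phi> x) = emeasure (\<phi> x) {a \<in> space A. (x, a) \<in> \<Gamma>}"
      by (rule nn_integral_indicator)
    moreover have "(\<integral>\<^sup>+a. indicator \<Gamma> (x, a) \<partial>\<phi> x) = (\<integral>\<^sup>+a. indicator {a \<in> space A. (x, a) \<in> \<Gamma>} a \<partial>\<phi> x)"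
      using sets_eq_imp_space_eq[OF s] by (intro nn_integral_cong) (auto split: split_indicator)
    ultimately show "(\<integral>\<^sup>+a. indicator \<Gamma> (x, a) \<partial>\<phi> x) = emeasure (\<phi> x) {a \<in> space A. (x, a) \<in> \<Gamma>}" by simp
  qed
  finally show ?thesis .
qed

lemma distr_fst_ksemi:
  assumes m: "sets m = sets M" and \<phi>: "\<phi> \<in> M \<rightarrow>\<^sub>M prob_algebra A" and ne: "space M \<noteq> {}"
  shows "distr (ksemi (M \<Otimes>\<^sub>M A) m \<phi>) M fst = m"
proof (rule measure_eqI)
  fix D assume "D \<in> sets (distr (ksemi (M \<Otimes>\<^sub>M A) m \<phi>) M fst)"
  then have D: "D \<in> sets M" by simp
  note [measurable_cong] = sets_ksemi[OF assms]
  have "emeasure (distr (ksemi (M \<Otimes>\<^sub>M A) m \<phi>) M fst) D = (\<integral>\<^sup>+z. indicator D (fst z) \<partial>ksemi (M \<Otimes>\<^sub>M A) m \<phi>)"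
    using D by (subst nn_integral_indicator[symmetric], simp, subst nn_integral_distr) auto
  also have "\<dots> = (\<integral>\<^sup>+x. \<integral>\<^sup>+a. indicator D x \<partial>\<phi> x \<partial>m)"
    using D by (subst nn_integral_ksemi[OF m \<phi>]) auto
  also have "\<dots> = (\<integral>\<^sup>+x. indicator D x \<partial>m)"
  proof (intro nn_integral_cong)
    fix x assume "x \<in> space m"
    then have "x \<in> space M" using sets_eq_imp_space_eq[OF m] by simp
    then have "prob_space (\<phi> x)" using measurable_space[OF \<phi>, of x] by (simp add: space_prob_algebra)
    then show "(\<integral>\<^sup>+a. indicator D x \<partial>\<phi> x) = indicator D x" by (simp add: prob_space.emeasure_space_1)
  qed
  finally show "emeasure (distr (ksemi (M \<Otimes>\<^sub>M A) m \<phi>) M fst) D = emeasure m D" using D m by simp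
qed (simp add: m)

text \<open>Rectangles are stable under intersection and generate the product sigma-algebra, and
  \<open>l\<close> is finite on the whole space. This is the criterion by which the disintegrations
  below are verified.\<close>

lemma ksemi_eqI:
  assumes m: "sets m = sets M" and \<phi>: "\<phi> \<in> M \<rightarrow>\<^sub>M prob_algebra A" and ne: "space M \<noteq> {}"
    and l: "sets l = sets (M \<Otimes>\<^sub>M A)" "finite_measure l"
    and rect: "\<And>D C. D \<in> sets M \<Longrightarrow> C \<in> sets A \<Longrightarrow>
      emeasure l (D \<times> C) = (\<integral>\<^sup>+x. indicator D x * emeasure (\<phi> x) C \<partial>m)"
  shows "l = ksemi (M \<Otimes>\<^sub>M A) m \<phi>"
proof (rule measure_eqI_generator_eq[where E="{a \<times> b | a b. a \<in> sets M \<and> b \<in> sets A}"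
      and \<Omega>="space M \<times> space A" and A="\<lambda>_. space M \<times> space A"])
  show "Int_stable {a \<times> b |a b. a \<in> sets M \<and> b \<in> sets A}" by (rule Int_stable_pair_measure_generator)
  show "{a \<times> b |a b. a \<in> sets M \<and> b \<in> sets A} \<subseteq> Pow (space M \<times> space A)"
    by (rule pair_measure_closed)
  show "emeasure l X = emeasure (ksemi (M \<Otimes>\<^sub>M A) m \<phi>) X"
    if "X \<in> {a \<times> b |a b. a \<in> sets M \<and> b \<in> sets A}" for X
  proof -
    from that obtain D C where X: "X = D \<times> C" and [measurable]: "D \<in> sets M" "C \<in> sets A" by auto
    have "emeasure (\<phi> x) {a \<in> space A. (x, a) \<in> D \<times> C} = indicator D x * emeasure (\<phi> x) C" for x
    proof -
      have "{a \<in> space A. (x, a) \<in> D \<times> C} = (if x \<in> D then C else {})"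
        using sets.sets_into_space[OF \<open>C \<in> sets A\<close>] by auto
      then show ?thesis by auto
    qed
    then show ?thesis by (simp add: X rect emeasure_ksemi[OF m \<phi> ne])
  qed
  show "emeasure l (space M \<times> space A) \<noteq> \<infinity>" using l by (simp add: finite_measure.emeasure_finite)
qed (auto simp: l sets_ksemi[OF m \<phi> ne] sets_pair_measure)

text \<open>On the set \<open>D\<close> where \<open>g < f\<close>, the nonnegative function
  \<open>f - g\<close> integrates to 0; finiteness of the integral of \<open>f\<close> allows the
  integral of the difference to be split.\<close>

lemma AE_le_of_set_nn_integral_le:
  fixes f g :: "'b \<Rightarrow> ennreal"
  assumes [measurable]: "f \<in> borel_measurable M" "g \<in> borel_measurable M"
    and fin: "(\<integral>\<^sup>+x. f x \<partial>M) < \<infinity>"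
    and le: "\<And>D. D \<in> sets M \<Longrightarrow> (\<integral>\<^sup>+x. f x * indicator D x \<partial>M) \<le> (\<integral>\<^sup>+x. g x * indicator D x \<partial>M)"
  shows "AE x in M. f x \<le> g x"
proof -
  define D where "D = {x \<in> space M. g x < f x}"
  have [measurable]: "D \<in> sets M" unfolding D_def by measurable
  have fD: "(\<integral>\<^sup>+x. f x * indicator D x \<partial>M) \<le> (\<integral>\<^sup>+x. f x \<partial>M)"
    by (intro nn_integral_mono) (auto split: split_indicator)
  have gD: "(\<integral>\<^sup>+x. g x * indicator D x \<partial>M) \<le> (\<integral>\<^sup>+x. f x * indicator D x \<partial>M)"
    by (intro nn_integral_mono) (auto simp: D_def split: split_indicator)
  have "(\<integral>\<^sup>+x. f x * indicator D x - g x * indicator D x \<partial>M)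
      = (\<integral>\<^sup>+x. f x * indicator D x \<partial>M) - (\<integral>\<^sup>+x. g x * indicator D x \<partial>M)"
    using fD gD fin by (intro nn_integral_diff) (auto simp: D_def top_unique split: split_indicator)
  also have "\<dots> = 0"
    using le[of D] fD fin by (intro diff_eq_0_ennreal) auto
  finally have "AE x in M. f x * indicator D x - g x * indicator D x = 0"
    by (subst (asm) nn_integral_0_iff_AE) auto
  with AE_space show ?thesis
  proof eventually_elim
    case (elim x)
    then have "x \<in> D \<Longrightarrow> f x \<le> g x" by (auto simp: diff_eq_0_iff_ennreal)
    then show ?case using elim(1) by (cases "g x < f x") (auto simp: D_def)
  qed
qed

section \<open>Conditional distribution functions on the unit interval\<close>

lemma rational_sequence_decreasing_to:
  obtains q :: "nat \<Rightarrow> real" where "\<And>n. q n \<in> \<rat>" "\<And>n. t < q n" "q \<longlonglongrightarrow> t"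
proof -
  have "\<exists>q\<in>\<rat>. t < q \<and> q < t + 1 / real (Suc n)" for n
    by (rule Rats_dense_in_real) simp
  then obtain q where q: "q n \<in> \<rat>" "t < q n" "q n < t + 1 / real (Suc n)" for n by metis
  have "q \<longlonglongrightarrow> t"
  proof (rule tendsto_sandwich[OF _ _ tendsto_const])
    show "(\<lambda>n. t + 1 / real (Suc n)) \<longlonglongrightarrow> t"
      using tendsto_add[OF tendsto_const[of t] LIMSEQ_Suc[OF lim_1_over_n]] by simp
  qed (use q in \<open>auto intro!: always_eventually less_imp_le\<close>)
  with q that show thesis by blast
qed

text \<open>Conditional distribution functions: the densities \<open>h q\<close> of \<open>D \<mapsto> l (D \<times> {..q})\<close> at rational
  levels are almost everywhere monotone in \<open>q\<close>, and their right limits are distribution functions.\<close>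

lemma real_disintegration:
  fixes l :: "('x \<times> real) measure"
  assumes l: "finite_measure l" "sets l = sets (M \<Otimes>\<^sub>M borel)" and ne: "space M \<noteq> {}"
    and supp: "AE z in l. 0 \<le> snd z \<and> snd z \<le> 1"
  obtains \<kappa> where "\<kappa> \<in> M \<rightarrow>\<^sub>M prob_algebra borel" "l = ksemi (M \<Otimes>\<^sub>M borel) (distr l M fst) \<kappa>"
proof -
  interpret l: finite_measure l by fact
  note [measurable_cong] = l(2)
  define m where "m = distr l M fst"
  have sets_m[measurable_cong, simp]: "sets m = sets M" by (simp add: m_def)
  have space_m[simp]: "space m = space M" by (simp add: m_def)
  have space_l: "space l = space M \<times> UNIV" using sets_eq_imp_space_eq[OF l(2)] by (simp add: space_pair_measure)
  interpret m: finite_measure m unfolding m_def by (rule l.finite_measure_distr) measurable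
  have em: "emeasure m D = emeasure l (D \<times> UNIV)" if "D \<in> sets M" for D
  proof -
    have "fst -` D \<inter> space l = D \<times> UNIV" using sets.sets_into_space[OF that] by (auto simp: space_l)
    then show ?thesis using that by (simp add: m_def emeasure_distr)
  qed
  define \<nu> where "\<nu> q = distr (density l (indicator (space M \<times> {..q}))) M fst" for q :: real
  have [measurable]: "space M \<times> {..q} \<in> sets l" for q :: real by (simp add: l(2))
  have e\<nu>: "emeasure (\<nu> q) D = emeasure l (D \<times> {..q})" if [measurable]: "D \<in> sets M" for q D
  proof -
    have [measurable]: "D \<times> {..q} \<in> sets l" by (simp add: l(2))
    have 1: "fst -` D \<inter> space l = D \<times> UNIV" using sets.sets_into_space[OF that] by (auto simp: space_l)
    have "emeasure (\<nu> q) D = (\<integral>\<^sup>+z. indicator (space M \<times> {..q}) z * indicator (D \<times> UNIV) z \<partial>l)"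
      unfolding \<nu>_def using that
      by (subst emeasure_distr) (auto simp: 1 l(2) emeasure_density measurable_cong_sets[OF sets_density refl])
    also have "\<dots> = (\<integral>\<^sup>+z. indicator (D \<times> {..q}) z \<partial>l)"
      using sets.sets_into_space[OF that] by (intro nn_integral_cong) (auto split: split_indicator)
    finally show ?thesis by simp
  qed
  define h where "h q = RN_deriv m (\<nu> q)" for q
  have [measurable]: "h q \<in> borel_measurable M" for q
    using borel_measurable_RN_deriv[of m "\<nu> q"] by (simp add: h_def)
  have hint: "(\<integral>\<^sup>+x. h q x * indicator D x \<partial>m) = emeasure l (D \<times> {..q})" if D: "D \<in> sets M" for q D
  proof -
    have "absolutely_continuous m (\<nu> q)"
      unfolding absolutely_continuous_def null_sets_def
    proof (clarsimp simp: \<nu>_def[THEN arg_cong, of sets])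
      fix D assume D: "D \<in> sets M" "emeasure m D = 0"
      have "emeasure l (D \<times> {..q}) \<le> emeasure l (D \<times> UNIV)"
        using D by (intro emeasure_mono) (auto simp: l(2))
      then show "emeasure (\<nu> q) D = 0" using D by (simp add: e\<nu> em)
    qed
    then have "density m (h q) = \<nu> q" unfolding h_def by (rule m.density_RN_deriv) (simp add: \<nu>_def)
    then have "emeasure (\<nu> q) D = (\<integral>\<^sup>+x. h q x * indicator D x \<partial>m)"
      using D by (metis emeasure_density \<open>h q \<in> borel_measurable M\<close> measurable_cong_sets sets_m)
    then show ?thesis by (simp add: e\<nu>[OF D])
  qed
  have hfin: "(\<integral>\<^sup>+x. h q x \<partial>m) < \<infinity>" for q
  proof -
    have "(\<integral>\<^sup>+x. h q x \<partial>m) = (\<integral>\<^sup>+x. h q x * indicator (space M) x \<partial>m)"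
      by (intro nn_integral_cong) auto
    then show ?thesis using hint[of "space M" q] l.emeasure_finite[of "space M \<times> {..q}"]
      by (simp add: less_top[symmetric])
  qed
  have hmono: "AE x in m. h q x \<le> h q' x" if "q \<le> q'" for q q'
  proof (rule AE_le_of_set_nn_integral_le[OF _ _ hfin])
    show "(\<integral>\<^sup>+x. h q x * indicator D x \<partial>m) \<le> (\<integral>\<^sup>+x. h q' x * indicator D x \<partial>m)" if D: "D \<in> sets m" for D
      using D \<open>q \<le> q'\<close> by (simp add: hint) (intro emeasure_mono, auto simp: l(2))
  qed auto
  have hle1: "AE x in m. h q x \<le> 1" for q
  proof (rule AE_le_of_set_nn_integral_le[OF _ _ hfin])
    show "(\<integral>\<^sup>+x. h q x * indicator D x \<partial>m) \<le> (\<integral>\<^sup>+x. 1 * indicator D x \<partial>m)" if D: "D \<in> sets m" for D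
      using D by (simp add: hint em) (intro emeasure_mono, auto simp: l(2))
  qed auto
  have h0: "AE x in m. h q x = 0" if q: "q < 0" for q
  proof -
    have "(\<integral>\<^sup>+x. h q x \<partial>m) = (\<integral>\<^sup>+x. h q x * indicator (space M) x \<partial>m)"
      by (intro nn_integral_cong) auto
    also have "\<dots> = emeasure l (space M \<times> {..q})" by (simp add: hint)
    also have "\<dots> = (\<integral>\<^sup>+z. indicator (space M \<times> {..q}) z \<partial>l)" by simp
    also have "\<dots> = (\<integral>\<^sup>+z. 0 \<partial>l)"
      by (intro nn_integral_cong_AE AE_mp[OF supp AE_I2]) (use q in \<open>auto split: split_indicator\<close>)
    also have "\<dots> = 0" by simp
    finally show ?thesis by (subst (asm) nn_integral_0_iff_AE) auto
  qed
  have h1: "AE x in m. 1 \<le> h q x" if q: "1 \<le> q" for q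
  proof (rule AE_le_of_set_nn_integral_le)
    show "(\<integral>\<^sup>+x. 1 * indicator D x \<partial>m) \<le> (\<integral>\<^sup>+x. h q x * indicator D x \<partial>m)" if D: "D \<in> sets m" for D
    proof -
      have "emeasure l (D \<times> UNIV) = emeasure l (D \<times> {..q})"
        using D supp q by (intro emeasure_eq_AE) (auto simp: l(2))
      then show ?thesis using D by (simp add: hint em)
    qed
    show "(\<integral>\<^sup>+x. 1 \<partial>m) < \<infinity>" using m.emeasure_finite[of "space m"]
      by (simp add: less_top[symmetric])
  qed auto
  \<comment> \<open>Indexing by \<open>rat\<close> leaves countably many almost-everywhere
    statements, so one measurable set of full measure carries them all at once.\<close>
  define good where "good x \<longleftrightarrow> (\<forall>a b. a \<le> b \<longrightarrow> h (real_of_rat a) x \<le> h (real_of_rat b) x) \<and>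
    (\<forall>a. h (real_of_rat a) x \<le> 1 \<and> (a < 0 \<longrightarrow> h (real_of_rat a) x = 0) \<and> (1 \<le> a \<longrightarrow> 1 \<le> h (real_of_rat a) x))" for x
  have [measurable]: "Measurable.pred M good"
    unfolding good_def by measurable
  have AE_good: "AE x in m. good x"
    unfolding good_def using hmono hle1 h0 h1
    by (simp add: AE_all_countable AE_conj_iff of_rat_less_eq)
  have goodD: "q' \<in> \<rat> \<Longrightarrow> q \<le> q' \<Longrightarrow> h q x \<le> h q' x" "h q x \<le> 1" "q < 0 \<Longrightarrow> h q x = 0" "1 \<le> q \<Longrightarrow> h q x = 1"
    if "good x" "q \<in> \<rat>" for q q' x
    using that by (auto simp: good_def Rats_def of_rat_less_eq intro!: antisym)
  \<comment> \<open>Off the good set the distribution function of the point mass at 0 is used, so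
    that every state receives a probability law.\<close>
  define H where "H q x = (if good x then enn2real (h q x) else of_bool (0 \<le> q))" for q x
  have [measurable]: "H q \<in> borel_measurable M" for q
    unfolding H_def by measurable
  have H01: "0 \<le> H q x" "H q x \<le> 1" if "q \<in> \<rat>" for q x
    using goodD(2)[of x q] that by (auto simp: H_def intro!: enn2real_leI)
  have Hmono: "H q x \<le> H q' x" if "q \<in> \<rat>" "q' \<in> \<rat>" "q \<le> q'" for q q' x
  proof (cases "good x")
    case True
    then have "h q x \<le> h q' x" "h q' x \<le> 1" using that goodD by auto
    then show ?thesis using True by (auto simp: H_def intro!: enn2real_mono intro: le_less_trans)
  qed (use that in \<open>auto simp: H_def\<close>)
  have H0: "H q x = 0" if "q \<in> \<rat>" "q < 0" for q x using that goodD by (auto simp: H_def)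
  have H1: "H q x = 1" if "q \<in> \<rat>" "1 \<le> q" for q x
    using that goodD by (auto simp: H_def)
  \<comment> \<open>Only levels strictly above \<open>t\<close> enter, which makes
    \<open>F x\<close> right-continuous; at a rational level it may differ from
    \<open>H\<close>.\<close>
  define F where "F x t = (INF q\<in>{q\<in>\<rat>. t < q}. H q x)" for x t
  have bdd: "bdd_below ((\<lambda>q. H q x) ` {q\<in>\<rat>. t < q})" for x t
    by (rule bdd_belowI[of _ 0]) (auto simp: H01)
  have nonempty: "{q\<in>\<rat>. t < q} \<noteq> {}" for t :: real
    using Rats_dense_in_real[of t "t + 1"] by auto
  have FleH: "F x t \<le> H q x" if "q \<in> \<rat>" "t < q" for x t q
    unfolding F_def using that bdd by (intro cINF_lower) auto
  have F_less: "\<exists>q\<in>\<rat>. t < q \<and> H q x < y" if "F x t < y" for x t y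
    using that unfolding F_def by (subst (asm) cINF_less_iff[OF nonempty bdd]) auto
  have F01: "0 \<le> F x t" "F x t \<le> 1" for x t
  proof -
    show "0 \<le> F x t" unfolding F_def by (intro cINF_greatest nonempty) (auto simp: H01)
    obtain q where "q \<in> \<rat>" "t < q" using nonempty[of t] by auto
    then show "F x t \<le> 1" using FleH[of q t x] H01[of q x] by simp
  qed
  have F_mono: "F x s \<le> F x t" if "s \<le> t" for x s t
    unfolding F_def using that bdd nonempty by (intro cINF_superset_mono) auto
  have F_0: "F x t = 0" if t: "t < 0" for x t
  proof -
    obtain q where "q \<in> \<rat>" "t < q" "q < 0" using Rats_dense_in_real[OF t] by auto
    then show ?thesis using FleH[of q t x] H0[of q x] F01[of x t] by simp
  qed
  have F_1: "F x t = 1" if t: "1 \<le> t" for x t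
  proof (rule antisym)
    show "1 \<le> F x t" unfolding F_def using t by (intro cINF_greatest nonempty) (auto simp: H1)
  qed (rule F01)
  have H_lim: "(\<lambda>n. H (s n) x) \<longlonglongrightarrow> F x t"
    if s: "\<And>n. s n \<in> \<rat>" "\<And>n. t < s n" "s \<longlonglongrightarrow> t" for x t s
  proof (rule order_tendstoI)
    show "\<forall>\<^sub>F n in sequentially. y < H (s n) x" if "y < F x t" for y
      by (intro always_eventually allI less_le_trans[OF that FleH[OF s(1,2)]])
    show "\<forall>\<^sub>F n in sequentially. H (s n) x < y" if y: "F x t < y" for y
    proof -
      obtain q where q: "q \<in> \<rat>" "t < q" "H q x < y" using F_less[OF y] by auto
      have "\<forall>\<^sub>F n in sequentially. s n < q" using s(3) q(2) by (rule order_tendstoD)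
      then show ?thesis
        by eventually_elim (rule le_less_trans[OF Hmono[OF s(1) q(1) less_imp_le] q(3)])
    qed
  qed
  have F_cont: "continuous (at_right t) (F x)" for x t
    unfolding continuous_within
  proof (rule order_tendstoI)
    show "\<forall>\<^sub>F s in at_right t. y < F x s" if "y < F x t" for y
      unfolding eventually_at_filter
      by (intro always_eventually allI impI less_le_trans[OF that F_mono]) auto
    show "\<forall>\<^sub>F s in at_right t. F x s < y" if y: "F x t < y" for y
    proof -
      obtain q where q: "q \<in> \<rat>" "t < q" "H q x < y" using F_less[OF y] by auto
      then show ?thesis
        unfolding eventually_at_right[OF q(2)]
        by (intro exI[of _ q] conjI q(2) allI impI le_less_trans[OF FleH q(3)]) (use q in auto)
    qed
  qed
  have F_bot: "(F x \<longlongrightarrow> 0) at_bot" for x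
    by (rule tendsto_eventually) (auto simp: eventually_at_bot_dense F_0 intro!: exI[of _ 0])
  have F_top: "(F x \<longlongrightarrow> 1) at_top" for x
    by (rule tendsto_eventually) (auto simp: eventually_at_top_linorder F_1 intro!: exI[of _ 1])
  have F_meas[measurable]: "(\<lambda>x. F x t) \<in> borel_measurable M" for t
  proof -
    obtain s where s: "\<And>n. s n \<in> \<rat>" "\<And>n. t < s n" "s \<longlonglongrightarrow> t" by (rule rational_sequence_decreasing_to) blast
    show ?thesis by (rule borel_measurable_LIMSEQ_real[OF H_lim[OF s]]) measurable
  qed
  \<comment> \<open>Both sides are limits along rational levels approaching \<open>t\<close> from
    above: \<open>H\<close> tends to \<open>F\<close>, and the indicators of the half-lines tend to
    that of \<open>{..t}\<close>. Dominated convergence applies since both measures are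
    finite.\<close>
  have F_int: "(\<integral>\<^sup>+x. indicator D x * ennreal (F x t) \<partial>m) = emeasure l (D \<times> {..t})" if D[measurable]: "D \<in> sets M" for D t
  proof -
    obtain s where s: "\<And>n. s n \<in> \<rat>" "\<And>n. t < s n" "s \<longlonglongrightarrow> t" by (rule rational_sequence_decreasing_to) blast
    have 1: "(\<lambda>n. \<integral>\<^sup>+x. indicator D x * ennreal (H (s n) x) \<partial>m) \<longlonglongrightarrow> (\<integral>\<^sup>+x. indicator D x * ennreal (F x t) \<partial>m)"
    proof (rule nn_integral_dominated_convergence[where w="\<lambda>_. 1"])
      show "AE x in m. (\<lambda>n. indicator D x * ennreal (H (s n) x)) \<longlonglongrightarrow> indicator D x * ennreal (F x t)"
        by (intro AE_I2 ennreal_tendsto_cmult tendsto_ennrealI H_lim s) (auto split: split_indicator)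
      show "AE x in m. indicator D x * ennreal (H (s n) x) \<le> 1" for n
        using H01[OF s(1)] by (auto intro!: AE_I2 split: split_indicator simp: ennreal_le_1)
      show "(\<integral>\<^sup>+x. 1 \<partial>m) < \<infinity>" using m.emeasure_finite[of "space m"] by (simp add: less_top[symmetric])
    qed measurable
    have "(\<integral>\<^sup>+x. indicator D x * ennreal (H q x) \<partial>m) = emeasure l (D \<times> {..q})" if q: "q \<in> \<rat>" for q
    proof -
      have "(\<integral>\<^sup>+x. indicator D x * ennreal (H q x) \<partial>m) = (\<integral>\<^sup>+x. h q x * indicator D x \<partial>m)"
      proof (rule nn_integral_cong_AE, use AE_good in eventually_elim)
        case (elim x)
        then have "h q x \<le> 1" using q by (rule goodD)
        then have "h q x < top" by (rule le_less_trans) simp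
        then show ?case using elim by (simp add: H_def mult.commute)
      qed
      then show ?thesis by (simp add: hint D)
    qed
    then have 2: "(\<lambda>n. \<integral>\<^sup>+x. indicator D x * ennreal (H (s n) x) \<partial>m) = (\<lambda>n. \<integral>\<^sup>+z. indicator (D \<times> {..s n}) z \<partial>l)"
      using s(1) by (simp add: l(2))
    have 3: "(\<lambda>n. \<integral>\<^sup>+z. indicator (D \<times> {..s n}) z \<partial>l) \<longlonglongrightarrow> (\<integral>\<^sup>+z. indicator (D \<times> {..t}) z \<partial>l)"
    proof (rule nn_integral_dominated_convergence[where w="\<lambda>_. 1"])
      have "(\<lambda>n. indicator (D \<times> {..s n}) z :: ennreal) \<longlonglongrightarrow> indicator (D \<times> {..t}) z" for z
      proof (rule tendsto_eventually)
        show "\<forall>\<^sub>F n in sequentially. indicator (D \<times> {..s n}) z = (indicator (D \<times> {..t}) z :: ennreal)"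
        proof (cases "snd z \<le> t")
          case True
          then have "snd z \<le> s n" for n using s(2)[of n] by simp
          then show ?thesis using True by (cases z) (auto split: split_indicator)
        next
          case False
          then have "\<forall>\<^sub>F n in sequentially. s n < snd z" using s(3) by (intro order_tendstoD) auto
          then show ?thesis by eventually_elim (use False in \<open>cases z, auto split: split_indicator\<close>)
        qed
      qed
      then show "AE z in l. (\<lambda>n. indicator (D \<times> {..s n}) z :: ennreal) \<longlonglongrightarrow> indicator (D \<times> {..t}) z" by simp
      show "(\<integral>\<^sup>+x. 1 \<partial>l) < \<infinity>" using l.emeasure_finite[of "space l"] by (simp add: less_top[symmetric])
    qed (auto simp: l(2) split: split_indicator)
    show ?thesis
      using LIMSEQ_unique[OF 1 3[folded 2]] by (simp add: l(2))
  qed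
  define \<kappa> where "\<kappa> x = interval_measure (F x)" for x
  have \<kappa>_prob: "prob_space (\<kappa> x)" for x
    using real_distribution_interval_measure[OF F_mono F_cont F_bot F_top] by (simp add: \<kappa>_def real_distribution_def)
  have \<kappa>_atMost: "emeasure (\<kappa> x) {..t} = ennreal (F x t)" for x t
    unfolding \<kappa>_def by (rule emeasure_interval_measure_Iic[OF F_mono F_cont F_bot])
  have \<kappa>_sets: "sets (\<kappa> x) = sets borel" for x by (simp add: \<kappa>_def)
  have \<kappa>: "\<kappa> \<in> M \<rightarrow>\<^sub>M prob_algebra borel"
  proof (rule measurable_prob_algebra_generated[where \<Omega>=UNIV and G="range (\<lambda>a. {..a})"])
    show "sets borel = sigma_sets UNIV (range (\<lambda>a. {..a::real}))"
      unfolding borel_eq_atMost by (rule sets_measure_of) auto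
    show "Int_stable (range (\<lambda>a. {..a::real}))" by (auto simp: Int_stable_def)
    show "(\<lambda>x. emeasure (\<kappa> x) A) \<in> borel_measurable M" if "A \<in> range (\<lambda>a. {..a})" for A
      using that by (auto simp: \<kappa>_atMost)
  qed (auto simp: \<kappa>_prob \<kappa>_sets)
  have "l = ksemi (M \<Otimes>\<^sub>M borel) m \<kappa>"
  proof (rule ksemi_eqI[OF sets_m \<kappa> ne l(2,1)])
    fix D and C :: "real set" assume D[measurable]: "D \<in> sets M" and C: "C \<in> sets borel"
    \<comment> \<open>With \<open>D\<close> fixed, both sides are measures in \<open>C\<close> and
      the first is finite, so it suffices to compare them on half-lines.\<close>
    define l1 where "l1 = distr (density l (indicator (D \<times> UNIV))) borel snd"
    define l2 where "l2 = density m (indicator D) \<bind> \<kappa>"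
    have \<kappa>': "\<kappa> \<in> density m (indicator D) \<rightarrow>\<^sub>M subprob_algebra borel"
      using measurable_prob_algebraD[OF \<kappa>] by (simp cong: measurable_cong_sets)
    have e1: "emeasure l1 C = emeasure l (D \<times> C)" if C: "C \<in> sets borel" for C
    proof -
      have "emeasure l1 C = (\<integral>\<^sup>+z. indicator (D \<times> UNIV) z * indicator (snd -` C \<inter> space l) z \<partial>l)"
      proof -
        have [measurable]: "D \<times> UNIV \<in> sets l" by (simp add: l(2))
        have "snd -` C \<inter> space l \<in> sets l"
          using measurable_snd[of M "borel::real measure"] C by (intro measurable_sets[of snd l borel]) (simp_all cong: measurable_cong_sets add: l(2))
        then show ?thesis unfolding l1_def using C
          by (subst emeasure_distr) (auto simp: emeasure_density measurable_cong_sets[OF sets_density refl])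
      qed
      also have "\<dots> = (\<integral>\<^sup>+z. indicator (D \<times> C) z \<partial>l)"
        using sets.sets_into_space[OF D] by (intro nn_integral_cong) (auto split: split_indicator simp: space_l)
      finally show ?thesis using C by (simp add: l(2))
    qed
    have e2: "emeasure l2 C = (\<integral>\<^sup>+x. indicator D x * emeasure (\<kappa> x) C \<partial>m)" if C: "C \<in> sets borel" for C
    proof -
      have [measurable]: "(\<lambda>x. emeasure (\<kappa> x) C) \<in> borel_measurable M"
        using \<kappa> C by (intro measurable_emeasure_kernel measurable_prob_algebraD)
      show ?thesis unfolding l2_def
        by (subst emeasure_bind[OF _ \<kappa>' C]) (auto simp: ne nn_integral_density)
    qed
    have "l1 = l2"
    proof (rule measure_eqI_generator_eq[where E="range (\<lambda>a. {..a})" and \<Omega>=UNIV and A="\<lambda>n. {..real n}"])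
      show "Int_stable (range (\<lambda>a. {..a::real}))" by (auto simp: Int_stable_def)
      have b: "sets borel = sigma_sets UNIV (range (\<lambda>a. {..a::real}))"
        unfolding borel_eq_atMost by (rule sets_measure_of) auto
      show "sets l1 = sigma_sets UNIV (range (\<lambda>a. {..a::real}))" by (simp add: l1_def b)
      have "sets l2 = sets borel"
        unfolding l2_def using \<kappa>' by (intro sets_bind sets_kernel) (auto simp: ne)
      then show "sets l2 = sigma_sets UNIV (range (\<lambda>a. {..a::real}))" by (simp add: b)
      show "(\<Union>n. {..real n}) = UNIV" using real_arch_simple by auto
      show "emeasure l1 X = emeasure l2 X" if "X \<in> range (\<lambda>a. {..a})" for X
        using that by (auto simp: e1 e2 \<kappa>_atMost F_int)
      show "emeasure l1 {..real n} \<noteq> \<infinity>" for n by (simp add: e1 l.emeasure_finite)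
    qed auto
    then show "emeasure l (D \<times> C) = (\<integral>\<^sup>+x. indicator D x * emeasure (\<kappa> x) C \<partial>m)"
      using e1[OF C] e2[OF C] by simp
  qed
  with \<kappa> show thesis by (intro that) (simp_all add: m_def)
qed


text \<open>The action coordinate is pushed to the line by \<open>c\<close>, disintegrated there,
  and the kernel is pushed back by \<open>d\<close>. Because \<open>d (c a) = a\<close>, integrating
  \<open>indicator C (d u)\<close> against the coded measure recovers \<open>l\<close>, with no
  reference to the image of \<open>c\<close>.\<close>

lemma coded_disintegration:
  fixes l :: "('x \<times> 'a) measure" and c :: "'a \<Rightarrow> real"
  assumes l: "finite_measure l" "sets l = sets (M \<Otimes>\<^sub>M A)" and ne: "space M \<noteq> {}"
    and c: "c \<in> borel_measurable A" "\<And>a. 0 \<le> c a" "\<And>a. c a \<le> 1"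
    and d: "d \<in> borel \<rightarrow>\<^sub>M A" "\<And>a. a \<in> space A \<Longrightarrow> d (c a) = a"
  obtains \<phi> where "\<phi> \<in> M \<rightarrow>\<^sub>M prob_algebra A" "l = ksemi (M \<Otimes>\<^sub>M A) (distr l M fst) \<phi>"
proof -
  note [measurable] = c(1) d(1)
  note [measurable_cong] = l(2)
  interpret finite_measure l by fact
  have space_l: "space l = space M \<times> space A" using sets_eq_imp_space_eq[OF l(2)] by (simp add: space_pair_measure)
  define l' where "l' = distr l (M \<Otimes>\<^sub>M borel) (\<lambda>z. (fst z, c (snd z)))"
  have l': "finite_measure l'" "sets l' = sets (M \<Otimes>\<^sub>M borel)"
    unfolding l'_def by (auto intro!: finite_measure_distr)
  have m: "distr l' M fst = distr l M fst"
    unfolding l'_def by (subst distr_distr) (auto simp: comp_def)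
  have supp: "AE z in l'. 0 \<le> snd z \<and> snd z \<le> 1"
    unfolding l'_def by (subst AE_distr_iff) (auto simp: c)
  obtain \<kappa> where \<kappa>[measurable]: "\<kappa> \<in> M \<rightarrow>\<^sub>M prob_algebra borel"
    and \<kappa>_eq: "l' = ksemi (M \<Otimes>\<^sub>M borel) (distr l' M fst) \<kappa>"
    by (rule real_disintegration[OF l' ne supp]) blast
  define \<phi> where "\<phi> x = distr (\<kappa> x) A d" for x
  have \<phi>[measurable]: "\<phi> \<in> M \<rightarrow>\<^sub>M prob_algebra A" unfolding \<phi>_def by measurable
  have \<kappa>_sets: "sets (\<kappa> x) = sets borel" if "x \<in> space M" for x
    using measurable_space[OF \<kappa> that] by (simp add: space_prob_algebra)
  have "l = ksemi (M \<Otimes>\<^sub>M A) (distr l M fst) \<phi>"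
  proof (rule ksemi_eqI[OF _ \<phi> ne l(2,1)])
    fix D C assume [measurable]: "D \<in> sets M" "C \<in> sets A"
    define f where "f z = (indicator D (fst z) * indicator C (d (snd z)) :: ennreal)" for z
    have [measurable]: "f \<in> borel_measurable (M \<Otimes>\<^sub>M borel)" unfolding f_def by measurable
    have "emeasure l (D \<times> C) = (\<integral>\<^sup>+z. indicator (D \<times> C) z \<partial>l)" by (simp add: l(2))
    also have "\<dots> = (\<integral>\<^sup>+z. f (fst z, c (snd z)) \<partial>l)"
      by (intro nn_integral_cong) (auto simp: f_def space_l d split: split_indicator)
    also have "\<dots> = (\<integral>\<^sup>+z. f z \<partial>l')" unfolding l'_def by (subst nn_integral_distr) auto
    also have "\<dots> = (\<integral>\<^sup>+x. \<integral>\<^sup>+u. f (x, u) \<partial>\<kappa> x \<partial>distr l M fst)"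
      by (subst \<kappa>_eq, subst nn_integral_ksemi) (auto simp: m)
    also have "\<dots> = (\<integral>\<^sup>+x. indicator D x * emeasure (\<phi> x) C \<partial>distr l M fst)"
    proof (intro nn_integral_cong)
      fix x assume "x \<in> space (distr l M fst)"
      then have x: "x \<in> space M" by simp
      note [measurable_cong] = \<kappa>_sets[OF x]
      have "(\<integral>\<^sup>+u. f (x, u) \<partial>\<kappa> x) = indicator D x * (\<integral>\<^sup>+u. indicator C (d u) \<partial>\<kappa> x)"
        unfolding f_def fst_conv snd_conv by (intro nn_integral_cmult) measurable
      also have "(\<integral>\<^sup>+u. indicator C (d u) \<partial>\<kappa> x) = (\<integral>\<^sup>+a. indicator C a \<partial>\<phi> x)"
        unfolding \<phi>_def by (subst nn_integral_distr) auto
      finally show "(\<integral>\<^sup>+u. f (x, u) \<partial>\<kappa> x) = indicator D x * emeasure (\<phi> x) C" by (simp add: \<phi>_def)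
    qed
    finally show "emeasure l (D \<times> C) = (\<integral>\<^sup>+x. indicator D x * emeasure (\<phi> x) C \<partial>distr l M fst)" .
  qed simp
  with \<phi> that show thesis by blast
qed

section \<open>Dubins' theorem\<close>

definition convex_comb :: "'v::real_vector set \<Rightarrow> nat \<Rightarrow> 'v \<Rightarrow> bool" where
  "convex_comb E m x \<longleftrightarrow> (\<exists>n\<le>m. \<exists>v w. (\<forall>i<n. v i \<in> E \<and> 0 \<le> w i) \<and> (\<Sum>i<n. w i) = (1::real)
     \<and> x = (\<Sum>i<n. w i *\<^sub>R v i))"

lemma convex_comb_single: "x \<in> E \<Longrightarrow> 1 \<le> m \<Longrightarrow> convex_comb E m x"
  unfolding convex_comb_def
  by (intro exI[of _ "1::nat"] exI[of _ "\<lambda>_. x"] exI[of _ "\<lambda>_. 1::real"] conjI) auto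

lemma convex_comb_insert:
  assumes x: "convex_comb E m x" and e: "e \<in> E" and t: "0 \<le> t" "t \<le> 1"
  shows "convex_comb E (Suc m) ((1 - t) *\<^sub>R x + t *\<^sub>R e)"
proof -
  obtain n v w where n: "n \<le> m" and v: "\<forall>i<n. v i \<in> E \<and> 0 \<le> w i" and w: "(\<Sum>i<n. w i) = (1::real)"
    and x: "x = (\<Sum>i<n. w i *\<^sub>R v i)"
    using x unfolding convex_comb_def by blast
  let ?v = "\<lambda>i. if i < n then v i else e" and ?w = "\<lambda>i. if i < n then (1 - t) * w i else t"
  have "(\<Sum>i<n. ?w i) = (1 - t) * (\<Sum>i<n. w i)" by (simp add: sum_distrib_left)
  then have 1: "(\<Sum>i<Suc n. ?w i) = 1" by (simp add: w)
  have "(\<Sum>i<n. ?w i *\<^sub>R ?v i) = (1 - t) *\<^sub>R x" by (simp add: x scaleR_sum_right)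
  then have 2: "(1 - t) *\<^sub>R x + t *\<^sub>R e = (\<Sum>i<Suc n. ?w i *\<^sub>R ?v i)" by simp
  show ?thesis
    unfolding convex_comb_def
    by (intro exI[of _ "Suc n"] exI[of _ ?v] exI[of _ ?w] conjI 1 2) (use n v e t in auto)
qed

lemma convex_segment_point:
  fixes x y :: "'v::real_vector"
  assumes "convex K" "x \<in> K" "y \<in> K" "0 \<le> t" "t \<le> 1"
  shows "x + t *\<^sub>R (y - x) \<in> K"
proof -
  have "(1 - t) *\<^sub>R x + t *\<^sub>R y \<in> K" using assms by (intro convexD_alt) auto
  then show ?thesis by (simp add: algebra_simps)
qed

lemma convex_symmetric_scale:
  fixes x d :: "'v::real_vector"
  assumes K: "convex K" "x + d \<in> K" "x - d \<in> K" and t: "\<bar>t\<bar> \<le> 1"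
  shows "x + t *\<^sub>R d \<in> K"
proof -
  have "(x - d) + ((1 + t) / 2) *\<^sub>R ((x + d) - (x - d)) \<in> K"
    using t by (intro convex_segment_point[OF K(1,3,2)]) auto
  also have "(x - d) + ((1 + t) / 2) *\<^sub>R ((x + d) - (x - d)) = x + t *\<^sub>R d"
  proof -
    have "(x + d) - (x - d) = 2 *\<^sub>R d" by (simp add: algebra_simps scaleR_2)
    then have "(x - d) + ((1 + t) / 2) *\<^sub>R ((x + d) - (x - d)) = (x - d) + (1 + t) *\<^sub>R d" by simp
    then show ?thesis by (simp add: algebra_simps)
  qed
  finally show ?thesis .
qed

text \<open>The last point \<open>y\<close> of \<open>K\<close> in a direction \<open>d\<close> along which \<open>K\<close> extends on both sides of
  \<open>x\<close> has a smaller face: among the functionals separating the directions of the face of \<open>x\<close>,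
  one may be eliminated against \<open>d\<close>.\<close>

lemma face_functionals_reduce:
  fixes K :: "'v::real_vector set"
  assumes K: "convex K" and x: "x + d \<in> K" "x - d \<in> K" "d \<noteq> 0"
    and t: "0 < t" "x + t *\<^sub>R d \<in> K" "\<And>s. s > t \<Longrightarrow> x + s *\<^sub>R d \<notin> K"
    and I: "finite I" "\<And>i. i \<in> I \<Longrightarrow> linear (l i)"
    and sep: "\<And>v. x + v \<in> K \<Longrightarrow> x - v \<in> K \<Longrightarrow> (\<And>i. i \<in> I \<Longrightarrow> l i v = (0::real)) \<Longrightarrow> v = 0"
  obtains j l' where "j \<in> I" "\<And>i. i \<in> I - {j} \<Longrightarrow> linear (l' i)"
    "\<And>v. x + t *\<^sub>R d + v \<in> K \<Longrightarrow> x + t *\<^sub>R d - v \<in> K \<Longrightarrow>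
       (\<And>i. i \<in> I - {j} \<Longrightarrow> l' i v = (0::real)) \<Longrightarrow> v = 0"
proof -
  \<comment> \<open>Some functional must be nonzero on \<open>d\<close>, since \<open>d\<close>
    itself is a direction of the face of \<open>x\<close>. It is the one to be eliminated.\<close>
  obtain j where j: "j \<in> I" "l j d \<noteq> 0" using sep[OF x(1,2)] x(3) by blast
  \<comment> \<open>Gaussian elimination: \<open>l' i\<close> is \<open>l i\<close> corrected by a
    multiple of \<open>l j\<close> so as to vanish on \<open>d\<close>.\<close>
  define l' where "l' i v = l i v - (l i d / l j d) * l j v" for i v
  show thesis
  proof (rule that[OF j(1), of l'])
    show "linear (l' i)" if "i \<in> I - {j}" for i
    proof (rule linearI)
      have i: "linear (l i)" "linear (l j)" using that I(2) j by auto
      show "l' i (a + b) = l' i a + l' i b" for a b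
        by (simp add: l'_def linear_add[OF i(1)] linear_add[OF i(2)] algebra_simps add_divide_distrib)
      show "l' i (c *\<^sub>R a) = c *\<^sub>R l' i a" for c a
        by (simp add: l'_def linear_scale[OF i(1)] linear_scale[OF i(2)] algebra_simps)
    qed
  next
    fix v assume v: "x + t *\<^sub>R d + v \<in> K" "x + t *\<^sub>R d - v \<in> K" and l'v: "\<And>i. i \<in> I - {j} \<Longrightarrow> l' i v = 0"
    \<comment> \<open>Chosen so that \<open>l j\<close> vanishes on \<open>v - s d\<close>; the
      condition \<open>l' i v = 0\<close> then makes every other \<open>l i\<close> vanish there
      too.\<close>
    define s where "s = l j v / l j d"
    define y where "y = x + t *\<^sub>R d"
    have lv: "l i (v - s *\<^sub>R d) = 0" if i: "i \<in> I" for i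
    proof -
      have "l i (v - s *\<^sub>R d) = l i v - s * l i d"
        using I(2)[OF i] by (simp add: linear_diff linear_scale)
      also have "\<dots> = 0"
      proof (cases "i = j")
        case False
        then show ?thesis using l'v[of i] i by (simp add: l'_def s_def field_simps)
      qed (use j in \<open>simp add: s_def\<close>)
      finally show ?thesis .
    qed
    text \<open>\<open>x\<close> lies strictly between \<open>y\<close> and \<open>x - d\<close>, so directions available at \<open>y\<close> are available at \<open>x\<close>.\<close>
    define a where "a = 1 / (1 + t)"
    have a: "0 < a" "a < 1" using t(1) by (auto simp: a_def)
    have ax: "x + (a * u) *\<^sub>R v \<in> K" if "\<bar>u\<bar> \<le> 1" for u
    proof -
      have "y + u *\<^sub>R v \<in> K"
        using convex_symmetric_scale[OF K, of y v u] v that by (simp add: y_def)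
      then have "(x - d) + a *\<^sub>R ((y + u *\<^sub>R v) - (x - d)) \<in> K"
        using a by (intro convex_segment_point[OF K x(2)]) auto
      moreover have "(y + u *\<^sub>R v) - (x - d) = (1 + t) *\<^sub>R d + u *\<^sub>R v"
        by (simp add: y_def algebra_simps)
      moreover have "a *\<^sub>R ((1 + t) *\<^sub>R d + u *\<^sub>R v) = d + (a * u) *\<^sub>R v"
        using t(1) by (simp add: a_def scaleR_add_right)
      ultimately show ?thesis by simp
    qed
    \<comment> \<open>The scale \<open>e = h / 2\<close> is small enough that \<open>x\<close> plus
      or minus \<open>2 e v\<close> and \<open>x\<close> plus or minus \<open>2 e s d\<close> lie in
      \<open>K\<close>; suitable midpoints are \<open>x\<close> plus or minus
      \<open>e (v - s d)\<close>.\<close>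
    define h where "h = a / (1 + \<bar>s\<bar>)"
    define e where "e = h / 2"
    have e: "0 < e" "e * \<bar>s\<bar> * 2 \<le> 1" "e * 2 \<le> a"
    proof -
      show "0 < e" using a by (simp add: e_def h_def add_pos_nonneg)
      have "a * \<bar>s\<bar> \<le> 1 * \<bar>s\<bar>" using a by (intro mult_right_mono) auto
      then show "e * \<bar>s\<bar> * 2 \<le> 1" by (simp add: e_def h_def divide_le_eq)
      have "e * 2 = a / (1 + \<bar>s\<bar>)" by (simp add: e_def h_def[symmetric])
      also have "\<dots> \<le> a / 1" using a by (intro divide_left_mono) auto
      finally show "e * 2 \<le> a" by simp
    qed
    have mid: "x + (c * e) *\<^sub>R (v - s *\<^sub>R d) \<in> K" if c: "c = 1 \<or> c = -1" for c
    proof -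
      have "x + (c * (2 * e)) *\<^sub>R v \<in> K"
        using ax[of "c * (2 * e) / a"] a e(1,3) c by (auto simp: abs_mult)
      moreover have "x + (- c * (2 * e * s)) *\<^sub>R d \<in> K"
        using e(1,2) c by (intro convex_symmetric_scale[OF K x(1,2)]) (auto simp: abs_mult mult_ac)
      ultimately have "(x + (c * (2 * e)) *\<^sub>R v) +
          (1/2) *\<^sub>R ((x + (- c * (2 * e * s)) *\<^sub>R d) - (x + (c * (2 * e)) *\<^sub>R v)) \<in> K"
        by (intro convex_segment_point[OF K]) auto
      also have "(x + (c * (2 * e)) *\<^sub>R v) +
          (1/2) *\<^sub>R ((x + (- c * (2 * e * s)) *\<^sub>R d) - (x + (c * (2 * e)) *\<^sub>R v)) = x + (c * e) *\<^sub>R (v - s *\<^sub>R d)"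
      proof -
        have gen: "(x + u) + (1/2) *\<^sub>R ((x + w) - (x + u)) = x + (1/2) *\<^sub>R (u + w)" for u w
        proof -
          define hu where "hu = (1/2) *\<^sub>R u"
          have "hu + hu = u" unfolding hu_def by (metis scaleR_add_right scaleR_half_double)
          then have uh: "u - hu = hu" by (metis add_diff_cancel_right')
          have "(x + u) + ((1/2) *\<^sub>R w - hu) = x + ((u - hu) + (1/2) *\<^sub>R w)" by (simp add: algebra_simps)
          then show ?thesis by (simp add: scaleR_diff_right scaleR_add_right hu_def[symmetric] uh)
        qed
        show ?thesis unfolding gen by (simp add: scaleR_add_right scaleR_diff_right mult_ac)
      qed
      finally show ?thesis .
    qed
    have "e *\<^sub>R (v - s *\<^sub>R d) = 0"
    proof (rule sep)
      show "x + e *\<^sub>R (v - s *\<^sub>R d) \<in> K" "x - e *\<^sub>R (v - s *\<^sub>R d) \<in> K" using mid[of 1] mid[of "-1"] by simp_all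
      show "l i (e *\<^sub>R (v - s *\<^sub>R d)) = 0" if "i \<in> I" for i using lv[OF that] I(2)[OF that] by (simp add: linear_scale)
    qed
    then have vs: "v = s *\<^sub>R d" using e by simp
    \<comment> \<open>Otherwise \<open>v\<close> is a nonzero multiple of \<open>d\<close>, and one
      of the points \<open>x + t d + v\<close>, \<open>x + t d - v\<close> lies beyond the last
      point of \<open>K\<close> on the ray.\<close>
    have "s = 0"
    proof (rule ccontr)
      assume "s \<noteq> 0"
      have "x + (t + \<bar>s\<bar>) *\<^sub>R d \<in> K"
        using v unfolding vs by (cases "s \<ge> 0") (auto simp: algebra_simps)
      then show False using t(3)[of "t + \<bar>s\<bar>"] \<open>s \<noteq> 0\<close> by simp
    qed
    then show "v = 0" using vs by simp
  qed
qed

text \<open>Dubins' theorem, by induction on the number of functionals. The separation hypothesis says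
  that \<open>x\<close> is an extreme point of the section of \<open>K\<close> by the level sets of the \<open>l i\<close> through \<open>x\<close>.\<close>

theorem dubins:
  fixes K :: "'v::real_vector set"
  assumes K: "convex K"
    and last: "\<And>x y. x \<in> K \<Longrightarrow> y \<in> K \<Longrightarrow> x \<noteq> y \<Longrightarrow>
      \<exists>t\<ge>1. x + t *\<^sub>R (y - x) \<in> K \<and> (\<forall>s>t. x + s *\<^sub>R (y - x) \<notin> K)"
    and I: "finite I" "\<And>i. i \<in> I \<Longrightarrow> linear (l i)"
    and x: "x \<in> K"
    and sep: "\<And>v. x + v \<in> K \<Longrightarrow> x - v \<in> K \<Longrightarrow> (\<And>i. i \<in> I \<Longrightarrow> l i v = (0::real)) \<Longrightarrow> v = 0"
  shows "convex_comb {e. e extreme_point_of K} (card I + 1) x"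
  using I x sep
proof (induction "card I" arbitrary: I l x)
  case (0 I l x)
  then have I: "I = {}" by simp
  have "x extreme_point_of K"
    unfolding extreme_point_of_def
  proof (intro conjI ballI notI)
    \<comment> \<open>With no functionals the hypothesis says that no nontrivial symmetric segment
      around \<open>x\<close> lies in \<open>K\<close>, but an open segment of \<open>K\<close>
      through \<open>x\<close> contains one.\<close>
    fix a b assume ab: "a \<in> K" "b \<in> K" "x \<in> open_segment a b"
    then obtain u where u: "0 < u" "u < 1" "a \<noteq> b" "x = (1 - u) *\<^sub>R a + u *\<^sub>R b"
      by (auto simp: in_segment)
    define e where "e = min u (1 - u)"
    have e: "0 < e" "e \<le> u" "e \<le> 1 - u" using u by (auto simp: e_def)
    have "a + (u + e) *\<^sub>R (b - a) \<in> K" "a + (u - e) *\<^sub>R (b - a) \<in> K"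
      using e u by (auto intro!: convex_segment_point[OF K ab(1,2)])
    then have "x + e *\<^sub>R (b - a) \<in> K" "x - e *\<^sub>R (b - a) \<in> K" by (simp_all add: u(4) algebra_simps)
    then have "e *\<^sub>R (b - a) = 0" using 0(5) I by blast
    then show False using e u by simp
  qed (fact 0)
  then show ?case by (intro convex_comb_single) auto
next
  case (Suc n I l x)
  show ?case
  proof (cases "x extreme_point_of K")
    case True
    then show ?thesis by (intro convex_comb_single) auto
  next
    case False
    \<comment> \<open>The end point of \<open>K\<close> in a direction open on both sides of
      \<open>x\<close> is covered by the induction hypothesis with one functional fewer.\<close>
    have step: "\<exists>t\<ge>1. x + t *\<^sub>R d \<in> K \<and> convex_comb {e. e extreme_point_of K} (card I) (x + t *\<^sub>R d)"
      if d: "x + d \<in> K" "x - d \<in> K" "d \<noteq> 0" for d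
    proof -
      obtain t where t: "t \<ge> 1" "x + t *\<^sub>R d \<in> K" "\<And>s. s > t \<Longrightarrow> x + s *\<^sub>R d \<notin> K"
        using last[OF Suc.prems(3) d(1)] d(3) by auto
      then have "0 < t" by simp
      obtain j l' where j: "j \<in> I" and l': "\<And>i. i \<in> I - {j} \<Longrightarrow> linear (l' i)"
        "\<And>v. x + t *\<^sub>R d + v \<in> K \<Longrightarrow> x + t *\<^sub>R d - v \<in> K \<Longrightarrow>
          (\<And>i. i \<in> I - {j} \<Longrightarrow> l' i v = (0::real)) \<Longrightarrow> v = 0"
        by (rule face_functionals_reduce[OF K d \<open>0 < t\<close> t(2,3) Suc.prems(1,2,4)]) blast+
      have cI: "n = card (I - {j})" "card (I - {j}) + 1 = card I"
        using Suc.hyps(2) j Suc.prems(1) by auto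
      have "convex_comb {e. e extreme_point_of K} (card (I - {j}) + 1) (x + t *\<^sub>R d)"
        by (rule Suc.hyps(1)[OF cI(1) _ l'(1) t(2) l'(2)]) (use Suc.prems(1) in auto)
      then show ?thesis using t cI by auto
    qed
    obtain a b u where ab: "a \<in> K" "b \<in> K" and u: "0 < u" "u < 1" "a \<noteq> b" "x = (1 - u) *\<^sub>R a + u *\<^sub>R b"
      using False Suc.prems(3) by (auto simp: extreme_point_of_def in_segment)
    define e where "e = min u (1 - u)"
    have e: "0 < e" "e \<le> u" "e \<le> 1 - u" using u by (auto simp: e_def)
    have "a + (u + e) *\<^sub>R (b - a) \<in> K" "a + (u - e) *\<^sub>R (b - a) \<in> K"
      using e u by (auto intro!: convex_segment_point[OF K ab(1,2)])
    then have d: "x + e *\<^sub>R (b - a) \<in> K" "x - e *\<^sub>R (b - a) \<in> K" by (simp_all add: u(4) algebra_simps)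
    define d where "d = e *\<^sub>R (b - a)"
    have d: "x + d \<in> K" "x - d \<in> K" "d \<noteq> 0" using d e u by (auto simp: d_def)
    obtain t where t: "t \<ge> 1" "x + t *\<^sub>R d \<in> K" "convex_comb {e. e extreme_point_of K} (card I) (x + t *\<^sub>R d)"
      using step[OF d] by blast
    \<comment> \<open>\<open>x\<close> lies between \<open>y\<close> and \<open>x - d\<close>, but
      \<open>x - d\<close> need not be extreme. Instead an extreme point \<open>E\<close> of
      positive weight in \<open>y\<close> is selected; the ray from \<open>E\<close> through
      \<open>x\<close> ends at a point again covered by \<open>step\<close>, and \<open>x\<close> is
      a mixture of that point and \<open>E\<close>, at the cost of one extra extreme point.\<close>
    define y where "y = x + t *\<^sub>R d"
    obtain n' :: nat and v w where v: "\<forall>i<n'. v i extreme_point_of K \<and> 0 \<le> w i" and w: "(\<Sum>i<n'. w i) = (1::real)"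
      and y: "y = (\<Sum>i<n'. w i *\<^sub>R v i)"
      using t(3) unfolding convex_comb_def y_def[symmetric] mem_Collect_eq by blast
    obtain k where k: "k < n'" "w k > 0"
    proof -
      have "\<exists>k<n'. w k > 0"
      proof (rule ccontr)
        assume "\<not> ?thesis"
        then have "(\<Sum>i<n'. w i) \<le> 0" by (intro sum_nonpos) auto
        then show False using w by simp
      qed
      then show thesis using that by blast
    qed
    define E where "E = v k"
    have E: "E extreme_point_of K" using v k by (simp add: E_def)
    then have EK: "E \<in> K" by (simp add: extreme_point_of_def)
    have Ex: "E \<noteq> x" using E False by auto
    have "\<exists>q>0. x + q *\<^sub>R (x - E) \<in> K"
    proof -
      \<comment> \<open>The weight of \<open>E\<close> in
        \<open>x = t/(1+t) (x - d) + 1/(1+t) y\<close>. The normalised remainder is \<open>z\<close>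
        below, so the segment from \<open>E\<close> through \<open>x\<close> continues to
        \<open>z\<close>.\<close>
      define c where "c = 1 / (1 + t) * w k"
      have rest: "sum w ({..<n'} - {k}) = 1 - w k"
        using w k by (simp add: sum_diff1)
      have wk1: "w k \<le> 1"
        using rest sum_nonneg[of "{..<n'} - {k}" w] v by auto
      have c: "0 < c" "c < 1"
      proof -
        show "0 < c" using k t by (simp add: c_def)
        have "c \<le> 1 / (1 + t) * 1" unfolding c_def using t wk1 by (intro mult_left_mono) auto
        also have "\<dots> < 1" using t by simp
        finally show "c < 1" .
      qed
      have dec: "y - w k *\<^sub>R E = (\<Sum>i\<in>{..<n'} - {k}. w i *\<^sub>R v i)"
        unfolding y E_def using k by (simp add: sum_diff1)
      have xy: "x - c *\<^sub>R E = (t / (1 + t)) *\<^sub>R (x - d) + (1 / (1 + t)) *\<^sub>R (\<Sum>i\<in>{..<n'} - {k}. w i *\<^sub>R v i)"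
      proof -
        have "(1 + t) *\<^sub>R (x - c *\<^sub>R E) = (1 + t) *\<^sub>R x - w k *\<^sub>R E"
          using t by (simp add: c_def scaleR_diff_right)
        also have "\<dots> = t *\<^sub>R (x - d) + (y - w k *\<^sub>R E)" by (simp add: y_def algebra_simps)
        finally have "(1 / (1 + t)) *\<^sub>R ((1 + t) *\<^sub>R (x - c *\<^sub>R E)) = (1 / (1 + t)) *\<^sub>R (t *\<^sub>R (x - d) + (y - w k *\<^sub>R E))"
          by simp
        then show ?thesis using t unfolding dec by (simp add: scaleR_add_right)
      qed
      define z where "z = (1 / (1 - c)) *\<^sub>R (x - c *\<^sub>R E)"
      have "z \<in> K"
      proof -
        \<comment> \<open>The fresh index \<open>n'\<close> carries the point \<open>x - d\<close>;
          the other indices carry what remains of \<open>y\<close> without \<open>E\<close>.\<close>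
        define J where "J = insert n' ({..<n'} - {k})"
        define W where "W i = (if i = n' then t / (1 + t) else 1 / (1 + t) * w i) / (1 - c)" for i
        define V where "V i = (if i = n' then x - d else v i)" for i
        have "(\<Sum>i\<in>J. W i *\<^sub>R V i) \<in> K"
        proof (rule convex_sum[OF _ K])
          have "sum W ({..<n'} - {k}) = (\<Sum>i\<in>{..<n'} - {k}. w i / ((1 + t) * (1 - c)))"
            by (intro sum.cong) (auto simp: W_def)
          also have "\<dots> = (1 / (1 + t) / (1 - c)) * (1 - w k)"
            by (simp add: sum_divide_distrib[symmetric] rest)
          finally have "sum W J = (t / (1 + t)) / (1 - c) + (1 / (1 + t) / (1 - c)) * (1 - w k)"
            by (simp add: J_def W_def)
          also have "\<dots> = (t / (1 + t) + 1 / (1 + t) * (1 - w k)) / (1 - c)"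
            by (simp add: add_divide_distrib)
          also have "t / (1 + t) + 1 / (1 + t) * (1 - w k) = 1 - c"
            using t by (simp add: c_def divide_simps)
          finally show "sum W J = 1" using c by simp
          show "0 \<le> W i" if "i \<in> J" for i
            using that t c v by (auto simp: J_def W_def)
          show "V i \<in> K" if "i \<in> J" for i
            using that d v by (auto simp: J_def V_def extreme_point_of_def)
        qed (auto simp: J_def)
        also have "(\<Sum>i\<in>J. W i *\<^sub>R V i) = z"
        proof -
          have "(\<Sum>i\<in>{..<n'} - {k}. W i *\<^sub>R V i) = (1 / (1 - c)) *\<^sub>R (1 / (1 + t)) *\<^sub>R (\<Sum>i\<in>{..<n'} - {k}. w i *\<^sub>R v i)"
            unfolding scaleR_sum_right by (intro sum.cong) (auto simp: W_def V_def)
          moreover have "W n' *\<^sub>R V n' = (1 / (1 - c)) *\<^sub>R (t / (1 + t)) *\<^sub>R (x - d)"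
            by (simp add: W_def V_def)
          ultimately show ?thesis
            by (simp add: J_def z_def xy scaleR_add_right)
        qed
        finally show ?thesis .
      qed
      have "x + (c / (1 - c)) *\<^sub>R (x - E) = z"
      proof -
        have "(1 - c) *\<^sub>R (x + (c / (1 - c)) *\<^sub>R (x - E)) = x - c *\<^sub>R E"
        proof -
          have "(1 - c) * (c / (1 - c)) = c" using c by simp
          then have "(1 - c) *\<^sub>R (x + (c / (1 - c)) *\<^sub>R (x - E)) = (1 - c) *\<^sub>R x + c *\<^sub>R (x - E)"
            by (simp only: scaleR_add_right scaleR_scaleR)
          then show ?thesis by (simp add: algebra_simps)
        qed
        then have "(1 / (1 - c)) *\<^sub>R ((1 - c) *\<^sub>R (x + (c / (1 - c)) *\<^sub>R (x - E))) = z" by (simp only: z_def)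
        then show ?thesis using c by simp
      qed
      then show ?thesis using \<open>z \<in> K\<close> c by (intro exI[of _ "c / (1 - c)"]) auto
    qed
    then obtain q where q: "0 < q" "x + q *\<^sub>R (x - E) \<in> K" by blast
    \<comment> \<open>\<open>r \<le> 1\<close> keeps \<open>x - d2\<close> between \<open>x\<close>
      and \<open>E\<close>, and \<open>r \<le> q\<close> keeps \<open>x + d2\<close> on the
      extension just found.\<close>
    define r where "r = min 1 q"
    have r: "0 < r" "r \<le> 1" "r / q \<le> 1" "0 \<le> r / q" using q by (auto simp: r_def)
    define d2 where "d2 = r *\<^sub>R (x - E)"
    have 1: "x - d2 \<in> K"
      using convex_segment_point[OF K Suc.prems(3) EK, of r] r by (simp add: d2_def algebra_simps)
    have 2: "x + d2 \<in> K"
      using convex_segment_point[OF K Suc.prems(3) q(2), of "r / q"] r q by (simp add: d2_def)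
    have 3: "d2 \<noteq> 0" using r Ex by (simp add: d2_def)
    obtain t2 where t2: "t2 \<ge> 1" "x + t2 *\<^sub>R d2 \<in> K"
      "convex_comb {e. e extreme_point_of K} (card I) (x + t2 *\<^sub>R d2)"
      using step[OF 2 1 3] by blast
    \<comment> \<open>The end point is \<open>x + s (x - E)\<close>, whence the weights
      \<open>1/(1+s)\<close> for it and \<open>s/(1+s)\<close> for \<open>E\<close>.\<close>
    define s where "s = t2 * r"
    have s: "0 < s" using t2 r by (simp add: s_def)
    have "x = (1 - s / (1 + s)) *\<^sub>R (x + t2 *\<^sub>R d2) + (s / (1 + s)) *\<^sub>R E"
    proof -
      have "1 - s / (1 + s) = 1 / (1 + s)" using s by (simp add: field_simps)
      moreover have "(1 / (1 + s)) *\<^sub>R ((x + t2 *\<^sub>R d2) + s *\<^sub>R E) = x"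
      proof -
        have "(x + t2 *\<^sub>R d2) + s *\<^sub>R E = (1 + s) *\<^sub>R x"
          by (simp add: d2_def s_def algebra_simps)
        then show ?thesis using s by simp
      qed
      ultimately show ?thesis by (simp add: scaleR_add_right)
    qed
    then show ?thesis
      using convex_comb_insert[OF t2(3), of E "s / (1 + s)"] E s by auto
  qed
qed

text \<open>Pointwise scaling turns real-valued functions into a real vector space, the ambient
  space in which Dubins' theorem is applied to occupation measures.\<close>

instantiation "fun" :: (type, real_vector) real_vector
begin
definition "r *\<^sub>R f = (\<lambda>x. r *\<^sub>R f x)"
instance
  by standard (auto simp: scaleR_fun_def fun_eq_iff scaleR_add_right scaleR_add_left)
end

section \<open>Combinations of finite measures\<close>

text \<open>The bound passes from sets to functions by induction on measurable functions, so no
  density of \<open>K\<close> has to be produced.\<close>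

lemma nn_integral_le_combination:
  assumes s: "sets K = sets M" "sets M1 = sets M" "sets M2 = sets M"
    and le: "\<And>\<Gamma>. \<Gamma> \<in> sets M \<Longrightarrow> emeasure K \<Gamma> \<le> C * (emeasure M1 \<Gamma> + emeasure M2 \<Gamma>)"
    and f: "f \<in> borel_measurable M"
  shows "(\<integral>\<^sup>+x. f x \<partial>K) \<le> C * ((\<integral>\<^sup>+x. f x \<partial>M1) + (\<integral>\<^sup>+x. f x \<partial>M2))"
  using f
proof (induction rule: borel_measurable_induct)
  case (cong f g)
  have e: "integral\<^sup>N N f = integral\<^sup>N N g" if "sets N = sets M" for N
    using cong(3) sets_eq_imp_space_eq[OF that] by (intro nn_integral_cong) auto
  show ?case using cong(4) by (simp add: e s)
next
  case (set A)
  then show ?case using le by (simp add: s)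
next
  case (mult u c)
  have [measurable]: "u \<in> borel_measurable K" "u \<in> borel_measurable M1" "u \<in> borel_measurable M2"
    using mult(2) s by (simp_all cong: measurable_cong_sets)
  have "c * integral\<^sup>N K u \<le> c * (C * (integral\<^sup>N M1 u + integral\<^sup>N M2 u))"
    using mult by (intro mult_left_mono) auto
  then show ?case by (simp add: nn_integral_cmult distrib_left mult_ac)
next
  case (add u v)
  have [measurable]: "u \<in> borel_measurable K" "u \<in> borel_measurable M1" "u \<in> borel_measurable M2"
    "v \<in> borel_measurable K" "v \<in> borel_measurable M1" "v \<in> borel_measurable M2"
    using add(1,3) s by (simp_all cong: measurable_cong_sets)
  have "integral\<^sup>N K u + integral\<^sup>N K v
      \<le> C * (integral\<^sup>N M1 u + integral\<^sup>N M2 u) + C * (integral\<^sup>N M1 v + integral\<^sup>N M2 v)"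
    using add by (intro add_mono) auto
  then show ?case by (simp add: nn_integral_add distrib_left add_ac)
next
  case (seq U)
  have [measurable]: "U i \<in> borel_measurable K" for i
    using seq(1) s by (simp cong: measurable_cong_sets)
  have "(\<integral>\<^sup>+x. (SUP i. U i x) \<partial>K) = (SUP i. integral\<^sup>N K (U i))"
    using seq by (intro nn_integral_monotone_convergence_SUP) auto
  also have "\<dots> \<le> C * ((\<integral>\<^sup>+x. (SUP i. U i x) \<partial>M1) + (\<integral>\<^sup>+x. (SUP i. U i x) \<partial>M2))"
  proof (rule SUP_least)
    fix i
    have "integral\<^sup>N K (U i) \<le> C * (integral\<^sup>N M1 (U i) + integral\<^sup>N M2 (U i))" by (rule seq)
    also have "\<dots> \<le> C * ((\<integral>\<^sup>+x. (SUP i. U i x) \<partial>M1) + (\<integral>\<^sup>+x. (SUP i. U i x) \<partial>M2))"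
      by (intro mult_left_mono add_mono nn_integral_mono SUP_upper) auto
    finally show "integral\<^sup>N K (U i) \<le> C * ((\<integral>\<^sup>+x. (SUP i. U i x) \<partial>M1) + (\<integral>\<^sup>+x. (SUP i. U i x) \<partial>M2))" .
  qed
  finally show ?case by (simp add: image_comp)
qed

lemma suminf_finite_imp_tendsto_0:
  fixes f :: "nat \<Rightarrow> ennreal"
  assumes "suminf f < top"
  shows "f \<longlonglongrightarrow> 0"
proof -
  have "f n < top" for n using assms by (rule ennreal_suminf_lessD)
  then have f: "f n = ennreal (enn2real (f n))" for n by simp
  then have "(\<Sum>n. ennreal (enn2real (f n))) \<noteq> top" using assms by simp
  then have "summable (\<lambda>n. enn2real (f n))" by (intro summable_suminf_not_top) auto
  then have "(\<lambda>n. ennreal (enn2real (f n))) \<longlonglongrightarrow> ennreal 0"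
    by (intro tendsto_ennrealI summable_LIMSEQ_zero)
  then show ?thesis using f by simp
qed


text \<open>An affine combination with a negative coefficient has no direct meaning in
  \<open>ennreal\<close>; two terms on each side express it without subtraction. Finiteness of the
  coefficients is used to pass products to the limit.\<close>

lemma nn_integral_eq_combination:
  assumes s: "sets K = sets M" "sets M1 = sets M" "sets M2 = sets M" "sets M3 = sets M"
    and fin: "a < top" "b < top" "c < top" "d < top"
    and eq: "\<And>\<Gamma>. \<Gamma> \<in> sets M \<Longrightarrow> a * emeasure K \<Gamma> + b * emeasure M1 \<Gamma> = c * emeasure M2 \<Gamma> + d * emeasure M3 \<Gamma>"
    and f: "f \<in> borel_measurable M"
  shows "a * (\<integral>\<^sup>+x. f x \<partial>K) + b * (\<integral>\<^sup>+x. f x \<partial>M1) = c * (\<integral>\<^sup>+x. f x \<partial>M2) + d * (\<integral>\<^sup>+x. f x \<partial>M3)"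
  using f
proof (induction rule: borel_measurable_induct)
  case (cong f g)
  have e: "integral\<^sup>N N f = integral\<^sup>N N g" if "sets N = sets M" for N
    using cong(3) sets_eq_imp_space_eq[OF that] by (intro nn_integral_cong) auto
  show ?case using cong(4) by (simp add: e s)
next
  case (set A)
  then show ?case using eq by (simp add: s)
next
  case (mult u k)
  have [measurable]: "u \<in> borel_measurable K" "u \<in> borel_measurable M1" "u \<in> borel_measurable M2" "u \<in> borel_measurable M3"
    using mult(2) s by (simp_all cong: measurable_cong_sets)
  have "k * (a * integral\<^sup>N K u + b * integral\<^sup>N M1 u) = k * (c * integral\<^sup>N M2 u + d * integral\<^sup>N M3 u)"
    using mult by simp
  then show ?case by (simp add: nn_integral_cmult distrib_left mult_ac)
next
  case (add u v)
  have [measurable]: "u \<in> borel_measurable K" "u \<in> borel_measurable M1" "u \<in> borel_measurable M2" "u \<in> borel_measurable M3"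
    "v \<in> borel_measurable K" "v \<in> borel_measurable M1" "v \<in> borel_measurable M2" "v \<in> borel_measurable M3"
    using add(1,3) s by (simp_all cong: measurable_cong_sets)
  have "(a * integral\<^sup>N K u + b * integral\<^sup>N M1 u) + (a * integral\<^sup>N K v + b * integral\<^sup>N M1 v)
      = (c * integral\<^sup>N M2 u + d * integral\<^sup>N M3 u) + (c * integral\<^sup>N M2 v + d * integral\<^sup>N M3 v)"
    using add by simp
  then show ?case by (simp add: nn_integral_add distrib_left add_ac)
next
  case (seq U)
  have lim: "(\<lambda>i. integral\<^sup>N N (U i)) \<longlonglongrightarrow> integral\<^sup>N N (SUP i. U i)" if N: "sets N = sets M" for N
  proof -
    have "U i \<in> borel_measurable N" for i using seq(1) N by (simp cong: measurable_cong_sets)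
    then have "(\<integral>\<^sup>+x. (SUP i. U i x) \<partial>N) = (SUP i. integral\<^sup>N N (U i))"
      using seq by (intro nn_integral_monotone_convergence_SUP) auto
    moreover have "incseq (\<lambda>i. integral\<^sup>N N (U i))"
      using \<open>incseq U\<close> by (auto intro!: nn_integral_mono simp: incseq_def le_fun_def)
    moreover have "(SUP i. U i) = (\<lambda>x. SUP i. U i x)" by (auto simp: fun_eq_iff image_comp)
    ultimately show ?thesis using LIMSEQ_SUP[of "\<lambda>i. integral\<^sup>N N (U i)"] by simp
  qed
  have "(\<lambda>i. a * integral\<^sup>N K (U i) + b * integral\<^sup>N M1 (U i)) \<longlonglongrightarrow> a * integral\<^sup>N K (SUP i. U i) + b * integral\<^sup>N M1 (SUP i. U i)"
    by (intro tendsto_add ennreal_tendsto_cmult fin lim s)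
  moreover have "(\<lambda>i. c * integral\<^sup>N M2 (U i) + d * integral\<^sup>N M3 (U i)) \<longlonglongrightarrow> c * integral\<^sup>N M2 (SUP i. U i) + d * integral\<^sup>N M3 (SUP i. U i)"
    by (intro tendsto_add ennreal_tendsto_cmult fin lim s)
  ultimately show ?case unfolding seq.IH by (rule LIMSEQ_unique)
qed

text \<open>Countable additivity is inherited from convergent real series, where signed coefficients
  are harmless; nonnegativity on every set then turns the combination into a measure.\<close>

lemma real_combination_measure:
  assumes \<mu>: "finite_measure \<mu>" "sets \<mu> = sets M" and \<nu>: "finite_measure \<nu>" "sets \<nu> = sets M"
    and nonneg: "\<And>\<Gamma>. \<Gamma> \<in> sets M \<Longrightarrow> 0 \<le> a * measure \<mu> \<Gamma> + b * measure \<nu> \<Gamma>"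
  obtains \<kappa> where "sets \<kappa> = sets M" "finite_measure \<kappa>"
    "\<And>\<Gamma>. \<Gamma> \<in> sets M \<Longrightarrow> measure \<kappa> \<Gamma> = a * measure \<mu> \<Gamma> + b * measure \<nu> \<Gamma>"
proof -
  interpret \<mu>: finite_measure \<mu> by fact
  interpret \<nu>: finite_measure \<nu> by fact
  define F where "F \<Gamma> = a * measure \<mu> \<Gamma> + b * measure \<nu> \<Gamma>" for \<Gamma>
  define \<kappa> where "\<kappa> = measure_of (space M) (sets M) (\<lambda>\<Gamma>. ennreal (F \<Gamma>))"
  have sets_\<kappa>: "sets \<kappa> = sets M" by (simp add: \<kappa>_def sets.sets_measure_of_eq)
  have e: "emeasure \<kappa> \<Gamma> = ennreal (F \<Gamma>)" if "\<Gamma> \<in> sets M" for \<Gamma>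
    unfolding \<kappa>_def
  proof (rule emeasure_measure_of_sigma)
    show "sigma_algebra (space M) (sets M)" ..
    show "positive (sets M) (\<lambda>\<Gamma>. ennreal (F \<Gamma>))" by (simp add: positive_def F_def)
    show "countably_additive (sets M) (\<lambda>\<Gamma>. ennreal (F \<Gamma>))"
    proof (rule countably_additiveI)
      fix A :: "nat \<Rightarrow> _" assume A: "range A \<subseteq> sets M" "disjoint_family A" "(\<Union>i. A i) \<in> sets M"
      have "(\<lambda>i. measure \<mu> (A i)) sums measure \<mu> (\<Union>i. A i)"
        using A \<mu>(2) by (intro \<mu>.finite_measure_UNION) auto
      moreover have "(\<lambda>i. measure \<nu> (A i)) sums measure \<nu> (\<Union>i. A i)"
        using A \<nu>(2) by (intro \<nu>.finite_measure_UNION) auto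
      ultimately have "(\<lambda>i. F (A i)) sums F (\<Union>i. A i)"
        unfolding F_def by (intro sums_add sums_mult)
      moreover have "0 \<le> F (A i)" for i using A(1) nonneg by (auto simp: F_def)
      ultimately show "(\<Sum>i. ennreal (F (A i))) = ennreal (F (\<Union>i. A i))"
        by (intro suminf_ennreal_eq)
    qed
  qed fact
  show thesis
  proof (rule that[OF sets_\<kappa>])
    show "finite_measure \<kappa>"
      using sets_eq_imp_space_eq[OF sets_\<kappa>] by (intro finite_measureI) (simp add: e)
    show "measure \<kappa> \<Gamma> = a * measure \<mu> \<Gamma> + b * measure \<nu> \<Gamma>" if "\<Gamma> \<in> sets M" for \<Gamma>
      using e[OF that] nonneg[OF that] by (simp add: measure_def F_def)
  qed
qed

text \<open>Of \<open>t - 1\<close> and \<open>1 - t\<close> the negative one is truncated to 0 by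
  \<open>ennreal\<close>, so a single identity covers both interpolation and extrapolation.\<close>

lemma emeasure_combination:
  assumes \<kappa>: "finite_measure \<kappa>" and \<mu>: "finite_measure \<mu>" and \<nu>: "finite_measure \<nu>" and t: "0 \<le> t"
    and eq: "measure \<kappa> \<Gamma> = (1 - t) * measure \<mu> \<Gamma> + t * measure \<nu> \<Gamma>"
  shows "1 * emeasure \<kappa> \<Gamma> + ennreal (t - 1) * emeasure \<mu> \<Gamma> = ennreal t * emeasure \<nu> \<Gamma> + ennreal (1 - t) * emeasure \<mu> \<Gamma>"
proof -
  interpret \<kappa>: finite_measure \<kappa> by fact
  interpret \<mu>: finite_measure \<mu> by fact
  interpret \<nu>: finite_measure \<nu> by fact
  show ?thesis
  proof (cases "t \<le> 1")
    case True
    then show ?thesis using t eq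
      by (simp add: \<kappa>.emeasure_eq_measure \<mu>.emeasure_eq_measure \<nu>.emeasure_eq_measure ennreal_neg
          ennreal_mult'[symmetric] ennreal_plus[symmetric] add.commute del: ennreal_plus)
  next
    case False
    have "measure \<kappa> \<Gamma> + (t - 1) * measure \<mu> \<Gamma> = t * measure \<nu> \<Gamma>" using eq by (simp add: algebra_simps)
    then show ?thesis using False t
      by (simp add: \<kappa>.emeasure_eq_measure \<mu>.emeasure_eq_measure \<nu>.emeasure_eq_measure ennreal_neg
          ennreal_mult'[symmetric] ennreal_plus[symmetric] del: ennreal_plus)
  qed
qed

text \<open>Adding the bound \<open>c\<close> makes \<open>g\<close> nonnegative, and the identity
  for \<open>ennreal\<close> integrals applies; the shift contributes \<open>c\<close> times the
  total mass, which obeys the same affine relation.\<close>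

lemma integral_combination:
  fixes g :: "'b \<Rightarrow> real"
  assumes \<kappa>: "finite_measure \<kappa>" "sets \<kappa> = sets M" and \<mu>: "finite_measure \<mu>" "sets \<mu> = sets M"
    and \<nu>: "finite_measure \<nu>" "sets \<nu> = sets M" and t: "0 \<le> t"
    and eq: "\<And>\<Gamma>. \<Gamma> \<in> sets M \<Longrightarrow> measure \<kappa> \<Gamma> = (1 - t) * measure \<mu> \<Gamma> + t * measure \<nu> \<Gamma>"
    and g[measurable]: "g \<in> borel_measurable M" and bd: "\<And>z. z \<in> space M \<Longrightarrow> \<bar>g z\<bar> \<le> c"
  shows "(\<integral>z. g z \<partial>\<kappa>) = (1 - t) * (\<integral>z. g z \<partial>\<mu>) + t * (\<integral>z. g z \<partial>\<nu>)"
proof -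
  note set_eq = emeasure_combination[OF \<kappa>(1) \<mu>(1) \<nu>(1) t eq]
  have key: "(\<integral>z. h z \<partial>\<kappa>) = (1 - t) * (\<integral>z. h z \<partial>\<mu>) + t * (\<integral>z. h z \<partial>\<nu>)"
    if h[measurable]: "h \<in> borel_measurable M" and h0: "\<And>z. z \<in> space M \<Longrightarrow> 0 \<le> h z" and hk: "\<And>z. z \<in> space M \<Longrightarrow> h z \<le> k" for h :: "'b \<Rightarrow> real" and k
  proof -
    have I: "(\<integral>\<^sup>+z. ennreal (h z) \<partial>N) = ennreal (\<integral>z. h z \<partial>N)" "0 \<le> (\<integral>z. h z \<partial>N)" if N: "finite_measure N" "sets N = sets M" for N
    proof -
      interpret finite_measure N by fact
      have s: "space N = space M" using N(2) by (rule sets_eq_imp_space_eq)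
      have "integrable N h"
        using h N(2) h0 hk by (intro integrable_const_bound[where B=k] AE_I2) (auto simp: s cong: measurable_cong_sets)
      then show "(\<integral>\<^sup>+z. ennreal (h z) \<partial>N) = ennreal (\<integral>z. h z \<partial>N)"
        using h0 by (intro nn_integral_eq_integral) (auto simp: s)
      show "0 \<le> (\<integral>z. h z \<partial>N)" using h0 by (intro Bochner_Integration.integral_nonneg) (simp add: s)
    qed
    have "1 * (\<integral>\<^sup>+z. ennreal (h z) \<partial>\<kappa>) + ennreal (t - 1) * (\<integral>\<^sup>+z. ennreal (h z) \<partial>\<mu>)
        = ennreal t * (\<integral>\<^sup>+z. ennreal (h z) \<partial>\<nu>) + ennreal (1 - t) * (\<integral>\<^sup>+z. ennreal (h z) \<partial>\<mu>)"
      by (rule nn_integral_eq_combination[OF \<kappa>(2) \<mu>(2) \<nu>(2) \<mu>(2) _ _ _ _ set_eq]) auto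
    then have eq: "ennreal (\<integral>z. h z \<partial>\<kappa>) + ennreal (t - 1) * ennreal (\<integral>z. h z \<partial>\<mu>)
        = ennreal t * ennreal (\<integral>z. h z \<partial>\<nu>) + ennreal (1 - t) * ennreal (\<integral>z. h z \<partial>\<mu>)"
      by (simp add: I(1)[OF \<kappa>] I(1)[OF \<mu>] I(1)[OF \<nu>])
    note nn = I(2)[OF \<kappa>] I(2)[OF \<mu>] I(2)[OF \<nu>]
    show ?thesis
    proof (cases "t \<le> 1")
      case True
      then have "ennreal (\<integral>z. h z \<partial>\<kappa>) = ennreal (t * (\<integral>z. h z \<partial>\<nu>) + (1 - t) * (\<integral>z. h z \<partial>\<mu>))"
        using eq nn t by (simp add: ennreal_neg ennreal_mult ennreal_plus)
      then have "(\<integral>z. h z \<partial>\<kappa>) = t * (\<integral>z. h z \<partial>\<nu>) + (1 - t) * (\<integral>z. h z \<partial>\<mu>)"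
        using nn t True by (subst (asm) ennreal_inj) auto
      then show ?thesis by simp
    next
      case False
      then have "ennreal ((\<integral>z. h z \<partial>\<kappa>) + (t - 1) * (\<integral>z. h z \<partial>\<mu>)) = ennreal (t * (\<integral>z. h z \<partial>\<nu>))"
        using eq nn t by (simp add: ennreal_neg ennreal_mult ennreal_plus)
      then have "(\<integral>z. h z \<partial>\<kappa>) + (t - 1) * (\<integral>z. h z \<partial>\<mu>) = t * (\<integral>z. h z \<partial>\<nu>)"
        using nn t False by (subst (asm) ennreal_inj) auto
      then show ?thesis by (simp add: algebra_simps)
    qed
  qed
  have shift: "(\<integral>z. g z + c \<partial>N) = (\<integral>z. g z \<partial>N) + c * measure N (space N)" if N: "finite_measure N" "sets N = sets M" for N
  proof -
    interpret finite_measure N by fact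
    have s: "space N = space M" using N(2) by (rule sets_eq_imp_space_eq)
    have "integrable N g"
      using g N(2) bd by (intro integrable_const_bound[where B=c] AE_I2) (auto simp: s cong: measurable_cong_sets)
    then show ?thesis by simp
  qed
  have 1: "(\<integral>z. g z + c \<partial>\<kappa>) = (1 - t) * (\<integral>z. g z + c \<partial>\<mu>) + t * (\<integral>z. g z + c \<partial>\<nu>)"
    using bd by (intro key[where k="2 * c"]) (auto simp: abs_le_iff, fastforce+)
  have 2: "measure \<kappa> (space \<kappa>) = (1 - t) * measure \<mu> (space \<mu>) + t * measure \<nu> (space \<nu>)"
    using eq[of "space M"] sets_eq_imp_space_eq[OF \<kappa>(2)] sets_eq_imp_space_eq[OF \<mu>(2)] sets_eq_imp_space_eq[OF \<nu>(2)] by simp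
  show ?thesis using 1[unfolded shift[OF \<kappa>] shift[OF \<mu>] shift[OF \<nu>] 2] by (simp add: algebra_simps)
qed


text \<open>\<open>V\<close> is the variance of \<open>c\<close>. The densities
  \<open>1 + c - u\<close> and \<open>1 - c + u\<close> have mean one and move the mean of
  \<open>c\<close> up and down by \<open>V\<close>, so the two tilted laws share their mean only if
  \<open>V\<close> vanishes. In the second case \<open>V\<close> is added on the left to avoid
  subtraction.\<close>

lemma (in prob_space) tilted_moments:
  fixes c :: "'a \<Rightarrow> real"
  assumes [measurable]: "c \<in> borel_measurable M" and c: "\<And>a. 0 \<le> c a" "\<And>a. c a \<le> 1"
  defines "u \<equiv> \<integral>a. c a \<partial>M" and "V \<equiv> \<integral>\<^sup>+a. ennreal ((c a - (\<integral>a. c a \<partial>M))\<^sup>2) \<partial>M"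
  shows "0 \<le> u" "u \<le> 1" "(\<integral>\<^sup>+a. ennreal (1 + c a - u) \<partial>M) = 1" "(\<integral>\<^sup>+a. ennreal (1 - c a + u) \<partial>M) = 1"
    "(\<integral>\<^sup>+a. ennreal (1 + c a - u) * ennreal (c a) \<partial>M) = ennreal u + V"
    "(\<integral>\<^sup>+a. ennreal (1 - c a + u) * ennreal (c a) \<partial>M) + V = ennreal u"
    "V \<le> 1"
proof -
  have int[simp]: "integrable M c" by (rule integrable_const_bound[where B=1]) (auto simp: c)
  have int2[simp]: "integrable M (\<lambda>a. c a * c a)"
    by (rule integrable_const_bound[where B=1]) (auto simp: c intro!: mult_le_one)
  show u: "0 \<le> u" "u \<le> 1"
    using integral_mono[of M c "\<lambda>_. 1"] by (auto simp: u_def c prob_space intro!: Bochner_Integration.integral_nonneg)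
  define s where "s = (\<integral>a. c a * c a \<partial>M)"
  have V: "V = ennreal (s - u * u)" "0 \<le> s - u * u"
  proof -
    have sq: "(\<lambda>a. (c a - u)\<^sup>2) = (\<lambda>a. c a * c a - 2 * u * c a + u * u)"
      by (auto simp: power2_eq_square algebra_simps)
    have "(\<integral>a. (c a - u)\<^sup>2 \<partial>M) = s - 2 * u * u + u * u"
      unfolding sq by (simp add: s_def u_def[symmetric] prob_space)
    then have e: "(\<integral>a. (c a - u)\<^sup>2 \<partial>M) = s - u * u" by simp
    have "V = (\<integral>\<^sup>+a. ennreal ((c a - u)\<^sup>2) \<partial>M)" by (simp add: V_def u_def)
    also have "\<dots> = ennreal (\<integral>a. (c a - u)\<^sup>2 \<partial>M)"
      by (rule nn_integral_eq_integral) (auto simp: sq)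
    finally show "V = ennreal (s - u * u)" using e by simp
    show "0 \<le> s - u * u" unfolding e[symmetric] by (rule Bochner_Integration.integral_nonneg) simp
  qed
  have nn: "0 \<le> 1 + c a - u" "0 \<le> 1 - c a + u" for a using u c[of a] by auto
  have "(\<integral>\<^sup>+a. ennreal (1 + c a - u) \<partial>M) = ennreal (\<integral>a. 1 + c a - u \<partial>M)"
    by (rule nn_integral_eq_integral[OF _ AE_I2]) (simp, rule nn)
  then show "(\<integral>\<^sup>+a. ennreal (1 + c a - u) \<partial>M) = 1" by (simp add: prob_space u_def[symmetric])
  have "(\<integral>\<^sup>+a. ennreal (1 - c a + u) \<partial>M) = ennreal (\<integral>a. 1 - c a + u \<partial>M)"
    by (rule nn_integral_eq_integral[OF _ AE_I2]) (simp, rule nn)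
  then show "(\<integral>\<^sup>+a. ennreal (1 - c a + u) \<partial>M) = 1" by (simp add: prob_space u_def[symmetric])
  have "(\<integral>\<^sup>+a. ennreal (1 + c a - u) * ennreal (c a) \<partial>M) = (\<integral>\<^sup>+a. ennreal (c a + c a * c a - u * c a) \<partial>M)"
  proof (rule nn_integral_cong)
    fix a
    have "ennreal (1 + c a - u) * ennreal (c a) = ennreal ((1 + c a - u) * c a)"
      by (rule ennreal_mult[symmetric]) (rule nn c)+
    also have "(1 + c a - u) * c a = c a + c a * c a - u * c a" by (simp add: algebra_simps)
    finally show "ennreal (1 + c a - u) * ennreal (c a) = ennreal (c a + c a * c a - u * c a)" .
  qed
  also have "\<dots> = ennreal (\<integral>a. c a + c a * c a - u * c a \<partial>M)"
  proof (rule nn_integral_eq_integral)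
    show "AE a in M. 0 \<le> c a + c a * c a - u * c a"
    proof (rule AE_I2)
      fix a
      have "c a + c a * c a - u * c a = c a * (1 + c a - u)" by (simp add: algebra_simps)
      then show "0 \<le> c a + c a * c a - u * c a" using nn(1)[of a] c(1)[of a] by (simp only: mult_nonneg_nonneg)
    qed
  qed auto
  also have "\<dots> = ennreal (u + (s - u * u))" by (simp add: u_def[symmetric] s_def[symmetric] add_diff_eq)
  finally show "(\<integral>\<^sup>+a. ennreal (1 + c a - u) * ennreal (c a) \<partial>M) = ennreal u + V"
    using V u by (simp add: ennreal_plus[symmetric] del: ennreal_plus)
  have "(\<integral>\<^sup>+a. ennreal (1 - c a + u) * ennreal (c a) \<partial>M) = (\<integral>\<^sup>+a. ennreal (c a - c a * c a + u * c a) \<partial>M)"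
  proof (rule nn_integral_cong)
    fix a
    have "ennreal (1 - c a + u) * ennreal (c a) = ennreal ((1 - c a + u) * c a)"
      by (rule ennreal_mult[symmetric]) (rule nn c)+
    also have "(1 - c a + u) * c a = c a - c a * c a + u * c a" by (simp add: algebra_simps)
    finally show "ennreal (1 - c a + u) * ennreal (c a) = ennreal (c a - c a * c a + u * c a)" .
  qed
  also have "\<dots> = ennreal (\<integral>a. c a - c a * c a + u * c a \<partial>M)"
  proof (rule nn_integral_eq_integral)
    show "AE a in M. 0 \<le> c a - c a * c a + u * c a"
    proof (rule AE_I2)
      fix a
      have "c a - c a * c a + u * c a = c a * (1 - c a + u)" by (simp add: algebra_simps)
      then show "0 \<le> c a - c a * c a + u * c a" using nn(2)[of a] c(1)[of a] by (simp only: mult_nonneg_nonneg)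
    qed
  qed auto
  finally have e: "(\<integral>\<^sup>+a. ennreal (1 - c a + u) * ennreal (c a) \<partial>M) = ennreal (u - s + u * u)"
    by (simp add: u_def[symmetric] s_def[symmetric])
  have "s \<le> u" unfolding s_def u_def by (intro integral_mono) (auto simp: c mult_left_le)
  then have "0 \<le> u - s + u * u" using u by simp
  then show "(\<integral>\<^sup>+a. ennreal (1 - c a + u) * ennreal (c a) \<partial>M) + V = ennreal u"
    unfolding e V(1) using V(2) by (simp add: ennreal_plus[symmetric] del: ennreal_plus)
  show "V \<le> 1" unfolding V(1) using \<open>s \<le> u\<close> u by (auto simp: ennreal_le_1 intro: order_trans[of _ s])
qed


section \<open>Absorbing Markov decision processes\<close>

text \<open>Topology is dropped: the action space is a bare measurable space whose standard Borel
  structure is recorded by the pair of measurable maps in \<open>coding\<close>.\<close>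

locale mdp =
  fixes MX :: "'x measure" and MA :: "'a measure" and Aset :: "'x \<Rightarrow> 'a set"
    and Q :: "'x \<times> 'a \<Rightarrow> 'x measure" and \<eta> :: "'x measure" and \<Delta> :: "'x set"
  assumes Q[measurable]: "Q \<in> MX \<Otimes>\<^sub>M MA \<rightarrow>\<^sub>M prob_algebra MX"
    and prob_\<eta>: "prob_space \<eta>" and sets_\<eta>[measurable_cong, simp]: "sets \<eta> = sets MX"
    and Aset: "\<And>x. x \<in> space MX \<Longrightarrow> Aset x \<in> sets MA"
    and graph[measurable]: "Sigma (space MX) Aset \<in> sets (MX \<Otimes>\<^sub>M MA)"
    and selector: "\<exists>\<theta>. \<theta> \<in> MX \<rightarrow>\<^sub>M MA \<and> (\<forall>x\<in>space MX. \<theta> x \<in> Aset x)"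
    and coding: "\<exists>(c :: 'a \<Rightarrow> real) d. c \<in> borel_measurable MA \<and> (\<forall>a. 0 \<le> c a \<and> c a \<le> 1) \<and>
      d \<in> borel \<rightarrow>\<^sub>M MA \<and> (\<forall>a\<in>space MA. d (c a) = a)"
    and \<Delta>[measurable]: "\<Delta> \<in> sets MX"
    and \<Delta>_closed: "\<And>x a. x \<in> \<Delta> \<Longrightarrow> a \<in> space MA \<Longrightarrow> emeasure (Q (x, a)) \<Delta> = 1"
    and absorbing: "\<And>\<pi> P. is_policy MX MA Aset \<pi> \<Longrightarrow> is_strategic_measure MX MA Q \<eta> \<pi> P \<Longrightarrow>
      (\<integral>\<^sup>+\<omega>. ennreal_of_enat (hit_time \<Delta> \<omega>) \<partial>P) < \<infinity>"
begin

abbreviation "MXA \<equiv> MX \<Otimes>\<^sub>M MA"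

abbreviation "paths \<equiv> path_space MX MA"

abbreviation "hists \<equiv> hist_space MX MA"

abbreviation "strategic \<equiv> is_strategic_measure MX MA Q \<eta>"

section \<open>Admissible kernels and their disintegration\<close>

definition kernels :: "('x \<Rightarrow> 'a measure) set" where
  "kernels = {\<phi>. \<phi> \<in> MX \<rightarrow>\<^sub>M prob_algebra MA \<and> (\<forall>x\<in>space MX. emeasure (\<phi> x) (Aset x) = 1)}"

lemma kernelsD:
  assumes "\<phi> \<in> kernels"
  shows "\<phi> \<in> MX \<rightarrow>\<^sub>M prob_algebra MA" "x \<in> space MX \<Longrightarrow> emeasure (\<phi> x) (Aset x) = 1"
    "x \<in> space MX \<Longrightarrow> prob_space (\<phi> x)" "x \<in> space MX \<Longrightarrow> sets (\<phi> x) = sets MA"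
proof -
  show *: "\<phi> \<in> MX \<rightarrow>\<^sub>M prob_algebra MA" using assms by (simp add: kernels_def)
  show "x \<in> space MX \<Longrightarrow> emeasure (\<phi> x) (Aset x) = 1" using assms by (simp add: kernels_def)
  show "x \<in> space MX \<Longrightarrow> prob_space (\<phi> x)" "x \<in> space MX \<Longrightarrow> sets (\<phi> x) = sets MA"
    using measurable_space[OF *] by (auto simp: space_prob_algebra)
qed

lemma space_MX_ne: "space MX \<noteq> {}"
  using prob_space.not_empty[OF prob_\<eta>] sets_eq_imp_space_eq[OF sets_\<eta>] by simp

lemma space_MXA_ne: "space MXA \<noteq> {}"
proof -
  obtain \<theta> where "\<theta> \<in> MX \<rightarrow>\<^sub>M MA" using selector by blast
  then have "space MA \<noteq> {}" using space_MX_ne by (auto dest: measurable_space)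
  then show ?thesis using space_MX_ne by (simp add: space_pair_measure)
qed

lemma Q_D:
  assumes "z \<in> space MXA"
  shows "prob_space (Q z)" "sets (Q z) = sets MX" "space (Q z) = space MX"
  using measurable_space[OF Q assms] by (auto simp: space_prob_algebra dest: sets_eq_imp_space_eq)

lemma ksemi_cong_AE:
  assumes m: "sets m = sets MX" and "\<phi> \<in> MX \<rightarrow>\<^sub>M prob_algebra MA" "\<psi> \<in> MX \<rightarrow>\<^sub>M prob_algebra MA"
    and "AE x in m. \<phi> x = \<psi> x"
  shows "ksemi MXA m \<phi> = ksemi MXA m \<psi>"
proof (rule measure_eqI)
  show "sets (ksemi MXA m \<phi>) = sets (ksemi MXA m \<psi>)"
    using assms by (simp add: sets_ksemi space_MX_ne)
  fix \<Gamma> assume "\<Gamma> \<in> sets (ksemi MXA m \<phi>)"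
  then have "\<Gamma> \<in> sets MXA" using assms by (simp add: sets_ksemi space_MX_ne)
  then show "emeasure (ksemi MXA m \<phi>) \<Gamma> = emeasure (ksemi MXA m \<psi>) \<Gamma>"
    using assms by (auto simp: emeasure_ksemi space_MX_ne intro!: nn_integral_cong_AE)
qed

text \<open>A disintegration is admissible only at almost every state. The exceptional states form a
  measurable set because the graph is measurable, and there the kernel is replaced by the point mass
  at a selector.\<close>

lemma kernel_disintegration:
  assumes l: "finite_measure l" "sets l = sets MXA" and K: "AE z in l. snd z \<in> Aset (fst z)"
  obtains \<phi> where "\<phi> \<in> kernels" "l = ksemi MXA (distr l MX fst) \<phi>"
proof -
  define m where "m = distr l MX fst"
  have m[simp, measurable_cong]: "sets m = sets MX" "space m = space MX" by (simp_all add: m_def)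
  obtain c :: "'a \<Rightarrow> real" and d where cd: "c \<in> borel_measurable MA" "\<And>a. 0 \<le> c a" "\<And>a. c a \<le> 1"
      "d \<in> borel \<rightarrow>\<^sub>M MA" "\<And>a. a \<in> space MA \<Longrightarrow> d (c a) = a"
    using coding by blast
  obtain \<phi> where \<phi>[measurable]: "\<phi> \<in> MX \<rightarrow>\<^sub>M prob_algebra MA" and l_eq: "l = ksemi MXA m \<phi>"
    by (rule coded_disintegration[OF l space_MX_ne cd]) (auto simp: m_def)
  obtain \<theta> where \<theta>[measurable]: "\<theta> \<in> MX \<rightarrow>\<^sub>M MA" and \<theta>_mem: "\<And>x. x \<in> space MX \<Longrightarrow> \<theta> x \<in> Aset x"
    using selector by blast
  have \<phi>_prob: "prob_space (\<phi> x)" "sets (\<phi> x) = sets MA" if "x \<in> space MX" for x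
    using measurable_space[OF \<phi> that] by (auto simp: space_prob_algebra)
  have meas[measurable]: "(\<lambda>x. measure (\<phi> x) (Aset x)) \<in> borel_measurable MX"
    by (rule measure_measurable_prob_algebra2[OF graph \<phi>])
  define \<psi> where "\<psi> x = (if measure (\<phi> x) (Aset x) = 1 then \<phi> x else return MA (\<theta> x))" for x
  have \<psi>[measurable]: "\<psi> \<in> MX \<rightarrow>\<^sub>M prob_algebra MA"
    unfolding \<psi>_def by measurable
  have "\<psi> \<in> kernels"
  proof -
    have "emeasure (\<psi> x) (Aset x) = 1" if x: "x \<in> space MX" for x
    proof -
      interpret prob_space "\<phi> x" by (rule \<phi>_prob[OF x])
      show ?thesis
        using \<theta>_mem[OF x] Aset[OF x] by (simp add: \<psi>_def emeasure_eq_measure)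
    qed
    then show ?thesis using \<psi> by (simp add: kernels_def)
  qed
  moreover have "AE x in m. \<phi> x = \<psi> x"
  proof -
    let ?G = "space MXA - Sigma (space MX) Aset"
    have "emeasure l ?G = (\<integral>\<^sup>+z. indicator ?G z \<partial>l)"
      using l(2) by (subst nn_integral_indicator) auto
    also have "\<dots> = (\<integral>\<^sup>+z. 0 \<partial>l)"
      using K by (intro nn_integral_cong_AE) (auto simp: space_pair_measure split: split_indicator)
    finally have "(\<integral>\<^sup>+x. emeasure (\<phi> x) {a \<in> space MA. (x, a) \<in> ?G} \<partial>m) = 0"
      using emeasure_ksemi[of m MX \<phi> MA ?G] by (simp add: l_eq[symmetric] space_MX_ne \<phi>)
    moreover have "(\<lambda>x. emeasure (\<phi> x) {a \<in> space MA. (x, a) \<in> ?G}) \<in> borel_measurable m"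
      using emeasure_measurable_subprob_algebra2[of MX "\<lambda>x. {a \<in> space MA. (x, a) \<in> ?G}" MA \<phi>]
        measurable_prob_algebraD[OF \<phi>]
    proof -
      have "Sigma (space MX) (\<lambda>x. {a \<in> space MA. (x, a) \<in> ?G}) = ?G"
        by (auto simp: space_pair_measure)
      then show ?thesis
        using emeasure_measurable_subprob_algebra2[of MX "\<lambda>x. {a \<in> space MA. (x, a) \<in> ?G}" MA \<phi>]
          measurable_prob_algebraD[OF \<phi>] by (simp cong: measurable_cong_sets)
    qed
    ultimately have "AE x in m. emeasure (\<phi> x) {a \<in> space MA. (x, a) \<in> ?G} = 0"
      by (subst (asm) nn_integral_0_iff_AE) auto
    with AE_space show ?thesis
    proof eventually_elim
      case (elim x)
      then have x: "x \<in> space MX" by simp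
      interpret prob_space "\<phi> x" by (rule \<phi>_prob[OF x])
      have "{a \<in> space MA. (x, a) \<in> ?G} = space (\<phi> x) - Aset x"
        using x sets_eq_imp_space_eq[OF \<phi>_prob(2)[OF x]] by (auto simp: space_pair_measure)
      then have "prob (space (\<phi> x) - Aset x) = 0" using elim by (simp add: measure_def)
      then have "prob (Aset x) = 1"
        using prob_compl[of "Aset x"] Aset[OF x] \<phi>_prob(2)[OF x] by simp
      then show ?case by (simp add: \<psi>_def)
    qed
  qed
  ultimately have "\<psi> \<in> kernels" "l = ksemi MXA m \<psi>"
    using ksemi_cong_AE[OF m(1) \<phi> \<psi>] l_eq by metis+
  then show thesis unfolding m_def by (rule that)
qed

lemma measurable_hist[measurable]: "hist n \<in> paths \<rightarrow>\<^sub>M hists n"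
  unfolding hist_def hist_space_def path_space_def by measurable

lemma measurable_path_component[measurable]: "(\<lambda>\<omega>. \<omega> n) \<in> paths \<rightarrow>\<^sub>M MXA"
  unfolding path_space_def by measurable

lemma measurable_snd_hist[measurable]: "snd \<in> hists n \<rightarrow>\<^sub>M MX"
  unfolding hist_space_def by measurable

lemma fst_path: "\<omega> \<in> space paths \<Longrightarrow> fst (\<omega> n) \<in> space MX" "\<omega> \<in> space paths \<Longrightarrow> snd (\<omega> n) \<in> space MA"
  using measurable_space[OF measurable_path_component, of \<omega> n] by (auto simp: space_pair_measure mem_Times_iff)

subsection \<open>Existence of strategic measures\<close>

lemma policyD:
  assumes "is_policy MX MA Aset \<pi>"
  shows "\<pi> n \<in> hists n \<rightarrow>\<^sub>M prob_algebra MA"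
    "h \<in> space (hists n) \<Longrightarrow> emeasure (\<pi> n h) (Aset (snd h)) = 1"
  using assms by (auto simp: is_policy_def)

text \<open>Ionescu-Tulcea for pairs: the step kernel \<open>K i\<close> draws the state from
  \<open>\<eta>\<close> or from \<open>Q\<close> at the preceding pair, then the action from
  \<open>\<pi> i\<close> given the history extended by that state.\<close>

lemma strategic_measure_exists:
  assumes "is_policy MX MA Aset \<pi>"
  shows "\<exists>P. strategic \<pi> P"
proof -
  note \<pi>[measurable] = policyD(1)[OF assms]
  define base where "base i \<omega> = (if i = 0 then \<eta> else Q (\<omega> (i - 1)))" for i and \<omega> :: "nat \<Rightarrow> 'x \<times> 'a"
  define K where "K i \<omega> = base i \<omega> \<bind> (\<lambda>x. distr (\<pi> i (\<omega>, x)) MXA (Pair x))" for i and \<omega> :: "nat \<Rightarrow> 'x \<times> 'a"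
  let ?H = "\<lambda>i. PiM {0..<i} (\<lambda>_. MXA)"
  have base[measurable]: "base i \<in> ?H i \<rightarrow>\<^sub>M prob_algebra MX" for i
  proof (cases i)
    case 0
    have "\<eta> \<in> space (prob_algebra MX)" using prob_\<eta> by (simp add: space_prob_algebra)
    moreover have "base 0 = (\<lambda>_. \<eta>)" by (simp add: base_def fun_eq_iff)
    ultimately show ?thesis by (simp add: 0)
  next
    case (Suc j)
    have "(\<lambda>\<omega>. \<omega> j) \<in> ?H i \<rightarrow>\<^sub>M MXA" by (rule measurable_component_singleton) (simp add: Suc)
    moreover have "base i = (\<lambda>\<omega>. Q (\<omega> j))" by (simp add: base_def fun_eq_iff Suc)
    ultimately show ?thesis using measurable_compose[OF _ Q] by metis
  qed
  have hist_H: "hists i = ?H i \<Otimes>\<^sub>M MX" for i by (simp add: hist_space_def atLeast0LessThan)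
  have [measurable]: "(\<lambda>(\<omega>, x). distr (\<pi> i (\<omega>, x)) MXA (Pair x)) \<in> ?H i \<Otimes>\<^sub>M MX \<rightarrow>\<^sub>M prob_algebra MXA" for i
  proof -
    have "(\<lambda>z. distr (\<pi> i z) MXA (Pair (snd z))) \<in> hists i \<rightarrow>\<^sub>M prob_algebra MXA" by measurable
    then show ?thesis by (simp add: hist_H case_prod_beta')
  qed
  have K[measurable]: "K i \<in> ?H i \<rightarrow>\<^sub>M prob_algebra MXA" for i
    unfolding K_def by measurable
  interpret IT: Ionescu_Tulcea K "\<lambda>_. MXA"
  proof (rule Ionescu_Tulcea.intro)
    show "K i \<in> ?H i \<rightarrow>\<^sub>M subprob_algebra MXA" for i by (rule measurable_prob_algebraD) (rule K)
    show "prob_space (K i x)" if "x \<in> space (?H i)" for i x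
      using measurable_space[OF K that] by (simp add: space_prob_algebra)
  qed
  define P where "P = IT.PF.lim"
  have sets_P[measurable_cong, simp]: "sets P = sets paths" by (simp add: P_def path_space_def)
  have space_P[simp]: "space P = space paths" by (simp add: P_def path_space_def)
  \<comment> \<open>Finite-dimensional laws of the projective limit: the prefix
    \<open>{0..<n}\<close> is filled after exactly \<open>n\<close> steps.\<close>
  have distr_P: "distr P (?H n) (\<lambda>\<omega>. restrict \<omega> {0..<n}) = IT.C 0 n (\<lambda>_. undefined)" for n
  proof -
    have s: "sets (IT.C 0 n (\<lambda>_. undefined)) = sets (?H n)" using IT.sets_C[of "\<lambda>_. undefined" 0 n] by (simp add: space_PiM)
    have u: "IT.up_to {0..<n} = n"
      using IT.up_to_iff[of "{0..<n}"] by (metis antisym atLeastLessThan_iff finite_atLeastLessThan le_refl less_irrefl linorder_not_less zero_le)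
    have "distr (IT.C 0 n (\<lambda>_. undefined)) (?H n) (\<lambda>f. restrict f {0..<n}) = distr (IT.C 0 n (\<lambda>_. undefined)) (?H n) (\<lambda>f. f)"
      using sets_eq_imp_space_eq[OF s] by (intro distr_cong) (auto simp: space_PiM PiE_iff extensional_restrict)
    also have "\<dots> = IT.C 0 n (\<lambda>_. undefined)" using s by (simp add: distr_id2)
    finally show ?thesis unfolding P_def by (subst IT.distr_lim) (simp_all add: IT.CI_def u)
  qed
  have "emeasure P (space P) = 1"
  proof -
    have "distr P (?H 0) (\<lambda>\<omega>. restrict \<omega> {0..<0}) = IT.C 0 0 (\<lambda>_. undefined)" by (rule distr_P)
    moreover have "prob_space (IT.C 0 0 (\<lambda>_. undefined))" by (rule IT.prob_space_C) (simp add: space_PiM)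
    ultimately have "prob_space (distr P (?H 0) (\<lambda>\<omega>. restrict \<omega> {0..<0}))" by simp
    moreover have "(\<lambda>\<omega>. restrict \<omega> {0..<0}) \<in> P \<rightarrow>\<^sub>M ?H 0"
      by (simp add: measurable_cong_sets[OF sets_P refl] path_space_def) measurable
    ultimately show ?thesis by (metis prob_space_distrD prob_space.emeasure_space_1)
  qed
  then interpret P: prob_space P by (rule prob_spaceI)
  have restrict_meas[measurable]: "(\<lambda>\<omega>. restrict \<omega> {0..<n}) \<in> paths \<rightarrow>\<^sub>M ?H n" for n
    unfolding path_space_def by measurable
  \<comment> \<open>Integrates out the last pair only; the defining identities of a strategic
    measure all follow from this recursion.\<close>
  have step: "(\<integral>\<^sup>+\<omega>. f (restrict \<omega> {0..<Suc n}) \<partial>P)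
      = (\<integral>\<^sup>+\<omega>. \<integral>\<^sup>+x. \<integral>\<^sup>+a. f ((restrict \<omega> {0..<n})(n := (x, a))) \<partial>\<pi> n (restrict \<omega> {0..<n}, x) \<partial>base n (restrict \<omega> {0..<n}) \<partial>P)"
    if f[measurable]: "f \<in> borel_measurable (?H (Suc n))" for f n
  proof -
    have sC: "space (IT.C 0 n (\<lambda>_. undefined)) = space (?H n)"
      using IT.space_C[of "\<lambda>_. undefined" 0 n] by (simp add: space_PiM)
    have upd[measurable]: "(\<lambda>(\<omega>, z). fun_upd \<omega> n z) \<in> ?H n \<Otimes>\<^sub>M MXA \<rightarrow>\<^sub>M ?H (Suc n)"
      by (simp add: split_beta') (intro measurable_fun_upd[where J="{0..<n}"], auto)
    have "(\<integral>\<^sup>+\<omega>. f (restrict \<omega> {0..<Suc n}) \<partial>P) = (\<integral>\<^sup>+\<omega>. f \<omega> \<partial>IT.C 0 (Suc n) (\<lambda>_. undefined))"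
      unfolding distr_P[symmetric] by (subst nn_integral_distr) auto
    also have "\<dots> = (\<integral>\<^sup>+\<omega>. \<integral>\<^sup>+\<omega>'. f \<omega>' \<partial>IT.eP n \<omega> \<partial>IT.C 0 n (\<lambda>_. undefined))"
    proof -
      have "IT.eP n \<in> IT.C 0 n (\<lambda>_. undefined) \<rightarrow>\<^sub>M subprob_algebra (?H (Suc n))"
        using IT.measurable_eP[of n] IT.sets_C[of "\<lambda>_. undefined" 0 n]
        by (simp add: space_PiM cong: measurable_cong_sets)
      then show ?thesis using nn_integral_bind[OF f, of "IT.eP n"] by simp
    qed
    also have "\<dots> = (\<integral>\<^sup>+\<omega>. \<integral>\<^sup>+z. f (fun_upd \<omega> n z) \<partial>K n \<omega> \<partial>IT.C 0 n (\<lambda>_. undefined))"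
      by (intro nn_integral_cong IT.nn_integral_eP f) (simp_all only: sC)
    also have "\<dots> = (\<integral>\<^sup>+\<omega>. \<integral>\<^sup>+x. \<integral>\<^sup>+a. f (fun_upd \<omega> n (x, a)) \<partial>\<pi> n (\<omega>, x) \<partial>base n \<omega> \<partial>IT.C 0 n (\<lambda>_. undefined))"
    proof (intro nn_integral_cong)
      fix \<omega> assume "\<omega> \<in> space (IT.C 0 n (\<lambda>_. undefined))"
      then have \<omega>: "\<omega> \<in> space (?H n)" by (simp only: sC)
      have b: "sets (base n \<omega>) = sets MX" using measurable_space[OF base \<omega>] by (simp add: space_prob_algebra)
      have g[measurable]: "(\<lambda>z. f (fun_upd \<omega> n z)) \<in> borel_measurable MXA"
        using \<omega> by measurable
      have k: "(\<lambda>x. \<pi> n (\<omega>, x)) \<in> MX \<rightarrow>\<^sub>M prob_algebra MA"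
        using measurable_compose[OF _ \<pi>[of n], of "Pair \<omega>" MX] \<omega> by (simp add: hist_H)
      show "(\<integral>\<^sup>+z. f (fun_upd \<omega> n z) \<partial>K n \<omega>) = (\<integral>\<^sup>+x. \<integral>\<^sup>+a. f (fun_upd \<omega> n (x, a)) \<partial>\<pi> n (\<omega>, x) \<partial>base n \<omega>)"
        using nn_integral_ksemi[OF b k g] by (simp add: K_def ksemi_def)
    qed
    also have "\<dots> = (\<integral>\<^sup>+\<omega>. \<integral>\<^sup>+x. \<integral>\<^sup>+a. f ((restrict \<omega> {0..<n})(n := (x, a))) \<partial>\<pi> n (restrict \<omega> {0..<n}, x) \<partial>base n (restrict \<omega> {0..<n}) \<partial>P)"
    proof -
      have [measurable]: "(\<lambda>z. f ((fst (fst z))(n := (snd (fst z), snd z)))) \<in> borel_measurable ((?H n \<Otimes>\<^sub>M MX) \<Otimes>\<^sub>M MA)"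
      proof -
        have "(\<lambda>z. ((fst (fst z)), (snd (fst z), snd z))) \<in> (?H n \<Otimes>\<^sub>M MX) \<Otimes>\<^sub>M MA \<rightarrow>\<^sub>M ?H n \<Otimes>\<^sub>M MXA" by measurable
        from measurable_compose[OF this measurable_compose[OF upd f]] show ?thesis by simp
      qed
      have [measurable]: "(\<lambda>z. \<integral>\<^sup>+a. f ((fst z)(n := (snd z, a))) \<partial>\<pi> n z) \<in> borel_measurable (?H n \<Otimes>\<^sub>M MX)"
        using \<pi>[of n]
        by (intro nn_integral_measurable_subprob_algebra2[where N=MA] measurable_prob_algebraD)
          (auto simp: hist_H split_beta')
      have "(\<lambda>\<omega>. \<integral>\<^sup>+x. \<integral>\<^sup>+a. f (fun_upd \<omega> n (x, a)) \<partial>\<pi> n (\<omega>, x) \<partial>base n \<omega>) \<in> borel_measurable (?H n)"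
        using base[of n]
        by (intro nn_integral_measurable_subprob_algebra2[where N=MX] measurable_prob_algebraD)
          (auto simp: split_beta')
      then show ?thesis
        unfolding distr_P[symmetric] by (subst nn_integral_distr) auto
    qed
    finally show ?thesis .
  qed
  have hist_eq: "hist n \<omega> = (restrict \<omega> {0..<n}, fst (\<omega> n))" for n and \<omega> :: "nat \<Rightarrow> 'x \<times> 'a"
    by (simp add: hist_def atLeast0LessThan)
  have restr[simp]: "restrict ((restrict \<omega> {0..<n})(n := z)) {0..<n} = restrict \<omega> {0..<n}"
    "restrict (restrict \<omega> {0..<Suc n}) {0..<n} = restrict \<omega> {0..<n}" for n z and \<omega> :: "nat \<Rightarrow> 'x \<times> 'a"
    by (auto simp: fun_eq_iff)
  have restrict_H[measurable]: "(\<lambda>\<omega>. restrict \<omega> {0..<n}) \<in> ?H (Suc n) \<rightarrow>\<^sub>M ?H n" for n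
    by (intro measurable_restrict measurable_component_singleton) auto
  have comp_H[measurable]: "(\<lambda>\<omega>. \<omega> n) \<in> ?H (Suc n) \<rightarrow>\<^sub>M MXA" for n
    by (intro measurable_component_singleton) auto
  have space_base: "x \<in> space (base n (restrict \<omega> {0..<n})) \<Longrightarrow> (restrict \<omega> {0..<n}, x) \<in> space (hists n)"
    if "\<omega> \<in> space P" for n x \<omega>
  proof -
    have r: "restrict \<omega> {0..<n} \<in> space (?H n)" using measurable_space[OF restrict_meas] that by simp
    then have "sets (base n (restrict \<omega> {0..<n})) = sets MX"
      using measurable_space[OF base] by (simp add: space_prob_algebra)
    then show "x \<in> space (base n (restrict \<omega> {0..<n})) \<Longrightarrow> (restrict \<omega> {0..<n}, x) \<in> space (hists n)"
      using r sets_eq_imp_space_eq by (auto simp: hist_H space_pair_measure)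
  qed
  have \<pi>_const: "(\<integral>\<^sup>+a. c \<partial>\<pi> n h) = c" if "h \<in> space (hists n)" for n h c
    using measurable_space[OF \<pi>[of n] that] by (simp add: space_prob_algebra prob_space.emeasure_space_1)
  have action: "(\<integral>\<^sup>+\<omega>. f (hist n \<omega>, snd (\<omega> n)) \<partial>P) = (\<integral>\<^sup>+\<omega>. \<integral>\<^sup>+a. f (hist n \<omega>, a) \<partial>\<pi> n (hist n \<omega>) \<partial>P)"
    if f[measurable]: "f \<in> borel_measurable (hists n \<Otimes>\<^sub>M MA)" for f n
  proof -
    have hist_meas[measurable]: "(\<lambda>\<omega>. (restrict \<omega> {0..<n}, fst (\<omega> n))) \<in> ?H (Suc n) \<rightarrow>\<^sub>M hists n"
      unfolding hist_H by measurable
    have "(\<lambda>h. \<integral>\<^sup>+a. f (h, a) \<partial>\<pi> n h) \<in> borel_measurable (hists n)"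
      using \<pi>[of n] f
      by (intro nn_integral_measurable_subprob_algebra2[where N=MA] measurable_prob_algebraD)
        (auto simp: split_beta')
    note inner[measurable] = measurable_compose[OF hist_meas this]
    have "(\<integral>\<^sup>+\<omega>. f (hist n \<omega>, snd (\<omega> n)) \<partial>P) = (\<integral>\<^sup>+\<omega>. \<integral>\<^sup>+x. \<integral>\<^sup>+a. f ((restrict \<omega> {0..<n}, x), a)
        \<partial>\<pi> n (restrict \<omega> {0..<n}, x) \<partial>base n (restrict \<omega> {0..<n}) \<partial>P)"
      using step[of "\<lambda>\<omega>. f ((restrict \<omega> {0..<n}, fst (\<omega> n)), snd (\<omega> n))" n] by (simp add: hist_eq)
    \<comment> \<open>A dummy integral over the action is inserted, so that the recursion can be
      read backwards to return to an integral over paths.\<close>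
    also have "\<dots> = (\<integral>\<^sup>+\<omega>. \<integral>\<^sup>+x. \<integral>\<^sup>+a'. \<integral>\<^sup>+a. f ((restrict \<omega> {0..<n}, x), a) \<partial>\<pi> n (restrict \<omega> {0..<n}, x)
        \<partial>\<pi> n (restrict \<omega> {0..<n}, x) \<partial>base n (restrict \<omega> {0..<n}) \<partial>P)"
      by (intro nn_integral_cong \<pi>_const[symmetric] space_base)
    also have "\<dots> = (\<integral>\<^sup>+\<omega>. \<integral>\<^sup>+a. f (hist n \<omega>, a) \<partial>\<pi> n (hist n \<omega>) \<partial>P)"
      using step[OF inner] by (simp add: hist_eq)
    finally show ?thesis .
  qed
  have state: "(\<integral>\<^sup>+\<omega>. f (restrict \<omega> {0..<Suc n}, fst (\<omega> (Suc n))) \<partial>P)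
      = (\<integral>\<^sup>+\<omega>. \<integral>\<^sup>+x. f (restrict \<omega> {0..<Suc n}, x) \<partial>Q (\<omega> n) \<partial>P)"
    if f[measurable]: "f \<in> borel_measurable (?H (Suc n) \<Otimes>\<^sub>M MX)" for f n
  proof -
    have "(\<integral>\<^sup>+\<omega>. f (restrict \<omega> {0..<Suc n}, fst (\<omega> (Suc n))) \<partial>P)
        = (\<integral>\<^sup>+\<omega>. \<integral>\<^sup>+x. \<integral>\<^sup>+a. f (restrict \<omega> {0..<Suc n}, x)
            \<partial>\<pi> (Suc n) (restrict \<omega> {0..<Suc n}, x) \<partial>base (Suc n) (restrict \<omega> {0..<Suc n}) \<partial>P)"
      using step[of "\<lambda>\<omega>. f (restrict \<omega> {0..<Suc n}, fst (\<omega> (Suc n)))" "Suc n"] by (simp del: nn_integral_const)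
    also have "\<dots> = (\<integral>\<^sup>+\<omega>. \<integral>\<^sup>+x. f (restrict \<omega> {0..<Suc n}, x) \<partial>base (Suc n) (restrict \<omega> {0..<Suc n}) \<partial>P)"
      by (intro nn_integral_cong \<pi>_const space_base)
    also have "\<dots> = (\<integral>\<^sup>+\<omega>. \<integral>\<^sup>+x. f (restrict \<omega> {0..<Suc n}, x) \<partial>Q (\<omega> n) \<partial>P)"
      by (simp add: base_def)
    finally show ?thesis .
  qed
  have "strategic \<pi> P"
    unfolding is_strategic_measure_def
  proof (intro conjI allI impI)
    show "prob_space P" by (rule P.prob_space_axioms)
    show "distr P MX (\<lambda>\<omega>. fst (\<omega> 0)) = \<eta>"
    proof (rule measure_eqI)
      fix D assume "D \<in> sets (distr P MX (\<lambda>\<omega>. fst (\<omega> 0)))"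
      then have [measurable]: "D \<in> sets MX" by simp
      have "emeasure (distr P MX (\<lambda>\<omega>. fst (\<omega> 0))) D = (\<integral>\<^sup>+\<omega>. indicator D (fst (\<omega> 0)) \<partial>P)"
        by (subst nn_integral_indicator[symmetric], simp, subst nn_integral_distr) auto
      also have "\<dots> = (\<integral>\<^sup>+\<omega>. \<integral>\<^sup>+x. \<integral>\<^sup>+a. indicator D x \<partial>\<pi> 0 (restrict \<omega> {0..<0}, x) \<partial>base 0 (restrict \<omega> {0..<0}) \<partial>P)"
        using step[of "\<lambda>\<omega>. indicator D (fst (\<omega> 0))" 0] by simp
      also have "\<dots> = (\<integral>\<^sup>+\<omega>. \<integral>\<^sup>+x. indicator D x \<partial>base 0 (restrict \<omega> {0..<0}) \<partial>P)"
        by (intro nn_integral_cong \<pi>_const space_base)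
      also have "\<dots> = emeasure \<eta> D" by (simp add: base_def P.emeasure_space_1[unfolded space_P])
      finally show "emeasure (distr P MX (\<lambda>\<omega>. fst (\<omega> 0))) D = emeasure \<eta> D" .
    qed simp
  next
    fix n B C assume [measurable]: "B \<in> sets (hists n)" "C \<in> sets MA"
    have "emeasure P {\<omega> \<in> space P. hist n \<omega> \<in> B \<and> snd (\<omega> n) \<in> C} = (\<integral>\<^sup>+\<omega>. indicator (B \<times> C) (hist n \<omega>, snd (\<omega> n)) \<partial>P)"
    proof -
      have "{\<omega> \<in> space P. hist n \<omega> \<in> B \<and> snd (\<omega> n) \<in> C} \<in> sets P" by measurable
      then have "emeasure P {\<omega> \<in> space P. hist n \<omega> \<in> B \<and> snd (\<omega> n) \<in> C} =
          (\<integral>\<^sup>+\<omega>. indicator {\<omega> \<in> space P. hist n \<omega> \<in> B \<and> snd (\<omega> n) \<in> C} \<omega> \<partial>P)" by simp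
      also have "\<dots> = (\<integral>\<^sup>+\<omega>. indicator (B \<times> C) (hist n \<omega>, snd (\<omega> n)) \<partial>P)"
        by (intro nn_integral_cong) (auto split: split_indicator)
      finally show ?thesis .
    qed
    also have "\<dots> = (\<integral>\<^sup>+\<omega>. \<integral>\<^sup>+a. indicator (B \<times> C) (hist n \<omega>, a) \<partial>\<pi> n (hist n \<omega>) \<partial>P)"
      by (rule action) measurable
    also have "\<dots> = (\<integral>\<^sup>+\<omega>. ennreal (indicator B (hist n \<omega>) * measure (\<pi> n (hist n \<omega>)) C) \<partial>P)"
    proof (intro nn_integral_cong)
      fix \<omega> assume "\<omega> \<in> space P"
      then have h: "hist n \<omega> \<in> space (hists n)" using measurable_space[OF measurable_hist] by simp
      then have s: "sets (\<pi> n (hist n \<omega>)) = sets MA" and "prob_space (\<pi> n (hist n \<omega>))"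
        using measurable_space[OF \<pi>[of n] h] by (auto simp: space_prob_algebra)
      interpret prob_space "\<pi> n (hist n \<omega>)" by fact
      show "(\<integral>\<^sup>+a. indicator (B \<times> C) (hist n \<omega>, a) \<partial>\<pi> n (hist n \<omega>)) = ennreal (indicator B (hist n \<omega>) * prob C)"
        using s by (simp add: indicator_times nn_integral_cmult ennreal_mult'' emeasure_eq_measure[symmetric] split: split_indicator)
    qed
    moreover have [measurable]: "(\<lambda>\<omega>. measure (\<pi> n (hist n \<omega>)) C) \<in> borel_measurable paths"
      using measurable_compose[OF measurable_compose[OF measurable_hist \<pi>] measurable_measure_prob_algebra[OF \<open>C \<in> sets MA\<close>]] .
    have "(\<integral>\<omega>. indicator B (hist n \<omega>) * measure (\<pi> n (hist n \<omega>)) C \<partial>P) =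
        enn2real (\<integral>\<^sup>+\<omega>. ennreal (indicator B (hist n \<omega>) * measure (\<pi> n (hist n \<omega>)) C) \<partial>P)"
      by (rule integral_eq_nn_integral) auto
    ultimately show "measure P {\<omega> \<in> space P. hist n \<omega> \<in> B \<and> snd (\<omega> n) \<in> C} =
        (\<integral>\<omega>. indicator B (hist n \<omega>) * measure (\<pi> n (hist n \<omega>)) C \<partial>P)"
      by (simp only: measure_def[of P])
  next
    fix n B C D assume [measurable]: "B \<in> sets (hists n)" "C \<in> sets MA" "D \<in> sets MX"
    define f where "f z = (indicator B (restrict (fst z) {0..<n}, fst (fst z n)) * indicator C (snd (fst z n)) * indicator D (snd z) :: ennreal)"
      for z :: "(nat \<Rightarrow> 'x \<times> 'a) \<times> 'x"
    have hist_meas[measurable]: "(\<lambda>\<omega>. (restrict \<omega> {0..<n}, fst (\<omega> n))) \<in> ?H (Suc n) \<rightarrow>\<^sub>M hists n"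
      unfolding hist_H by measurable
    have [measurable]: "f \<in> borel_measurable (?H (Suc n) \<Otimes>\<^sub>M MX)"
      unfolding f_def by measurable
    have "emeasure P {\<omega> \<in> space P. hist n \<omega> \<in> B \<and> snd (\<omega> n) \<in> C \<and> fst (\<omega> (Suc n)) \<in> D}
        = (\<integral>\<^sup>+\<omega>. f (restrict \<omega> {0..<Suc n}, fst (\<omega> (Suc n))) \<partial>P)"
    proof -
      let ?S = "{\<omega> \<in> space P. hist n \<omega> \<in> B \<and> snd (\<omega> n) \<in> C \<and> fst (\<omega> (Suc n)) \<in> D}"
      have "?S \<in> sets P" by measurable
      then have "emeasure P ?S = (\<integral>\<^sup>+\<omega>. indicator ?S \<omega> \<partial>P)" by simp
      also have "\<dots> = (\<integral>\<^sup>+\<omega>. f (restrict \<omega> {0..<Suc n}, fst (\<omega> (Suc n))) \<partial>P)"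
        by (intro nn_integral_cong) (auto simp: f_def hist_eq split: split_indicator)
      finally show ?thesis .
    qed
    also have "\<dots> = (\<integral>\<^sup>+\<omega>. \<integral>\<^sup>+x. f (restrict \<omega> {0..<Suc n}, x) \<partial>Q (\<omega> n) \<partial>P)"
      by (rule state) measurable
    also have "\<dots> = (\<integral>\<^sup>+\<omega>. ennreal (indicator B (hist n \<omega>) * indicator C (snd (\<omega> n)) * measure (Q (\<omega> n)) D) \<partial>P)"
    proof (intro nn_integral_cong)
      fix \<omega> assume "\<omega> \<in> space P"
      then have z: "\<omega> n \<in> space MXA" using measurable_space[OF measurable_path_component] by simp
      interpret prob_space "Q (\<omega> n)" by (rule Q_D[OF z])
      show "(\<integral>\<^sup>+x. f (restrict \<omega> {0..<Suc n}, x) \<partial>Q (\<omega> n)) =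
          ennreal (indicator B (hist n \<omega>) * indicator C (snd (\<omega> n)) * prob D)"
        using Q_D(2)[OF z]
        by (auto simp: f_def hist_eq nn_integral_cmult emeasure_eq_measure[symmetric] split: split_indicator)
    qed
    moreover have [measurable]: "(\<lambda>\<omega>. measure (Q (\<omega> n)) D) \<in> borel_measurable paths"
      using measurable_compose[OF measurable_compose[OF measurable_path_component Q] measurable_measure_prob_algebra[OF \<open>D \<in> sets MX\<close>]] .
    have "(\<integral>\<omega>. indicator B (hist n \<omega>) * indicator C (snd (\<omega> n)) * measure (Q (\<omega> n)) D \<partial>P) =
        enn2real (\<integral>\<^sup>+\<omega>. ennreal (indicator B (hist n \<omega>) * indicator C (snd (\<omega> n)) * measure (Q (\<omega> n)) D) \<partial>P)"
      by (rule integral_eq_nn_integral) auto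
    ultimately show "measure P {\<omega> \<in> space P. hist n \<omega> \<in> B \<and> snd (\<omega> n) \<in> C \<and> fst (\<omega> (Suc n)) \<in> D} =
        (\<integral>\<omega>. indicator B (hist n \<omega>) * indicator C (snd (\<omega> n)) * measure (Q (\<omega> n)) D \<partial>P)"
      by (simp only: measure_def[of P])
  qed simp
  then show ?thesis by blast
qed

subsection \<open>Markov policies\<close>

text \<open>The law of the state at time \<open>n\<close> under a Markov policy, computed by
  recursion rather than on path space; \<open>mjoint\<close> is the corresponding law of the
  state-action pair.\<close>

primrec mstate :: "(nat \<Rightarrow> 'x \<Rightarrow> 'a measure) \<Rightarrow> nat \<Rightarrow> 'x measure" where
  "mstate \<Phi> 0 = \<eta>"
| "mstate \<Phi> (Suc n) = ksemi MXA (mstate \<Phi> n) (\<Phi> n) \<bind> Q"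

definition mjoint :: "(nat \<Rightarrow> 'x \<Rightarrow> 'a measure) \<Rightarrow> nat \<Rightarrow> ('x \<times> 'a) measure" where
  "mjoint \<Phi> n = ksemi MXA (mstate \<Phi> n) (\<Phi> n)"

definition markov :: "(nat \<Rightarrow> 'x \<Rightarrow> 'a measure) \<Rightarrow> bool" where
  "markov \<Phi> \<longleftrightarrow> (\<forall>n. \<Phi> n \<in> kernels)"

lemma markovD: "markov \<Phi> \<Longrightarrow> \<Phi> n \<in> kernels"
  by (simp add: markov_def)

lemma ksemi_kernel_in_prob_algebra:
  assumes "\<phi> \<in> kernels" and m: "m \<in> space (prob_algebra MX)"
  shows "ksemi MXA m \<phi> \<in> space (prob_algebra MXA)"
proof -
  have "sets m = sets MX" using m by (simp add: space_prob_algebra)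
  then have k: "(\<lambda>x. distr (\<phi> x) MXA (Pair x)) \<in> MX \<rightarrow>\<^sub>M prob_algebra MXA"
    using measurable_ksemi_kernel[of MX MX, OF refl kernelsD(1)[OF assms(1)]] by simp
  then show ?thesis unfolding ksemi_def
    using prob_space_bind'[OF m k] sets_bind'[OF m k] by (simp add: space_prob_algebra)
qed

lemma mstate_in_prob_algebra:
  assumes "markov \<Phi>"
  shows "mstate \<Phi> n \<in> space (prob_algebra MX)"
proof (induction n)
  case 0
  then show ?case by (simp add: space_prob_algebra prob_\<eta>)
next
  case (Suc n)
  note m = ksemi_kernel_in_prob_algebra[OF markovD[OF assms] Suc]
  show ?case using prob_space_bind'[OF m Q] sets_bind'[OF m Q] by (simp add: space_prob_algebra)
qed

lemma sets_mstate: "markov \<Phi> \<Longrightarrow> sets (mstate \<Phi> n) = sets MX"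
  using mstate_in_prob_algebra by (auto simp: space_prob_algebra)

lemma space_mstate: "markov \<Phi> \<Longrightarrow> space (mstate \<Phi> n) = space MX"
  using sets_mstate by (rule sets_eq_imp_space_eq)

lemma sets_mjoint: "markov \<Phi> \<Longrightarrow> sets (mjoint \<Phi> n) = sets MXA"
  and prob_mjoint: "markov \<Phi> \<Longrightarrow> prob_space (mjoint \<Phi> n)"
  using ksemi_kernel_in_prob_algebra[OF markovD mstate_in_prob_algebra]
  by (auto simp: space_prob_algebra mjoint_def)

lemma space_mjoint: "markov \<Phi> \<Longrightarrow> space (mjoint \<Phi> n) = space MXA"
  using sets_mjoint by (rule sets_eq_imp_space_eq)

lemma distr_fst_mjoint: "markov \<Phi> \<Longrightarrow> distr (mjoint \<Phi> n) MX fst = mstate \<Phi> n"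
  unfolding mjoint_def
  by (intro distr_fst_ksemi sets_mstate kernelsD(1) markovD space_MX_ne)

lemma nn_integral_mjoint:
  assumes "markov \<Phi>" "f \<in> borel_measurable MXA"
  shows "(\<integral>\<^sup>+z. f z \<partial>mjoint \<Phi> n) = (\<integral>\<^sup>+x. \<integral>\<^sup>+a. f (x, a) \<partial>\<Phi> n x \<partial>mstate \<Phi> n)"
  unfolding mjoint_def using assms
  by (intro nn_integral_ksemi sets_mstate kernelsD(1) markovD)

lemma nn_integral_mjoint_fst:
  assumes "markov \<Phi>" and [measurable]: "f \<in> borel_measurable MX"
  shows "(\<integral>\<^sup>+z. f (fst z) \<partial>mjoint \<Phi> n) = (\<integral>\<^sup>+x. f x \<partial>mstate \<Phi> n)"
proof -
  have [simp]: "fst \<in> mjoint \<Phi> n \<rightarrow>\<^sub>M MX"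
    using measurable_fst[of MX MA] sets_mjoint[OF assms(1), of n] by (simp cong: measurable_cong_sets)
  show ?thesis unfolding distr_fst_mjoint[OF assms(1), symmetric] by (subst nn_integral_distr) auto
qed

lemma nn_integral_mstate_Suc:
  assumes "markov \<Phi>" "f \<in> borel_measurable MX"
  shows "(\<integral>\<^sup>+x. f x \<partial>mstate \<Phi> (Suc n)) = (\<integral>\<^sup>+z. \<integral>\<^sup>+y. f y \<partial>Q z \<partial>mjoint \<Phi> n)"
proof -
  have "Q \<in> mjoint \<Phi> n \<rightarrow>\<^sub>M subprob_algebra MX"
    using measurable_prob_algebraD[OF Q] sets_mjoint[OF assms(1)] by (simp cong: measurable_cong_sets)
  from nn_integral_bind[OF assms(2) this] show ?thesis by (simp add: mjoint_def)
qed

lemma markov_policy: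
  assumes "markov \<Phi>"
  shows "is_policy MX MA Aset (\<lambda>n h. \<Phi> n (snd h))"
  unfolding is_policy_def
proof (intro allI conjI ballI)
  fix n
  show "(\<lambda>h. \<Phi> n (snd h)) \<in> hists n \<rightarrow>\<^sub>M prob_algebra MA"
    by (rule measurable_compose[OF measurable_snd_hist kernelsD(1)[OF markovD[OF assms]]])
  fix h assume "h \<in> space (hists n)"
  then show "emeasure (\<Phi> n (snd h)) (Aset (snd h)) = 1"
    using measurable_space[OF measurable_snd_hist] by (intro kernelsD(2) markovD assms) auto
qed

subsection \<open>Marginals of strategic measures\<close>

lemma strategicD:
  assumes "strategic \<pi> P"
  shows "prob_space P" "sets P = sets paths" "space P = space paths" "distr P MX (\<lambda>\<omega>. fst (\<omega> 0)) = \<eta>"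
    "\<And>n B C. B \<in> sets (hists n) \<Longrightarrow> C \<in> sets MA \<Longrightarrow>
        measure P {\<omega> \<in> space P. hist n \<omega> \<in> B \<and> snd (\<omega> n) \<in> C}
          = (\<integral>\<omega>. indicator B (hist n \<omega>) * measure (\<pi> n (hist n \<omega>)) C \<partial>P)"
    "\<And>n B C D. B \<in> sets (hists n) \<Longrightarrow> C \<in> sets MA \<Longrightarrow> D \<in> sets MX \<Longrightarrow>
        measure P {\<omega> \<in> space P. hist n \<omega> \<in> B \<and> snd (\<omega> n) \<in> C \<and> fst (\<omega> (Suc n)) \<in> D}
          = (\<integral>\<omega>. indicator B (hist n \<omega>) * indicator C (snd (\<omega> n)) * measure (Q (\<omega> n)) D \<partial>P)"
  using assms unfolding is_strategic_measure_def by (auto dest: sets_eq_imp_space_eq)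

text \<open>The identities on rectangles, stated with real integrals, are assembled into one
  equality of measures; afterwards arbitrary nonnegative measurable functions of history and action
  can be integrated.\<close>

lemma strategic_action:
  assumes \<pi>: "is_policy MX MA Aset \<pi>" and P: "strategic \<pi> P"
  shows "distr P (hists n \<Otimes>\<^sub>M MA) (\<lambda>\<omega>. (hist n \<omega>, snd (\<omega> n)))
    = ksemi (hists n \<Otimes>\<^sub>M MA) (distr P (hists n) (hist n)) (\<pi> n)"
proof (rule ksemi_eqI)
  interpret prob_space P by (rule strategicD[OF P])
  note [measurable_cong] = strategicD(2)[OF P]
  note [simp] = strategicD(3)[OF P]
  note \<pi>m[measurable] = policyD(1)[OF \<pi>]
  show "space (hists n) \<noteq> {}"
    using measurable_space[OF measurable_hist[of n]] not_empty by auto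
  show "finite_measure (distr P (hists n \<Otimes>\<^sub>M MA) (\<lambda>\<omega>. (hist n \<omega>, snd (\<omega> n))))"
    by (rule finite_measure_distr) measurable
  fix B C assume [measurable]: "B \<in> sets (hists n)" "C \<in> sets MA"
  have [measurable]: "(\<lambda>\<omega>. measure (\<pi> n (hist n \<omega>)) C) \<in> borel_measurable paths"
    using measurable_compose[OF measurable_compose[OF measurable_hist \<pi>m] measurable_measure_prob_algebra[OF \<open>C \<in> sets MA\<close>]] .
  have h: "prob_space (\<pi> n (hist n \<omega>))" if "\<omega> \<in> space paths" for \<omega>
    using measurable_space[OF \<pi>m measurable_space[OF measurable_hist that]] by (simp add: space_prob_algebra)
  have eq: "(\<lambda>\<omega>. (hist n \<omega>, snd (\<omega> n))) -` (B \<times> C) \<inter> space P = {\<omega> \<in> space P. hist n \<omega> \<in> B \<and> snd (\<omega> n) \<in> C}"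
    by auto
  have "emeasure (distr P (hists n \<Otimes>\<^sub>M MA) (\<lambda>\<omega>. (hist n \<omega>, snd (\<omega> n)))) (B \<times> C)
      = ennreal (prob {\<omega> \<in> space P. hist n \<omega> \<in> B \<and> snd (\<omega> n) \<in> C})"
    by (subst emeasure_distr) (auto simp: emeasure_eq_measure eq simp del: strategicD(3)[OF P])
  also have "\<dots> = ennreal (\<integral>\<omega>. indicator B (hist n \<omega>) * measure (\<pi> n (hist n \<omega>)) C \<partial>P)"
    by (simp add: strategicD(5)[OF P] del: strategicD(3)[OF P])
  also have "\<dots> = (\<integral>\<^sup>+\<omega>. ennreal (indicator B (hist n \<omega>) * measure (\<pi> n (hist n \<omega>)) C) \<partial>P)"
  proof (rule nn_integral_eq_integral[symmetric])
    show "integrable P (\<lambda>\<omega>. indicator B (hist n \<omega>) * measure (\<pi> n (hist n \<omega>)) C)"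
      by (rule integrable_const_bound[where B=1])
        (auto intro!: AE_I2 mult_le_one prob_space.prob_le_1 h)
  qed auto
  also have "\<dots> = (\<integral>\<^sup>+\<omega>. indicator B (hist n \<omega>) * emeasure (\<pi> n (hist n \<omega>)) C \<partial>P)"
  proof (intro nn_integral_cong)
    fix \<omega> assume "\<omega> \<in> space P"
    then interpret p: prob_space "\<pi> n (hist n \<omega>)" by (intro h) simp
    show "ennreal (indicator B (hist n \<omega>) * p.prob C) = indicator B (hist n \<omega>) * emeasure (\<pi> n (hist n \<omega>)) C"
      by (simp add: p.emeasure_eq_measure split: split_indicator)
  qed
  also have "\<dots> = (\<integral>\<^sup>+h. indicator B h * emeasure (\<pi> n h) C \<partial>distr P (hists n) (hist n))"
    using measurable_emeasure_kernel[OF measurable_prob_algebraD[OF \<pi>m] \<open>C \<in> sets MA\<close>]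
    by (subst nn_integral_distr) auto
  finally show "emeasure (distr P (hists n \<Otimes>\<^sub>M MA) (\<lambda>\<omega>. (hist n \<omega>, snd (\<omega> n)))) (B \<times> C)
      = (\<integral>\<^sup>+h. indicator B h * emeasure (\<pi> n h) C \<partial>distr P (hists n) (hist n))" .
qed (auto simp: policyD(1)[OF \<pi>])

lemma strategic_AE_admissible:
  assumes \<pi>: "is_policy MX MA Aset \<pi>" and P: "strategic \<pi> P"
  shows "AE \<omega> in P. snd (\<omega> n) \<in> Aset (fst (\<omega> n))"
proof -
  interpret prob_space P by (rule strategicD[OF P])
  note [measurable_cong] = strategicD(2)[OF P]
  define G where "G z \<longleftrightarrow> (snd (fst z), snd z) \<in> Sigma (space MX) Aset" for z :: "((nat \<Rightarrow> 'x \<times> 'a) \<times> 'x) \<times> 'a"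
  have [measurable]: "Measurable.pred (hists n \<Otimes>\<^sub>M MA) G" unfolding G_def by measurable
  have ne: "space (hists n) \<noteq> {}"
    using measurable_space[OF measurable_hist[of n]] not_empty strategicD(3)[OF P] by auto
  let ?S = "{z \<in> space (hists n \<Otimes>\<^sub>M MA). \<not> G z}"
  have "emeasure (distr P (hists n \<Otimes>\<^sub>M MA) (\<lambda>\<omega>. (hist n \<omega>, snd (\<omega> n)))) ?S
      = (\<integral>\<^sup>+h. emeasure (\<pi> n h) {a \<in> space MA. (h, a) \<in> ?S} \<partial>distr P (hists n) (hist n))"
    unfolding strategic_action[OF assms] by (intro emeasure_ksemi policyD(1)[OF \<pi>] ne) auto
  also have "\<dots> = (\<integral>\<^sup>+h. 0 \<partial>distr P (hists n) (hist n))"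
  proof (intro nn_integral_cong)
    fix h assume "h \<in> space (distr P (hists n) (hist n))"
    then have h: "h \<in> space (hists n)" by simp
    then have x: "snd h \<in> space MX" using measurable_space[OF measurable_snd_hist] by auto
    have s: "sets (\<pi> n h) = sets MA" and "prob_space (\<pi> n h)"
      using measurable_space[OF policyD(1)[OF \<pi>] h] by (auto simp: space_prob_algebra)
    interpret p: prob_space "\<pi> n h" by fact
    have "{a \<in> space MA. (h, a) \<in> ?S} = space (\<pi> n h) - Aset (snd h)"
      using h x sets_eq_imp_space_eq[OF s] by (auto simp: G_def space_pair_measure)
    moreover have "p.prob (Aset (snd h)) = 1" using policyD(2)[OF \<pi> h] by (simp add: measure_def)
    ultimately show "emeasure (\<pi> n h) {a \<in> space MA. (h, a) \<in> ?S} = 0"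
      using p.prob_compl[of "Aset (snd h)"] Aset[OF x] s by (simp add: p.emeasure_eq_measure)
  qed
  finally have "AE z in distr P (hists n \<Otimes>\<^sub>M MA) (\<lambda>\<omega>. (hist n \<omega>, snd (\<omega> n))). G z"
    by (subst AE_iff_measurable[OF _ refl]) auto
  then have "AE \<omega> in P. G (hist n \<omega>, snd (\<omega> n))"
    by (subst (asm) AE_distr_iff) auto
  then show ?thesis by eventually_elim (auto simp: G_def hist_def)
qed

text \<open>The transition identity is used with the whole history space and the whole action space:
  the next state law depends on the past only through the law of the current pair.\<close>

lemma strategic_state_Suc:
  assumes P: "strategic \<pi> P"
  shows "distr P MX (\<lambda>\<omega>. fst (\<omega> (Suc n))) = distr P MXA (\<lambda>\<omega>. \<omega> n) \<bind> Q"
proof (rule measure_eqI)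
  interpret prob_space P by (rule strategicD[OF P])
  note [measurable_cong] = strategicD(2)[OF P]
  have Q': "Q \<in> distr P MXA (\<lambda>\<omega>. \<omega> n) \<rightarrow>\<^sub>M subprob_algebra MX"
    using measurable_prob_algebraD[OF Q] by simp
  have s: "sets (distr P MXA (\<lambda>\<omega>. \<omega> n) \<bind> Q) = sets MX"
    by (rule sets_bind) (auto simp: Q_D space_MXA_ne)
  then show "sets (distr P MX (\<lambda>\<omega>. fst (\<omega> (Suc n)))) = sets (distr P MXA (\<lambda>\<omega>. \<omega> n) \<bind> Q)" by simp
  fix D assume "D \<in> sets (distr P MX (\<lambda>\<omega>. fst (\<omega> (Suc n))))"
  then have D[measurable]: "D \<in> sets MX" by simp
  have [measurable]: "(\<lambda>\<omega>. measure (Q (\<omega> n)) D) \<in> borel_measurable paths"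
    using measurable_compose[OF measurable_compose[OF measurable_path_component Q] measurable_measure_prob_algebra[OF D]] .
  have z: "\<omega> n \<in> space MXA" if "\<omega> \<in> space P" for \<omega>
    using measurable_space[OF measurable_path_component] that strategicD(3)[OF P] by auto
  have "emeasure (distr P MX (\<lambda>\<omega>. fst (\<omega> (Suc n)))) D
      = ennreal (prob {\<omega> \<in> space P. hist n \<omega> \<in> space (hists n) \<and> snd (\<omega> n) \<in> space MA \<and> fst (\<omega> (Suc n)) \<in> D})"
  proof -
    have "{\<omega> \<in> space P. hist n \<omega> \<in> space (hists n) \<and> snd (\<omega> n) \<in> space MA \<and> fst (\<omega> (Suc n)) \<in> D}
        = (\<lambda>\<omega>. fst (\<omega> (Suc n))) -` D \<inter> space P"
      using measurable_space[OF measurable_hist[of n]] z strategicD(3)[OF P] by (auto simp: space_pair_measure mem_Times_iff)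
    then show ?thesis by (subst emeasure_distr) (auto simp: emeasure_eq_measure)
  qed
  also have "\<dots> = ennreal (\<integral>\<omega>. indicator (space (hists n)) (hist n \<omega>) * indicator (space MA) (snd (\<omega> n)) * measure (Q (\<omega> n)) D \<partial>P)"
    by (subst strategicD(6)[OF P]) auto
  also have "\<dots> = ennreal (\<integral>\<omega>. measure (Q (\<omega> n)) D \<partial>P)"
    using measurable_space[OF measurable_hist[of n]] z strategicD(3)[OF P]
    by (intro arg_cong[where f=ennreal] Bochner_Integration.integral_cong) (auto simp: space_pair_measure mem_Times_iff)
  also have "\<dots> = (\<integral>\<^sup>+\<omega>. ennreal (measure (Q (\<omega> n)) D) \<partial>P)"
  proof (rule nn_integral_eq_integral[symmetric])
    show "integrable P (\<lambda>\<omega>. measure (Q (\<omega> n)) D)"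
      by (rule integrable_const_bound[where B=1]) (auto intro!: AE_I2 prob_space.prob_le_1 Q_D z)
  qed auto
  also have "\<dots> = (\<integral>\<^sup>+\<omega>. emeasure (Q (\<omega> n)) D \<partial>P)"
  proof (intro nn_integral_cong)
    fix \<omega> assume "\<omega> \<in> space P"
    then interpret q: prob_space "Q (\<omega> n)" by (intro Q_D z)
    show "ennreal (q.prob D) = emeasure (Q (\<omega> n)) D" by (simp add: q.emeasure_eq_measure)
  qed
  also have "\<dots> = (\<integral>\<^sup>+z. emeasure (Q z) D \<partial>distr P MXA (\<lambda>\<omega>. \<omega> n))"
    using measurable_emeasure_kernel[OF measurable_prob_algebraD[OF Q] D] by (subst nn_integral_distr) auto
  also have "\<dots> = emeasure (distr P MXA (\<lambda>\<omega>. \<omega> n) \<bind> Q) D"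
    by (rule emeasure_bind[symmetric, OF _ Q' D]) (simp add: space_MXA_ne)
  finally show "emeasure (distr P MX (\<lambda>\<omega>. fst (\<omega> (Suc n)))) D = emeasure (distr P MXA (\<lambda>\<omega>. \<omega> n) \<bind> Q) D" .
qed

lemma distr_path_fst:
  assumes "strategic \<pi> P"
  shows "distr (distr P MXA (\<lambda>\<omega>. \<omega> n)) MX fst = distr P MX (\<lambda>\<omega>. fst (\<omega> n))"
proof -
  note [measurable_cong] = strategicD(2)[OF assms]
  show ?thesis by (subst distr_distr) (auto simp: comp_def)
qed

lemma strategic_eq_mjoint:
  assumes P: "strategic \<pi> P" and \<Phi>: "markov \<Phi>"
    and joint: "\<And>n. distr P MXA (\<lambda>\<omega>. \<omega> n) = ksemi MXA (distr P MX (\<lambda>\<omega>. fst (\<omega> n))) (\<Phi> n)"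
  shows "distr P MXA (\<lambda>\<omega>. \<omega> n) = mjoint \<Phi> n"
proof -
  have "distr P MX (\<lambda>\<omega>. fst (\<omega> n)) = mstate \<Phi> n"
  proof (induction n)
    case (Suc n)
    then show ?case by (simp add: strategic_state_Suc[OF P] joint)
  qed (simp add: strategicD[OF P])
  then show ?thesis by (simp add: joint mjoint_def)
qed

text \<open>The kernel at time \<open>n\<close> is the conditional law of the action given the
  current state alone. The resulting Markov policy reproduces all one-time marginals, though not
  necessarily the law of the path.\<close>

lemma strategic_ex_markov:
  assumes \<pi>: "is_policy MX MA Aset \<pi>" and P: "strategic \<pi> P"
  shows "\<exists>\<Phi>. markov \<Phi> \<and> (\<forall>n. distr P MXA (\<lambda>\<omega>. \<omega> n) = mjoint \<Phi> n)"
proof -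
  interpret prob_space P by (rule strategicD[OF P])
  note [measurable_cong] = strategicD(2)[OF P]
  have "\<exists>\<phi>. \<phi> \<in> kernels \<and> distr P MXA (\<lambda>\<omega>. \<omega> n) = ksemi MXA (distr P MX (\<lambda>\<omega>. fst (\<omega> n))) \<phi>" for n
  proof -
    have "AE \<omega> in P. (fst (\<omega> n), snd (\<omega> n)) \<in> Sigma (space MX) Aset"
      using strategic_AE_admissible[OF assms, of n] AE_space
      by eventually_elim (metis SigmaI fst_path(1) strategicD(3)[OF P])
    then have "AE z in distr P MXA (\<lambda>\<omega>. \<omega> n). (fst z, snd z) \<in> Sigma (space MX) Aset"
      by (subst AE_distr_iff) auto
    then have "AE z in distr P MXA (\<lambda>\<omega>. \<omega> n). snd z \<in> Aset (fst z)" by eventually_elim auto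
    moreover have "finite_measure (distr P MXA (\<lambda>\<omega>. \<omega> n))" by (rule finite_measure_distr) measurable
    ultimately obtain \<phi> where "\<phi> \<in> kernels" "distr P MXA (\<lambda>\<omega>. \<omega> n) = ksemi MXA (distr (distr P MXA (\<lambda>\<omega>. \<omega> n)) MX fst) \<phi>"
      using kernel_disintegration[of "distr P MXA (\<lambda>\<omega>. \<omega> n)"] by auto
    then show ?thesis by (auto simp: distr_path_fst[OF P])
  qed
  then obtain \<Phi> where "\<And>n. \<Phi> n \<in> kernels"
    "\<And>n. distr P MXA (\<lambda>\<omega>. \<omega> n) = ksemi MXA (distr P MX (\<lambda>\<omega>. fst (\<omega> n))) (\<Phi> n)" by metis
  then show ?thesis using strategic_eq_mjoint[OF P, of \<Phi>] by (auto simp: markov_def)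
qed

text \<open>The history enters the policy only through its last state, so integrating the rest of it
  out of the joint law of history and action leaves the kernel \<open>\<Phi> n\<close>.\<close>

lemma strategic_markov:
  assumes \<Phi>: "markov \<Phi>" and P: "strategic (\<lambda>n h. \<Phi> n (snd h)) P"
  shows "distr P MXA (\<lambda>\<omega>. \<omega> n) = mjoint \<Phi> n"
proof (rule strategic_eq_mjoint[OF P \<Phi>])
  fix n
  interpret prob_space P by (rule strategicD[OF P])
  note [measurable_cong] = strategicD(2)[OF P]
  note \<Phi>n[measurable] = kernelsD(1)[OF markovD[OF \<Phi>, of n]]
  show "distr P MXA (\<lambda>\<omega>. \<omega> n) = ksemi MXA (distr P MX (\<lambda>\<omega>. fst (\<omega> n))) (\<Phi> n)"
  proof (rule ksemi_eqI[OF _ \<Phi>n space_MX_ne])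
    show "finite_measure (distr P MXA (\<lambda>\<omega>. \<omega> n))" by (rule finite_measure_distr) measurable
    fix D C assume D[measurable]: "D \<in> sets MX" and C[measurable]: "C \<in> sets MA"
    have [measurable]: "(\<lambda>x. emeasure (\<Phi> n x) C) \<in> borel_measurable MX"
      by (rule measurable_emeasure_kernel[OF measurable_prob_algebraD[OF \<Phi>n] C])
    have [measurable]: "(\<lambda>h. \<Phi> n (snd h)) \<in> hists n \<rightarrow>\<^sub>M prob_algebra MA" by measurable
    define f where "f z = (indicator D (snd (fst z)) * indicator C (snd z) :: ennreal)"
      for z :: "((nat \<Rightarrow> 'x \<times> 'a) \<times> 'x) \<times> 'a"
    have [measurable]: "f \<in> borel_measurable (hists n \<Otimes>\<^sub>M MA)" unfolding f_def by measurable
    have "emeasure (distr P MXA (\<lambda>\<omega>. \<omega> n)) (D \<times> C) = (\<integral>\<^sup>+z. indicator (D \<times> C) z \<partial>distr P MXA (\<lambda>\<omega>. \<omega> n))"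
      by simp
    also have "\<dots> = (\<integral>\<^sup>+\<omega>. f (hist n \<omega>, snd (\<omega> n)) \<partial>P)"
      by (subst nn_integral_distr) (auto intro!: nn_integral_cong simp: f_def hist_def mem_Times_iff split: split_indicator)
    also have "\<dots> = (\<integral>\<^sup>+z. f z \<partial>distr P (hists n \<Otimes>\<^sub>M MA) (\<lambda>\<omega>. (hist n \<omega>, snd (\<omega> n))))"
      by (subst nn_integral_distr) auto
    also have "\<dots> = (\<integral>\<^sup>+h. \<integral>\<^sup>+a. f (h, a) \<partial>\<Phi> n (snd h) \<partial>distr P (hists n) (hist n))"
      unfolding strategic_action[OF markov_policy[OF \<Phi>] P] by (rule nn_integral_ksemi) auto
    also have "\<dots> = (\<integral>\<^sup>+h. indicator D (snd h) * emeasure (\<Phi> n (snd h)) C \<partial>distr P (hists n) (hist n))"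
    proof (intro nn_integral_cong)
      fix h assume "h \<in> space (distr P (hists n) (hist n))"
      then have "snd h \<in> space MX" using measurable_space[OF measurable_snd_hist] by auto
      then show "(\<integral>\<^sup>+a. f (h, a) \<partial>\<Phi> n (snd h)) = indicator D (snd h) * emeasure (\<Phi> n (snd h)) C"
        using kernelsD(4)[OF markovD[OF \<Phi>, of n]] C by (simp add: f_def nn_integral_cmult_indicator)
    qed
    also have "\<dots> = (\<integral>\<^sup>+\<omega>. indicator D (fst (\<omega> n)) * emeasure (\<Phi> n (fst (\<omega> n))) C \<partial>P)"
      by (subst nn_integral_distr) (auto simp: hist_def)
    also have "\<dots> = (\<integral>\<^sup>+x. indicator D x * emeasure (\<Phi> n x) C \<partial>distr P MX (\<lambda>\<omega>. fst (\<omega> n)))"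
      by (subst nn_integral_distr) auto
    finally show "emeasure (distr P MXA (\<lambda>\<omega>. \<omega> n)) (D \<times> C)
      = (\<integral>\<^sup>+x. indicator D x * emeasure (\<Phi> n x) C \<partial>distr P MX (\<lambda>\<omega>. fst (\<omega> n)))" .
  qed auto
qed

subsection \<open>Occupation measures\<close>

abbreviation "alive \<equiv> (space MX - \<Delta>) \<times> space MA"

text \<open>The laws of (X_n, A_n) restricted to states outside \<Delta> are summed over
  \<open>n\<close>. The sum is encoded as a bind with counting measure, which makes it a measure by
  construction.\<close>

definition occ :: "(nat \<Rightarrow> 'x \<Rightarrow> 'a measure) \<Rightarrow> ('x \<times> 'a) measure" where
  "occ \<Phi> = count_space UNIV \<bind> (\<lambda>n. density (mjoint \<Phi> n) (indicator alive))"

lemma alive_sets[measurable]: "alive \<in> sets MXA"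
  by measurable

lemma occ_kernel:
  assumes "markov \<Phi>"
  shows "(\<lambda>n. density (mjoint \<Phi> n) (indicator alive)) \<in> count_space UNIV \<rightarrow>\<^sub>M subprob_algebra MXA"
proof -
  have "subprob_space (density (mjoint \<Phi> n) (indicator alive))" for n
  proof
    interpret prob_space "mjoint \<Phi> n" by (rule prob_mjoint[OF assms])
    have "emeasure (density (mjoint \<Phi> n) (indicator alive)) (space (mjoint \<Phi> n))
        = (\<integral>\<^sup>+z. indicator alive z * indicator (space (mjoint \<Phi> n)) z \<partial>mjoint \<Phi> n)"
    proof (intro emeasure_density borel_measurable_indicator sets.top)
      show "alive \<in> sets (mjoint \<Phi> n)" using sets_mjoint[OF assms] by simp
    qed
    also have "\<dots> \<le> (\<integral>\<^sup>+z. 1 \<partial>mjoint \<Phi> n)" by (intro nn_integral_mono) (auto split: split_indicator)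
    finally show "emeasure (density (mjoint \<Phi> n) (indicator alive)) (space (density (mjoint \<Phi> n) (indicator alive))) \<le> 1"
      by (simp add: emeasure_space_1)
    show "space (density (mjoint \<Phi> n) (indicator alive)) \<noteq> {}" using not_empty by simp
  qed
  then show ?thesis by (simp add: space_subprob_algebra sets_mjoint[OF assms])
qed

lemma sets_occ: "markov \<Phi> \<Longrightarrow> sets (occ \<Phi>) = sets MXA"
  unfolding occ_def by (rule sets_bind) (auto simp: sets_mjoint)

lemma space_occ: "markov \<Phi> \<Longrightarrow> space (occ \<Phi>) = space MXA"
  using sets_occ by (rule sets_eq_imp_space_eq)

lemma nn_integral_occ:
  assumes \<Phi>: "markov \<Phi>" and f: "f \<in> borel_measurable MXA"
  shows "(\<integral>\<^sup>+z. f z \<partial>occ \<Phi>) = (\<Sum>n. \<integral>\<^sup>+z. f z * indicator alive z \<partial>mjoint \<Phi> n)"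
proof -
  have s: "borel_measurable (mjoint \<Phi> n) = borel_measurable MXA" for n
    by (rule measurable_cong_sets[OF sets_mjoint[OF \<Phi>] refl])
  have "(\<integral>\<^sup>+z. f z \<partial>occ \<Phi>) = (\<Sum>n. \<integral>\<^sup>+z. f z \<partial>density (mjoint \<Phi> n) (indicator alive))"
    unfolding occ_def by (simp add: nn_integral_bind[OF f occ_kernel[OF \<Phi>]] nn_integral_count_space_nat)
  also have "\<dots> = (\<Sum>n. \<integral>\<^sup>+z. f z * indicator alive z \<partial>mjoint \<Phi> n)"
    using f by (intro suminf_cong, subst nn_integral_density) (auto simp: s mult.commute)
  finally show ?thesis .
qed

lemma emeasure_occ:
  assumes \<Phi>: "markov \<Phi>" and \<Gamma>[measurable]: "\<Gamma> \<in> sets MXA"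
  shows "emeasure (occ \<Phi>) \<Gamma> = (\<Sum>n. emeasure (mjoint \<Phi> n) (\<Gamma> \<inter> alive))"
proof -
  have s: "\<Gamma> \<inter> alive \<in> sets (mjoint \<Phi> n)" for n using sets_mjoint[OF \<Phi>] by simp
  have "emeasure (occ \<Phi>) \<Gamma> = (\<integral>\<^sup>+z. indicator \<Gamma> z \<partial>occ \<Phi>)"
    using sets_occ[OF \<Phi>] by (subst nn_integral_indicator) auto
  also have "\<dots> = (\<Sum>n. \<integral>\<^sup>+z. indicator (\<Gamma> \<inter> alive) z \<partial>mjoint \<Phi> n)"
    by (subst nn_integral_occ[OF \<Phi>]) (auto intro!: suminf_cong nn_integral_cong split: split_indicator)
  finally show ?thesis using s by simp
qed

lemma less_hit_time: "enat n < hit_time \<Delta> \<omega> \<longleftrightarrow> (\<forall>k\<le>n. fst (\<omega> k) \<notin> \<Delta>)"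
proof (cases "\<exists>k. fst (\<omega> k) \<in> \<Delta>")
  case True
  have "n < (LEAST k. fst (\<omega> k) \<in> \<Delta>) \<longleftrightarrow> (\<forall>k\<le>n. fst (\<omega> k) \<notin> \<Delta>)"
  proof
    show "\<forall>k\<le>n. fst (\<omega> k) \<notin> \<Delta>" if "n < (LEAST k. fst (\<omega> k) \<in> \<Delta>)"
      using not_less_Least[of _ "\<lambda>k. fst (\<omega> k) \<in> \<Delta>"] that by (meson le_less_trans)
    show "n < (LEAST k. fst (\<omega> k) \<in> \<Delta>)" if "\<forall>k\<le>n. fst (\<omega> k) \<notin> \<Delta>"
      using LeastI_ex[OF True] that by (meson not_le)
  qed
  then show ?thesis using True by (simp add: hit_time_def)
qed (auto simp: hit_time_def)

lemma suminf_less_hit_time_le: "(\<Sum>n. indicator {\<omega>. enat n < hit_time \<Delta> \<omega>} \<omega>) \<le> ennreal_of_enat (hit_time \<Delta> \<omega>)"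
proof (cases "hit_time \<Delta> \<omega>")
  case (enat m)
  have "(\<Sum>n. indicator {\<omega>. enat n < hit_time \<Delta> \<omega>} \<omega>) = (\<Sum>n<m. indicator {\<omega>. enat n < hit_time \<Delta> \<omega>} \<omega> :: ennreal)"
    by (rule suminf_finite) (auto simp: enat)
  also have "\<dots> = (\<Sum>n<m. 1)" by (intro sum.cong) (auto simp: enat)
  finally show ?thesis by (simp add: enat)
qed simp

text \<open>Makes the event that \<Delta> has not been hit by time \<open>n\<close> depend, almost
  surely, on the state at time \<open>n\<close> alone.\<close>

lemma strategic_AE_absorbed:
  assumes P: "strategic \<pi> P"
  shows "AE \<omega> in P. \<forall>n. fst (\<omega> n) \<in> \<Delta> \<longrightarrow> fst (\<omega> (Suc n)) \<in> \<Delta>"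
proof -
  interpret prob_space P by (rule strategicD[OF P])
  note [measurable_cong] = strategicD(2)[OF P]
  have z: "\<omega> n \<in> space MXA" if "\<omega> \<in> space P" for \<omega> n
    using measurable_space[OF measurable_path_component] that strategicD(3)[OF P] by auto
  have "AE \<omega> in P. fst (\<omega> n) \<in> \<Delta> \<longrightarrow> fst (\<omega> (Suc n)) \<in> \<Delta>" for n
  proof -
    let ?B = "{h \<in> space (hists n). snd h \<in> \<Delta>}"
    let ?S = "{\<omega> \<in> space P. hist n \<omega> \<in> ?B \<and> snd (\<omega> n) \<in> space MA \<and> fst (\<omega> (Suc n)) \<in> space MX - \<Delta>}"
    have "prob ?S = (\<integral>\<omega>. indicator ?B (hist n \<omega>) * indicator (space MA) (snd (\<omega> n)) * measure (Q (\<omega> n)) (space MX - \<Delta>) \<partial>P)"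
      by (rule strategicD(6)[OF P]) auto
    also have "\<dots> = (\<integral>\<omega>. 0 \<partial>P)"
    proof (rule Bochner_Integration.integral_cong)
      fix \<omega> assume \<omega>: "\<omega> \<in> space P"
      have "measure (Q (\<omega> n)) (space MX - \<Delta>) = 0" if "fst (\<omega> n) \<in> \<Delta>"
      proof -
        have a: "snd (\<omega> n) \<in> space MA" using z[OF \<omega>, of n] by (auto simp: space_pair_measure mem_Times_iff)
        interpret q: prob_space "Q (\<omega> n)" by (rule Q_D[OF z[OF \<omega>]])
        have "q.prob \<Delta> = 1" using \<Delta>_closed[OF that a] by (simp add: measure_def)
        then show ?thesis using q.prob_compl[of \<Delta>] Q_D[OF z[OF \<omega>, of n]] by simp
      qed
      then show "indicator ?B (hist n \<omega>) * indicator (space MA) (snd (\<omega> n)) * measure (Q (\<omega> n)) (space MX - \<Delta>) = (0::real)"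
        by (auto simp: hist_def split: split_indicator)
    qed simp
    finally have "emeasure P ?S = 0" by (simp add: emeasure_eq_measure)
    moreover have "?S \<in> sets P" by measurable
    ultimately have "AE \<omega> in P. \<omega> \<notin> ?S" by (intro AE_not_in) (auto simp: null_sets_def)
    with AE_space show ?thesis
    proof eventually_elim
      case (elim \<omega>)
      then have "hist n \<omega> \<in> space (hists n)"
        using measurable_space[OF measurable_hist[of n]] strategicD(3)[OF P] by auto
      then show ?case
        using elim z[OF elim(1), of n] z[OF elim(1), of "Suc n"]
        by (auto simp: hist_def space_pair_measure mem_Times_iff)
    qed
  qed
  then show ?thesis by (simp add: AE_all_countable)
qed

text \<open>Almost surely, time \<open>n\<close> precedes the hitting time exactly when the state at
  time \<open>n\<close> is outside \<Delta>, so only one-time marginals matter. The total mass is at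
  most the expected hitting time, whence finiteness.\<close>

lemma occ_measure_eq_occ:
  assumes \<pi>: "is_policy MX MA Aset \<pi>" and P: "strategic \<pi> P" and \<Phi>: "markov \<Phi>"
    and joint: "\<And>n. distr P MXA (\<lambda>\<omega>. \<omega> n) = mjoint \<Phi> n"
  shows "occ_measure MX MA \<Delta> P = occ \<Phi>" "emeasure (occ \<Phi>) (space MXA) < \<infinity>"
proof -
  interpret prob_space P by (rule strategicD[OF P])
  note [measurable_cong] = strategicD(2)[OF P]
  have z: "\<omega> n \<in> space MXA" if "\<omega> \<in> space P" for \<omega> n
    using measurable_space[OF measurable_path_component] that strategicD(3)[OF P] by auto
  have "AE \<omega> in P. \<forall>n. enat n < hit_time \<Delta> \<omega> \<longleftrightarrow> fst (\<omega> n) \<notin> \<Delta>"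
    using strategic_AE_absorbed[OF P]
  proof eventually_elim
    case (elim \<omega>)
    have "fst (\<omega> k) \<in> \<Delta> \<Longrightarrow> k \<le> n \<Longrightarrow> fst (\<omega> n) \<in> \<Delta>" for k n
      by (induction n) (use elim in \<open>auto simp: le_Suc_eq\<close>)
    then show ?case by (auto simp: less_hit_time)
  qed
  then have AE: "AE \<omega> in P. enat n < hit_time \<Delta> \<omega> \<longleftrightarrow> fst (\<omega> n) \<notin> \<Delta>" for n
    by (simp add: AE_all_countable)
  have I: "(\<integral>\<^sup>+\<omega>. (\<Sum>n. indicator {\<omega>. enat n < hit_time \<Delta> \<omega> \<and> \<omega> n \<in> \<Gamma>} \<omega>) \<partial>P) = emeasure (occ \<Phi>) \<Gamma>"
    if \<Gamma>[measurable]: "\<Gamma> \<in> sets MXA" for \<Gamma>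
  proof -
    have "(\<integral>\<^sup>+\<omega>. (\<Sum>n. indicator {\<omega>. enat n < hit_time \<Delta> \<omega> \<and> \<omega> n \<in> \<Gamma>} \<omega>) \<partial>P)
        = (\<Sum>n. \<integral>\<^sup>+\<omega>. indicator {\<omega>. enat n < hit_time \<Delta> \<omega> \<and> \<omega> n \<in> \<Gamma>} \<omega> \<partial>P)"
    proof (rule nn_integral_suminf)
      fix n
      have "Measurable.pred P (\<lambda>\<omega>. (\<forall>k\<in>{..n}. fst (\<omega> k) \<notin> \<Delta>) \<and> \<omega> n \<in> \<Gamma>)" by measurable
      then have "{\<omega> \<in> space P. (\<forall>k\<in>{..n}. fst (\<omega> k) \<notin> \<Delta>) \<and> \<omega> n \<in> \<Gamma>} \<in> sets P" by measurable
      then have "indicator {\<omega> \<in> space P. (\<forall>k\<in>{..n}. fst (\<omega> k) \<notin> \<Delta>) \<and> \<omega> n \<in> \<Gamma>} \<in> borel_measurable P"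
        by (rule borel_measurable_indicator)
      then show "indicator {\<omega>. enat n < hit_time \<Delta> \<omega> \<and> \<omega> n \<in> \<Gamma>} \<in> borel_measurable P"
        by (rule measurable_cong[THEN iffD1, rotated]) (auto simp: less_hit_time split: split_indicator)
    qed
    also have "\<dots> = (\<Sum>n. emeasure (mjoint \<Phi> n) (\<Gamma> \<inter> alive))"
    proof (rule suminf_cong)
      fix n
      have "(\<integral>\<^sup>+\<omega>. indicator {\<omega>. enat n < hit_time \<Delta> \<omega> \<and> \<omega> n \<in> \<Gamma>} \<omega> \<partial>P) = (\<integral>\<^sup>+\<omega>. indicator (\<Gamma> \<inter> alive) (\<omega> n) \<partial>P)"
      proof (rule nn_integral_cong_AE, use AE[of n] AE_space in eventually_elim)
        case (elim \<omega>)
        then show ?case using z[OF elim(2), of n]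
          by (auto simp: space_pair_measure mem_Times_iff split: split_indicator)
      qed
      also have "\<dots> = (\<integral>\<^sup>+z. indicator (\<Gamma> \<inter> alive) z \<partial>mjoint \<Phi> n)"
        unfolding joint[symmetric] by (subst nn_integral_distr) auto
      also have "\<dots> = emeasure (mjoint \<Phi> n) (\<Gamma> \<inter> alive)"
        using sets_mjoint[OF \<Phi>, of n] by (intro nn_integral_indicator) auto
      finally show "(\<integral>\<^sup>+\<omega>. indicator {\<omega>. enat n < hit_time \<Delta> \<omega> \<and> \<omega> n \<in> \<Gamma>} \<omega> \<partial>P) = emeasure (mjoint \<Phi> n) (\<Gamma> \<inter> alive)" .
    qed
    also have "\<dots> = emeasure (occ \<Phi>) \<Gamma>" by (rule emeasure_occ[OF \<Phi> \<Gamma>, symmetric])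
    finally show ?thesis .
  qed
  have "occ_measure MX MA \<Delta> P = measure_of (space MXA) (sets MXA) (emeasure (occ \<Phi>))"
    unfolding occ_measure_def by (rule measure_of_eq) (auto simp: sets.space_closed I sets.sigma_sets_eq)
  also have "\<dots> = occ \<Phi>"
    using measure_of_of_measure[of "occ \<Phi>"] by (simp add: sets_occ[OF \<Phi>] space_occ[OF \<Phi>])
  finally show "occ_measure MX MA \<Delta> P = occ \<Phi>" .
  have "emeasure (occ \<Phi>) (space MXA) = (\<integral>\<^sup>+\<omega>. (\<Sum>n. indicator {\<omega>. enat n < hit_time \<Delta> \<omega> \<and> \<omega> n \<in> space MXA} \<omega>) \<partial>P)"
    by (rule I[symmetric]) simp
  also have "\<dots> \<le> (\<integral>\<^sup>+\<omega>. ennreal_of_enat (hit_time \<Delta> \<omega>) \<partial>P)"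
  proof (rule nn_integral_mono)
    fix \<omega>
    have "(\<Sum>n. indicator {\<omega>. enat n < hit_time \<Delta> \<omega> \<and> \<omega> n \<in> space MXA} \<omega>) \<le> (\<Sum>n. indicator {\<omega>. enat n < hit_time \<Delta> \<omega>} \<omega> :: ennreal)"
      by (intro suminf_le) (auto split: split_indicator)
    also have "\<dots> \<le> ennreal_of_enat (hit_time \<Delta> \<omega>)" by (rule suminf_less_hit_time_le)
    finally show "(\<Sum>n. indicator {\<omega>. enat n < hit_time \<Delta> \<omega> \<and> \<omega> n \<in> space MXA} \<omega>) \<le> ennreal_of_enat (hit_time \<Delta> \<omega>)" .
  qed
  also have "\<dots> < \<infinity>" by (rule absorbing[OF \<pi> P])
  finally show "emeasure (occ \<Phi>) (space MXA) < \<infinity>" .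
qed

lemma finite_occ:
  assumes \<Phi>: "markov \<Phi>"
  shows "finite_measure (occ \<Phi>)"
proof (rule finite_measureI)
  obtain P where P: "strategic (\<lambda>n h. \<Phi> n (snd h)) P"
    using strategic_measure_exists[OF markov_policy[OF \<Phi>]] by blast
  show "emeasure (occ \<Phi>) (space (occ \<Phi>)) \<noteq> \<infinity>"
    using occ_measure_eq_occ(2)[OF markov_policy[OF \<Phi>] P \<Phi> strategic_markov[OF \<Phi> P]]
    by (simp add: space_occ[OF \<Phi>])
qed

abbreviation "\<O> \<equiv> occ_set MX MA Aset Q \<eta> \<Delta>"

lemma occ_set_eq: "\<O> = {occ \<Phi> | \<Phi>. markov \<Phi>}"
proof (intro set_eqI iffI)
  fix \<mu> assume "\<mu> \<in> \<O>"
  then obtain \<pi> P where \<pi>: "is_policy MX MA Aset \<pi>" "strategic \<pi> P" and \<mu>: "\<mu> = occ_measure MX MA \<Delta> P"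
    by (auto simp: occ_set_def)
  obtain \<Phi> where "markov \<Phi>" "\<And>n. distr P MXA (\<lambda>\<omega>. \<omega> n) = mjoint \<Phi> n"
    using strategic_ex_markov[OF \<pi>] by blast
  then show "\<mu> \<in> {occ \<Phi> | \<Phi>. markov \<Phi>}" using occ_measure_eq_occ[OF \<pi>] \<mu> by auto
next
  fix \<mu> assume "\<mu> \<in> {occ \<Phi> | \<Phi>. markov \<Phi>}"
  then obtain \<Phi> where \<Phi>: "markov \<Phi>" and \<mu>: "\<mu> = occ \<Phi>" by auto
  obtain P where P: "strategic (\<lambda>n h. \<Phi> n (snd h)) P"
    using strategic_measure_exists[OF markov_policy[OF \<Phi>]] by blast
  have "\<mu> = occ_measure MX MA \<Delta> P"
    using occ_measure_eq_occ(1)[OF markov_policy[OF \<Phi>] P \<Phi> strategic_markov[OF \<Phi> P]] \<mu> by simp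
  then show "\<mu> \<in> \<O>"
    unfolding occ_set_def mem_Collect_eq using markov_policy[OF \<Phi>] P by (intro exI conjI)
qed

lemma chattering_occ:
  assumes \<phi>: "is_chattering MX MA Aset q \<phi>"
  shows "occ (\<lambda>_. \<phi>) \<in> occ_set_chattering MX MA Aset Q \<eta> \<Delta> q"
proof -
  have "\<phi> \<in> kernels" using \<phi> by (simp add: is_chattering_def kernels_def)
  then have m: "markov (\<lambda>_. \<phi>)" by (simp add: markov_def)
  obtain P where P: "strategic (\<lambda>n h. \<phi> (snd h)) P"
    using strategic_measure_exists[OF markov_policy[OF m]] by blast
  have "occ (\<lambda>_. \<phi>) = occ_measure MX MA \<Delta> P"
    using occ_measure_eq_occ(1)[OF markov_policy[OF m] P m strategic_markov[OF m P]] by simp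
  then show ?thesis
    unfolding occ_set_chattering_def mem_Collect_eq using \<phi> P by (intro exI conjI)
qed

section \<open>The one-step operator and test functions vanishing on \<Delta>\<close>

definition one_step :: "('x \<Rightarrow> 'a measure) \<Rightarrow> ('x \<Rightarrow> ennreal) \<Rightarrow> 'x \<Rightarrow> ennreal" where
  "one_step \<phi> f x = (\<integral>\<^sup>+a. \<integral>\<^sup>+y. f y \<partial>Q (x, a) \<partial>\<phi> x)"

abbreviation "survives \<equiv> (indicator (space MX - \<Delta>) :: 'x \<Rightarrow> ennreal)"

text \<open>Such functions vanish on \<Delta> and are at most 1. The class is stable under
  \<open>one_step\<close> because \<Delta> is absorbing, its integrals against occupation measures
  are finite, and it contains the indicators of \<open>D - \<Delta>\<close>, enough to identify a
  state marginal carried by the complement of \<Delta>.\<close>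

definition killed :: "('x \<Rightarrow> ennreal) \<Rightarrow> bool" where
  "killed f \<longleftrightarrow> f \<in> borel_measurable MX \<and> (\<forall>x\<in>space MX. f x \<le> survives x)"

lemma killedD:
  assumes "killed f"
  shows "f \<in> borel_measurable MX" "x \<in> \<Delta> \<Longrightarrow> f x = 0" "x \<in> space MX \<Longrightarrow> f x \<le> survives x"
  using assms sets.sets_into_space[OF \<Delta>] by (fastforce simp: killed_def)+

lemma killed_survives: "killed survives"
  by (auto simp: killed_def)

lemma measurable_integral_Q[measurable]:
  assumes [measurable]: "f \<in> borel_measurable MX"
  shows "(\<lambda>z. \<integral>\<^sup>+y. f y \<partial>Q z) \<in> borel_measurable MXA"
  by (rule nn_integral_measurable_subprob_algebra2[where N=MX]) (auto intro: measurable_prob_algebraD)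

lemma integral_Q_killed:
  assumes f: "killed f" and z: "z \<in> space MXA" "fst z \<in> \<Delta>"
  shows "(\<integral>\<^sup>+y. f y \<partial>Q z) = 0"
proof -
  interpret q: prob_space "Q z" by (rule Q_D[OF z(1)])
  have "emeasure (Q z) \<Delta> = 1"
    using \<Delta>_closed[of "fst z" "snd z"] z by (auto simp: space_pair_measure)
  then have "AE y in Q z. y \<in> \<Delta>"
    using Q_D(2)[OF z(1)] by (intro q.AE_prob_1) (simp add: measure_def)
  then have "(\<integral>\<^sup>+y. f y \<partial>Q z) = (\<integral>\<^sup>+y. 0 \<partial>Q z)"
    by (intro nn_integral_cong_AE) (auto simp: killedD(2)[OF f])
  then show ?thesis by simp
qed

lemma killed_one_step:
  assumes \<phi>: "\<phi> \<in> kernels" and f: "killed f"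
  shows "killed (one_step \<phi> f)"
  unfolding killed_def
proof (intro conjI ballI)
  have [measurable]: "\<phi> \<in> MX \<rightarrow>\<^sub>M subprob_algebra MA"
    by (rule measurable_prob_algebraD[OF kernelsD(1)[OF \<phi>]])
  have [measurable]: "f \<in> borel_measurable MX" by (rule killedD[OF f])
  show "one_step \<phi> f \<in> borel_measurable MX"
    unfolding one_step_def[abs_def]
    by (rule nn_integral_measurable_subprob_algebra2[where N=MA]) (auto simp: split_beta')
  fix x assume x: "x \<in> space MX"
  have space_\<phi>: "space (\<phi> x) = space MA" using kernelsD(4)[OF \<phi> x] by (rule sets_eq_imp_space_eq)
  show "one_step \<phi> f x \<le> survives x"
  proof (cases "x \<in> \<Delta>")
    case True
    then have "(\<integral>\<^sup>+a. \<integral>\<^sup>+y. f y \<partial>Q (x, a) \<partial>\<phi> x) = (\<integral>\<^sup>+a. 0 \<partial>\<phi> x)"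
      using x space_\<phi> by (intro nn_integral_cong integral_Q_killed[OF f]) (auto simp: space_pair_measure)
    then show ?thesis by (simp add: one_step_def)
  next
    case False
    have f1: "f y \<le> 1" if "y \<in> space MX" for y
      using killedD(3)[OF f that] by (auto split: split_indicator_asm)
    have "one_step \<phi> f x \<le> (\<integral>\<^sup>+a. 1 \<partial>\<phi> x)"
      unfolding one_step_def
    proof (rule nn_integral_mono)
      fix a assume "a \<in> space (\<phi> x)"
      then have z: "(x, a) \<in> space MXA" using x space_\<phi> by (simp add: space_pair_measure)
      have "(\<integral>\<^sup>+y. f y \<partial>Q (x, a)) \<le> (\<integral>\<^sup>+y. 1 \<partial>Q (x, a))"
        by (intro nn_integral_mono f1) (simp add: Q_D(3)[OF z])
      then show "(\<integral>\<^sup>+y. f y \<partial>Q (x, a)) \<le> 1" using prob_space.emeasure_space_1[OF Q_D(1)[OF z]] by simp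
    qed
    then show ?thesis using False x kernelsD(3)[OF \<phi> x] by (simp add: prob_space.emeasure_space_1)
  qed
qed

lemma killed_one_step_pow:
  assumes "\<phi> \<in> kernels" "killed f"
  shows "killed ((one_step \<phi> ^^ k) f)"
  by (induction k) (use assms in \<open>auto intro: killed_one_step\<close>)

lemma one_step_mono: "(\<And>y. y \<in> space MX \<Longrightarrow> f y \<le> h y) \<Longrightarrow> \<phi> \<in> kernels \<Longrightarrow> x \<in> space MX \<Longrightarrow> one_step \<phi> f x \<le> one_step \<phi> h x"
  unfolding one_step_def using sets_eq_imp_space_eq[OF kernelsD(4)]
  by (intro nn_integral_mono) (auto simp: Q_D space_pair_measure)

lemma one_step_pow_mono:
  assumes "\<And>y. y \<in> space MX \<Longrightarrow> f y \<le> h y" "\<phi> \<in> kernels" "x \<in> space MX"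
  shows "(one_step \<phi> ^^ k) f x \<le> (one_step \<phi> ^^ k) h x"
  using assms(3) by (induction k arbitrary: x) (auto intro!: one_step_mono assms)

lemma one_step_pow_survives_le:
  "\<phi> \<in> kernels \<Longrightarrow> x \<in> space MX \<Longrightarrow> (one_step \<phi> ^^ k) survives x \<le> survives x"
  by (intro killedD(3) killed_one_step_pow killed_survives)

lemma nn_integral_mstate_step:
  assumes \<Phi>: "markov \<Phi>" and f: "f \<in> borel_measurable MX"
  shows "(\<integral>\<^sup>+x. f x \<partial>mstate \<Phi> (Suc n)) = (\<integral>\<^sup>+x. one_step (\<Phi> n) f x \<partial>mstate \<Phi> n)"
  unfolding nn_integral_mstate_Suc[OF assms] one_step_def using f
  by (intro nn_integral_mjoint[OF \<Phi>]) measurable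

lemma nn_integral_mstate_iterate:
  assumes \<Phi>: "markov \<Phi>" and tail: "\<And>j. m \<le> j \<Longrightarrow> \<Phi> j = \<phi>" and \<phi>: "\<phi> \<in> kernels" and f: "killed f"
  shows "(\<integral>\<^sup>+x. f x \<partial>mstate \<Phi> (m + k)) = (\<integral>\<^sup>+x. (one_step \<phi> ^^ k) f x \<partial>mstate \<Phi> m)"
  using f
proof (induction k arbitrary: f)
  case (Suc k)
  have "(\<integral>\<^sup>+x. f x \<partial>mstate \<Phi> (m + Suc k)) = (\<integral>\<^sup>+x. one_step \<phi> f x \<partial>mstate \<Phi> (m + k))"
    using nn_integral_mstate_step[OF \<Phi> killedD(1)[OF Suc(2)], of "m + k"] tail by simp
  also have "\<dots> = (\<integral>\<^sup>+x. (one_step \<phi> ^^ k) (one_step \<phi> f) x \<partial>mstate \<Phi> m)"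
    by (rule Suc.IH) (rule killed_one_step[OF \<phi> Suc(2)])
  finally show ?case by (simp add: funpow_swap1)
qed simp

lemma mstate_cong: "(\<And>j. j < n \<Longrightarrow> \<Phi> j = \<Psi> j) \<Longrightarrow> mstate \<Phi> n = mstate \<Psi> n"
  by (induction n) auto

lemma nn_integral_occ_killed:
  assumes \<Phi>: "markov \<Phi>" and f: "killed f"
  shows "(\<integral>\<^sup>+z. f (fst z) \<partial>occ \<Phi>) = (\<Sum>n. \<integral>\<^sup>+x. f x \<partial>mstate \<Phi> n)"
proof -
  have [measurable]: "f \<in> borel_measurable MX" by (rule killedD[OF f])
  have "(\<integral>\<^sup>+z. f (fst z) \<partial>occ \<Phi>) = (\<Sum>n. \<integral>\<^sup>+z. f (fst z) * indicator alive z \<partial>mjoint \<Phi> n)"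
    by (rule nn_integral_occ[OF \<Phi>]) measurable
  also have "\<dots> = (\<Sum>n. \<integral>\<^sup>+z. f (fst z) \<partial>mjoint \<Phi> n)"
    by (intro suminf_cong nn_integral_cong)
      (auto simp: space_mjoint[OF \<Phi>] space_pair_measure killedD[OF f] split: split_indicator)
  finally show ?thesis by (simp add: nn_integral_mjoint_fst[OF \<Phi>])
qed

lemma suminf_mstate_finite:
  assumes \<Phi>: "markov \<Phi>"
  shows "(\<Sum>n. \<integral>\<^sup>+x. survives x \<partial>mstate \<Phi> n) < top"
proof -
  interpret finite_measure "occ \<Phi>" by (rule finite_occ[OF \<Phi>])
  have "(\<Sum>n. \<integral>\<^sup>+x. survives x \<partial>mstate \<Phi> n) = (\<integral>\<^sup>+z. survives (fst z) \<partial>occ \<Phi>)"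
    by (rule nn_integral_occ_killed[OF \<Phi> killed_survives, symmetric])
  also have "\<dots> \<le> (\<integral>\<^sup>+z. 1 \<partial>occ \<Phi>)" by (intro nn_integral_mono) (auto split: split_indicator)
  also have "\<dots> < top" using emeasure_finite[of "space (occ \<Phi>)"] by (simp add: less_top[symmetric])
  finally show ?thesis .
qed

text \<open>Switching to the stationary kernel \<open>\<phi>\<close> at time \<open>m\<close> is an admissible policy, hence absorbed.\<close>

lemma survival_after_switch_tendsto_0:
  assumes \<Phi>: "markov \<Phi>" and \<phi>: "\<phi> \<in> kernels"
  shows "(\<lambda>k. \<integral>\<^sup>+x. (one_step \<phi> ^^ k) survives x \<partial>mstate \<Phi> m) \<longlonglongrightarrow> 0"
proof -
  define \<Psi> where "\<Psi> j = (if j < m then \<Phi> j else \<phi>)" for j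
  have \<Psi>: "markov \<Psi>" using \<Phi> \<phi> by (simp add: markov_def \<Psi>_def)
  have "(\<lambda>n. \<integral>\<^sup>+x. survives x \<partial>mstate \<Psi> n) \<longlonglongrightarrow> 0"
    by (rule suminf_finite_imp_tendsto_0[OF suminf_mstate_finite[OF \<Psi>]])
  then have "(\<lambda>k. \<integral>\<^sup>+x. survives x \<partial>mstate \<Psi> (m + k)) \<longlonglongrightarrow> 0"
    by (subst add.commute) (rule LIMSEQ_ignore_initial_segment)
  moreover have "mstate \<Psi> m = mstate \<Phi> m" by (rule mstate_cong) (simp add: \<Psi>_def)
  ultimately show ?thesis
    using nn_integral_mstate_iterate[OF \<Psi> _ \<phi> killed_survives, of m] by (simp add: \<Psi>_def)
qed

text \<open>The limit is exchanged with the sum over switching times \<open>m\<close>; the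
  dominating terms are the survival probabilities at time \<open>m\<close>, whose sum is finite by
  absorption.\<close>

lemma survival_occ_tendsto_0:
  assumes \<Phi>: "markov \<Phi>" and \<phi>: "\<phi> \<in> kernels"
  shows "(\<lambda>k. \<integral>\<^sup>+z. (one_step \<phi> ^^ k) survives (fst z) \<partial>occ \<Phi>) \<longlonglongrightarrow> 0"
proof -
  have "(\<lambda>k. \<integral>\<^sup>+m. (\<integral>\<^sup>+x. (one_step \<phi> ^^ k) survives x \<partial>mstate \<Phi> m) \<partial>count_space UNIV) \<longlonglongrightarrow> (\<integral>\<^sup>+m. 0 \<partial>count_space (UNIV :: nat set))"
  proof (rule nn_integral_dominated_convergence[where w="\<lambda>m. \<integral>\<^sup>+x. survives x \<partial>mstate \<Phi> m"])
    show "AE m in count_space UNIV. (\<integral>\<^sup>+x. (one_step \<phi> ^^ k) survives x \<partial>mstate \<Phi> m) \<le> (\<integral>\<^sup>+x. survives x \<partial>mstate \<Phi> m)" for k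
      by (intro AE_I2 nn_integral_mono one_step_pow_survives_le[OF \<phi>]) (simp add: space_mstate[OF \<Phi>])
    show "(\<integral>\<^sup>+m. (\<integral>\<^sup>+x. survives x \<partial>mstate \<Phi> m) \<partial>count_space UNIV) < \<infinity>"
      using suminf_mstate_finite[OF \<Phi>] by (simp add: nn_integral_count_space_nat)
    show "AE m in count_space UNIV. (\<lambda>k. \<integral>\<^sup>+x. (one_step \<phi> ^^ k) survives x \<partial>mstate \<Phi> m) \<longlonglongrightarrow> 0"
      by (intro AE_I2 survival_after_switch_tendsto_0[OF \<Phi> \<phi>])
  qed auto
  then show ?thesis
    by (simp add: nn_integral_count_space_nat nn_integral_occ_killed[OF \<Phi> killed_one_step_pow[OF \<phi> killed_survives]])
qed

text \<open>The characteristic equation of occupation measures; \<open>c = 0\<close> is its homogeneous version.\<close>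

definition balanced :: "ennreal \<Rightarrow> ('x \<times> 'a) measure \<Rightarrow> bool" where
  "balanced c \<mu> \<longleftrightarrow> (\<forall>f. killed f \<longrightarrow>
     (\<integral>\<^sup>+z. f (fst z) \<partial>\<mu>) = c * (\<integral>\<^sup>+x. f x \<partial>\<eta>) + (\<integral>\<^sup>+z. \<integral>\<^sup>+y. f y \<partial>Q z \<partial>\<mu>))"

lemma balancedD: "balanced c \<mu> \<Longrightarrow> killed f \<Longrightarrow>
    (\<integral>\<^sup>+z. f (fst z) \<partial>\<mu>) = c * (\<integral>\<^sup>+x. f x \<partial>\<eta>) + (\<integral>\<^sup>+z. \<integral>\<^sup>+y. f y \<partial>Q z \<partial>\<mu>)"
  by (simp add: balanced_def)

text \<open>Splitting off time 0 leaves the sum over times shifted by one step, which is the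
  transition term; pairs with state in \<Delta> contribute nothing to it since they lead back to
  \<Delta>, where \<open>f\<close> vanishes.\<close>

lemma balanced_occ:
  assumes \<Phi>: "markov \<Phi>"
  shows "balanced 1 (occ \<Phi>)"
  unfolding balanced_def
proof (intro allI impI)
  fix f assume f: "killed f"
  have [measurable]: "f \<in> borel_measurable MX" by (rule killedD[OF f])
  have "(\<integral>\<^sup>+z. f (fst z) \<partial>occ \<Phi>) = (\<Sum>n. \<integral>\<^sup>+x. f x \<partial>mstate \<Phi> n)"
    by (rule nn_integral_occ_killed[OF \<Phi> f])
  also have "\<dots> = (\<Sum>n. \<integral>\<^sup>+x. f x \<partial>mstate \<Phi> (Suc n)) + (\<integral>\<^sup>+x. f x \<partial>mstate \<Phi> 0)"
    using suminf_offset[of "\<lambda>n. \<integral>\<^sup>+x. f x \<partial>mstate \<Phi> n" 1] by simp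
  also have "(\<Sum>n. \<integral>\<^sup>+x. f x \<partial>mstate \<Phi> (Suc n)) = (\<Sum>n. \<integral>\<^sup>+z. (\<integral>\<^sup>+y. f y \<partial>Q z) * indicator alive z \<partial>mjoint \<Phi> n)"
  proof (rule suminf_cong)
    fix n
    have "(\<integral>\<^sup>+z. (\<integral>\<^sup>+y. f y \<partial>Q z) \<partial>mjoint \<Phi> n) = (\<integral>\<^sup>+z. (\<integral>\<^sup>+y. f y \<partial>Q z) * indicator alive z \<partial>mjoint \<Phi> n)"
    proof (intro nn_integral_cong)
      fix z assume "z \<in> space (mjoint \<Phi> n)"
      then have z: "z \<in> space MXA" by (simp add: space_mjoint[OF \<Phi>])
      show "(\<integral>\<^sup>+y. f y \<partial>Q z) = (\<integral>\<^sup>+y. f y \<partial>Q z) * indicator alive z"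
        using integral_Q_killed[OF f z] z by (cases "fst z \<in> \<Delta>") (auto simp: space_pair_measure)
    qed
    then show "(\<integral>\<^sup>+x. f x \<partial>mstate \<Phi> (Suc n)) = (\<integral>\<^sup>+z. (\<integral>\<^sup>+y. f y \<partial>Q z) * indicator alive z \<partial>mjoint \<Phi> n)"
      using nn_integral_mstate_Suc[OF \<Phi>, of f n] by simp
  qed
  also have "\<dots> = (\<integral>\<^sup>+z. \<integral>\<^sup>+y. f y \<partial>Q z \<partial>occ \<Phi>)"
    by (rule nn_integral_occ[OF \<Phi>, symmetric]) measurable
  finally show "(\<integral>\<^sup>+z. f (fst z) \<partial>occ \<Phi>) = 1 * (\<integral>\<^sup>+x. f x \<partial>\<eta>) + (\<integral>\<^sup>+z. \<integral>\<^sup>+y. f y \<partial>Q z \<partial>occ \<Phi>)"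
    by (simp add: add.commute)
qed

text \<open>The transition term in the equation for \<open>f\<close> is the left side of the
  equation for \<open>one_step \<phi> f\<close>. Repeating this leaves a remainder bounded by the
  mass still outside \<Delta> after \<open>n\<close> steps of \<open>\<phi>\<close>.\<close>

lemma balanced_iterate:
  assumes \<mu>: "sets \<mu> = sets MXA" "balanced c \<mu>" and \<phi>: "\<phi> \<in> kernels" "\<mu> = ksemi MXA (distr \<mu> MX fst) \<phi>"
    and f: "killed f"
  shows "(\<integral>\<^sup>+z. f (fst z) \<partial>\<mu>) = c * (\<Sum>k<n. \<integral>\<^sup>+x. (one_step \<phi> ^^ k) f x \<partial>\<eta>) + (\<integral>\<^sup>+z. (one_step \<phi> ^^ n) f (fst z) \<partial>\<mu>)"
proof (induction n)
  case (Suc n)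
  let ?f = "(one_step \<phi> ^^ n) f"
  have k: "killed ?f" by (rule killed_one_step_pow[OF \<phi>(1) f])
  have [measurable]: "?f \<in> borel_measurable MX" by (rule killedD[OF k])
  have [measurable]: "one_step \<phi> ?f \<in> borel_measurable MX" by (rule killedD[OF killed_one_step[OF \<phi>(1) k]])
  have fst_m: "fst \<in> \<mu> \<rightarrow>\<^sub>M MX" using measurable_fst[of MX MA] \<mu>(1) by (simp cong: measurable_cong_sets)
  have "(\<integral>\<^sup>+z. \<integral>\<^sup>+y. ?f y \<partial>Q z \<partial>\<mu>) = (\<integral>\<^sup>+x. one_step \<phi> ?f x \<partial>distr \<mu> MX fst)"
    unfolding one_step_def[of \<phi> ?f] by (subst \<phi>(2), rule nn_integral_ksemi) (auto simp: kernelsD[OF \<phi>(1)])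
  also have "\<dots> = (\<integral>\<^sup>+z. one_step \<phi> ?f (fst z) \<partial>\<mu>)"
    using fst_m by (subst nn_integral_distr) auto
  finally have "(\<integral>\<^sup>+z. ?f (fst z) \<partial>\<mu>) = c * (\<integral>\<^sup>+x. ?f x \<partial>\<eta>) + (\<integral>\<^sup>+z. (one_step \<phi> ^^ Suc n) f (fst z) \<partial>\<mu>)"
    using balancedD[OF \<mu>(2) k] by simp
  then show ?case unfolding Suc by (simp add: distrib_left add.assoc)
qed simp

text \<open>Domination makes the remainder vanish and leaves a formula in which \<open>\<mu>\<close>
  appears only through \<open>c\<close> and \<open>\<phi>\<close>: this is uniqueness for the
  characteristic equation.\<close>

lemma dominated_balanced:
  assumes \<mu>: "sets \<mu> = sets MXA" "balanced c \<mu>" and \<phi>: "\<phi> \<in> kernels" "\<mu> = ksemi MXA (distr \<mu> MX fst) \<phi>"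
    and \<Phi>: "markov \<Phi>1" "markov \<Phi>2" and C: "C < top"
    and dom: "\<And>\<Gamma>. \<Gamma> \<in> sets MXA \<Longrightarrow> emeasure \<mu> \<Gamma> \<le> C * (emeasure (occ \<Phi>1) \<Gamma> + emeasure (occ \<Phi>2) \<Gamma>)"
    and f: "killed f" and c: "c < top"
  shows "(\<integral>\<^sup>+z. f (fst z) \<partial>\<mu>) = c * (\<Sum>k. \<integral>\<^sup>+x. (one_step \<phi> ^^ k) f x \<partial>\<eta>)"
proof -
  have "(\<lambda>n. C * ((\<integral>\<^sup>+z. (one_step \<phi> ^^ n) survives (fst z) \<partial>occ \<Phi>1) + (\<integral>\<^sup>+z. (one_step \<phi> ^^ n) survives (fst z) \<partial>occ \<Phi>2))) \<longlonglongrightarrow> C * (0 + 0)"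
    by (intro ennreal_tendsto_cmult tendsto_add C survival_occ_tendsto_0 \<Phi> \<phi>)
  then have upper: "(\<lambda>n. C * ((\<integral>\<^sup>+z. (one_step \<phi> ^^ n) survives (fst z) \<partial>occ \<Phi>1) + (\<integral>\<^sup>+z. (one_step \<phi> ^^ n) survives (fst z) \<partial>occ \<Phi>2))) \<longlonglongrightarrow> 0"
    by simp
  have "(\<lambda>n. \<integral>\<^sup>+z. (one_step \<phi> ^^ n) f (fst z) \<partial>\<mu>) \<longlonglongrightarrow> 0"
  proof (rule tendsto_sandwich[OF _ _ tendsto_const upper])
    have "(\<integral>\<^sup>+z. (one_step \<phi> ^^ n) f (fst z) \<partial>\<mu>) \<le> C * ((\<integral>\<^sup>+z. (one_step \<phi> ^^ n) survives (fst z) \<partial>occ \<Phi>1) + (\<integral>\<^sup>+z. (one_step \<phi> ^^ n) survives (fst z) \<partial>occ \<Phi>2))" for n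
    proof -
      have [measurable]: "(one_step \<phi> ^^ n) survives \<in> borel_measurable MX"
        by (rule killedD[OF killed_one_step_pow[OF \<phi>(1) killed_survives]])
      have "(\<integral>\<^sup>+z. (one_step \<phi> ^^ n) f (fst z) \<partial>\<mu>) \<le> (\<integral>\<^sup>+z. (one_step \<phi> ^^ n) survives (fst z) \<partial>\<mu>)"
        using sets_eq_imp_space_eq[OF \<mu>(1)]
        by (intro nn_integral_mono one_step_pow_mono killedD(3)[OF f] \<phi>) (auto simp: space_pair_measure)
      also have "\<dots> \<le> C * ((\<integral>\<^sup>+z. (one_step \<phi> ^^ n) survives (fst z) \<partial>occ \<Phi>1) + (\<integral>\<^sup>+z. (one_step \<phi> ^^ n) survives (fst z) \<partial>occ \<Phi>2))"
        by (rule nn_integral_le_combination[OF \<mu>(1) sets_occ[OF \<Phi>(1)] sets_occ[OF \<Phi>(2)] dom]) auto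
      finally show ?thesis .
    qed
    then show "\<forall>\<^sub>F n in sequentially. (\<integral>\<^sup>+z. (one_step \<phi> ^^ n) f (fst z) \<partial>\<mu>) \<le> C * ((\<integral>\<^sup>+z. (one_step \<phi> ^^ n) survives (fst z) \<partial>occ \<Phi>1) + (\<integral>\<^sup>+z. (one_step \<phi> ^^ n) survives (fst z) \<partial>occ \<Phi>2))"
      by (intro always_eventually allI)
  qed simp
  moreover have "(\<lambda>n. \<Sum>k<n. \<integral>\<^sup>+x. (one_step \<phi> ^^ k) f x \<partial>\<eta>) \<longlonglongrightarrow> (\<Sum>k. \<integral>\<^sup>+x. (one_step \<phi> ^^ k) f x \<partial>\<eta>)"
    by (intro summable_LIMSEQ summableI)
  ultimately have "(\<lambda>n. c * (\<Sum>k<n. \<integral>\<^sup>+x. (one_step \<phi> ^^ k) f x \<partial>\<eta>) + (\<integral>\<^sup>+z. (one_step \<phi> ^^ n) f (fst z) \<partial>\<mu>))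
      \<longlonglongrightarrow> c * (\<Sum>k. \<integral>\<^sup>+x. (one_step \<phi> ^^ k) f x \<partial>\<eta>) + 0"
    by (intro tendsto_add ennreal_tendsto_cmult c)
  then have "(\<lambda>n :: nat. \<integral>\<^sup>+z. f (fst z) \<partial>\<mu>) \<longlonglongrightarrow> c * (\<Sum>k. \<integral>\<^sup>+x. (one_step \<phi> ^^ k) f x \<partial>\<eta>)"
    by (simp add: balanced_iterate[OF \<mu> \<phi> f, symmetric])
  then show ?thesis by (rule LIMSEQ_const_iff[THEN iffD1])
qed

section \<open>Dominated solutions of the characteristic equation\<close>

lemma occ_null:
  assumes \<Phi>: "markov \<Phi>"
  shows "emeasure (occ \<Phi>) (space MXA - (Sigma (space MX) Aset \<inter> alive)) = 0"
proof -
  let ?N = "space MXA - (Sigma (space MX) Aset \<inter> alive)"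
  have "emeasure (mjoint \<Phi> n) (?N \<inter> alive) = 0" for n
  proof -
    have "emeasure (mjoint \<Phi> n) (?N \<inter> alive) = (\<integral>\<^sup>+x. emeasure (\<Phi> n x) {a \<in> space MA. (x, a) \<in> ?N \<inter> alive} \<partial>mstate \<Phi> n)"
      unfolding mjoint_def by (intro emeasure_ksemi sets_mstate \<Phi> kernelsD(1) markovD space_MX_ne) auto
    also have "\<dots> = (\<integral>\<^sup>+x. 0 \<partial>mstate \<Phi> n)"
    proof (intro nn_integral_cong)
      fix x assume "x \<in> space (mstate \<Phi> n)"
      then have x: "x \<in> space MX" by (simp add: space_mstate[OF \<Phi>])
      note k = markovD[OF \<Phi>, of n]
      interpret p: prob_space "\<Phi> n x" by (rule kernelsD(3)[OF k x])
      have "emeasure (\<Phi> n x) {a \<in> space MA. (x, a) \<in> ?N \<inter> alive} \<le> emeasure (\<Phi> n x) (space (\<Phi> n x) - Aset x)"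
        using x Aset[OF x] kernelsD(4)[OF k x] sets_eq_imp_space_eq[OF kernelsD(4)[OF k x]]
        by (intro emeasure_mono) auto
      also have "\<dots> = 0"
        using p.prob_compl[of "Aset x"] kernelsD(2)[OF k x] Aset[OF x] kernelsD(4)[OF k x]
        by (simp add: p.emeasure_eq_measure)
      finally show "emeasure (\<Phi> n x) {a \<in> space MA. (x, a) \<in> ?N \<inter> alive} = 0" by simp
    qed
    finally show ?thesis by simp
  qed
  then show ?thesis by (subst emeasure_occ[OF \<Phi>]) auto
qed

text \<open>Restricting to states outside \<Delta> does not affect the conditional law of the
  action, and all times share one kernel, so the sum over times disintegrates along it as
  well.\<close>

lemma occ_stationary_ksemi:
  assumes \<phi>: "\<phi> \<in> kernels"
  shows "occ (\<lambda>_. \<phi>) = ksemi MXA (distr (occ (\<lambda>_. \<phi>)) MX fst) \<phi>"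
proof (rule ksemi_eqI[OF _ kernelsD(1)[OF \<phi>] space_MX_ne])
  have m: "markov (\<lambda>_. \<phi>)" using \<phi> by (simp add: markov_def)
  note k = kernelsD(1)[OF \<phi>]
  show "sets (occ (\<lambda>_. \<phi>)) = sets MXA" by (rule sets_occ[OF m])
  show "finite_measure (occ (\<lambda>_. \<phi>))" by (rule finite_occ[OF m])
  fix D C assume [measurable]: "D \<in> sets MX" "C \<in> sets MA"
  have [measurable]: "(\<lambda>x. emeasure (\<phi> x) C) \<in> borel_measurable MX"
    by (rule measurable_emeasure_kernel[OF measurable_prob_algebraD[OF k] \<open>C \<in> sets MA\<close>])
  have fst_m: "fst \<in> occ (\<lambda>_. \<phi>) \<rightarrow>\<^sub>M MX" using measurable_fst[of MX MA] sets_occ[OF m] by (simp cong: measurable_cong_sets)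
  have "emeasure (occ (\<lambda>_. \<phi>)) (D \<times> C) = (\<integral>\<^sup>+z. indicator D (fst z) * indicator C (snd z) \<partial>occ (\<lambda>_. \<phi>))"
    using sets_occ[OF m] by (subst nn_integral_indicator[symmetric])
      (auto intro!: nn_integral_cong simp: indicator_times simp del: nn_integral_indicator)
  also have "\<dots> = (\<Sum>n. \<integral>\<^sup>+z. indicator D (fst z) * indicator C (snd z) * indicator alive z \<partial>mjoint (\<lambda>_. \<phi>) n)"
    by (rule nn_integral_occ[OF m]) measurable
  also have "\<dots> = (\<Sum>n. \<integral>\<^sup>+z. indicator D (fst z) * emeasure (\<phi> (fst z)) C * indicator alive z \<partial>mjoint (\<lambda>_. \<phi>) n)"
  proof (rule suminf_cong)
    fix n
    have in1: "(\<integral>\<^sup>+a. indicator D x * indicator C a * indicator alive (x, a) \<partial>\<phi> x) = indicator D x * survives x * emeasure (\<phi> x) C"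
      and in2: "(\<integral>\<^sup>+a. indicator D x * emeasure (\<phi> x) C * indicator alive (x, a) \<partial>\<phi> x) = indicator D x * survives x * emeasure (\<phi> x) C"
      if x: "x \<in> space MX" for x
    proof -
      note s = sets_eq_imp_space_eq[OF kernelsD(4)[OF \<phi> x]]
      have "(\<integral>\<^sup>+a. indicator D x * indicator C a * indicator alive (x, a) \<partial>\<phi> x) = (\<integral>\<^sup>+a. (indicator D x * survives x) * indicator C a \<partial>\<phi> x)"
        by (intro nn_integral_cong) (auto simp: s split: split_indicator)
      then show "(\<integral>\<^sup>+a. indicator D x * indicator C a * indicator alive (x, a) \<partial>\<phi> x) = indicator D x * survives x * emeasure (\<phi> x) C"
        using kernelsD(4)[OF \<phi> x] by (simp add: nn_integral_cmult_indicator)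
      have "(\<integral>\<^sup>+a. indicator D x * emeasure (\<phi> x) C * indicator alive (x, a) \<partial>\<phi> x) = (\<integral>\<^sup>+a. indicator D x * survives x * emeasure (\<phi> x) C \<partial>\<phi> x)"
        by (intro nn_integral_cong) (auto simp: s split: split_indicator)
      then show "(\<integral>\<^sup>+a. indicator D x * emeasure (\<phi> x) C * indicator alive (x, a) \<partial>\<phi> x) = indicator D x * survives x * emeasure (\<phi> x) C"
        using prob_space.emeasure_space_1[OF kernelsD(3)[OF \<phi> x]] by simp
    qed
    have "(\<integral>\<^sup>+z. indicator D (fst z) * indicator C (snd z) * indicator alive z \<partial>mjoint (\<lambda>_. \<phi>) n)
        = (\<integral>\<^sup>+x. \<integral>\<^sup>+a. indicator D (fst (x, a)) * indicator C (snd (x, a)) * indicator alive (x, a) \<partial>\<phi> x \<partial>mstate (\<lambda>_. \<phi>) n)"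
      by (rule nn_integral_mjoint[OF m]) measurable
    also have "\<dots> = (\<integral>\<^sup>+x. \<integral>\<^sup>+a. indicator D (fst (x, a)) * emeasure (\<phi> (fst (x, a))) C * indicator alive (x, a) \<partial>\<phi> x \<partial>mstate (\<lambda>_. \<phi>) n)"
      by (rule nn_integral_cong) (simp only: fst_conv snd_conv in1 in2 space_mstate[OF m])
    also have "\<dots> = (\<integral>\<^sup>+z. indicator D (fst z) * emeasure (\<phi> (fst z)) C * indicator alive z \<partial>mjoint (\<lambda>_. \<phi>) n)"
      by (rule nn_integral_mjoint[OF m, symmetric]) measurable
    finally show "(\<integral>\<^sup>+z. indicator D (fst z) * indicator C (snd z) * indicator alive z \<partial>mjoint (\<lambda>_. \<phi>) n)
        = (\<integral>\<^sup>+z. indicator D (fst z) * emeasure (\<phi> (fst z)) C * indicator alive z \<partial>mjoint (\<lambda>_. \<phi>) n)" .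
  qed
  also have "\<dots> = (\<integral>\<^sup>+z. indicator D (fst z) * emeasure (\<phi> (fst z)) C \<partial>occ (\<lambda>_. \<phi>))"
    by (rule nn_integral_occ[OF m, symmetric]) measurable
  also have "\<dots> = (\<integral>\<^sup>+x. indicator D x * emeasure (\<phi> x) C \<partial>distr (occ (\<lambda>_. \<phi>)) MX fst)"
    using fst_m by (subst nn_integral_distr) auto
  finally show "emeasure (occ (\<lambda>_. \<phi>)) (D \<times> C) = (\<integral>\<^sup>+x. indicator D x * emeasure (\<phi> x) C \<partial>distr (occ (\<lambda>_. \<phi>)) MX fst)" .
qed simp

text \<open>Two occupation measures appear because affine combinations of two points are to be
  tested. Finite mass, admissibility of actions and absence of mass on \<Delta> are all inherited
  from the bound.\<close>

definition dominated :: "('x \<times> 'a) measure \<Rightarrow> bool" where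
  "dominated \<mu> \<longleftrightarrow> sets \<mu> = sets MXA \<and> (\<exists>C \<Phi>1 \<Phi>2. markov \<Phi>1 \<and> markov \<Phi>2 \<and> C < top \<and>
    (\<forall>\<Gamma>\<in>sets MXA. emeasure \<mu> \<Gamma> \<le> C * (emeasure (occ \<Phi>1) \<Gamma> + emeasure (occ \<Phi>2) \<Gamma>)))"

lemma dominatedD:
  assumes "dominated \<mu>"
  shows "sets \<mu> = sets MXA" "space \<mu> = space MXA" "finite_measure \<mu>"
    "AE z in \<mu>. z \<in> Sigma (space MX) Aset \<inter> alive"
proof -
  obtain C \<Phi>1 \<Phi>2 where \<Phi>: "markov \<Phi>1" "markov \<Phi>2" and C: "C < top"
    and le: "\<And>\<Gamma>. \<Gamma> \<in> sets MXA \<Longrightarrow> emeasure \<mu> \<Gamma> \<le> C * (emeasure (occ \<Phi>1) \<Gamma> + emeasure (occ \<Phi>2) \<Gamma>)"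
    and s: "sets \<mu> = sets MXA"
    using assms unfolding dominated_def by blast
  show "sets \<mu> = sets MXA" "space \<mu> = space MXA" using s sets_eq_imp_space_eq[OF s] by auto
  interpret o1: finite_measure "occ \<Phi>1" by (rule finite_occ[OF \<Phi>(1)])
  interpret o2: finite_measure "occ \<Phi>2" by (rule finite_occ[OF \<Phi>(2)])
  have "emeasure \<mu> (space MXA) \<le> C * (emeasure (occ \<Phi>1) (space MXA) + emeasure (occ \<Phi>2) (space MXA))" by (rule le) simp
  also have "\<dots> < top"
    using C o1.emeasure_finite o2.emeasure_finite by (simp add: less_top[symmetric] ennreal_mult_eq_top_iff)
  finally show "finite_measure \<mu>" using s sets_eq_imp_space_eq[OF s] by (intro finite_measureI) auto
  let ?N = "space MXA - (Sigma (space MX) Aset \<inter> alive)"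
  have "emeasure \<mu> ?N \<le> C * (emeasure (occ \<Phi>1) ?N + emeasure (occ \<Phi>2) ?N)" by (rule le) measurable
  then have "emeasure \<mu> ?N = 0" by (simp add: occ_null[OF \<Phi>(1)] occ_null[OF \<Phi>(2)])
  then show "AE z in \<mu>. z \<in> Sigma (space MX) Aset \<inter> alive"
    using s sets_eq_imp_space_eq[OF s] by (intro AE_I[of _ _ ?N]) auto
qed

lemma dominated_occ:
  assumes "markov \<Phi>"
  shows "dominated (occ \<Phi>)"
  unfolding dominated_def using sets_occ[OF assms] assms
  by (intro conjI exI[of _ 1] exI[of _ \<Phi>]) auto

lemma dominated_kernel:
  assumes "dominated \<mu>"
  obtains \<phi> where "\<phi> \<in> kernels" "\<mu> = ksemi MXA (distr \<mu> MX fst) \<phi>"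
  using kernel_disintegration[of \<mu>] dominatedD[OF assms] by (metis (mono_tags, lifting) AE_mp AE_I2 IntD1 SigmaE2 prod.collapse)

lemma dominated_killed:
  assumes \<mu>: "dominated \<mu>" "balanced c \<mu>" "c < top" and \<phi>: "\<phi> \<in> kernels" "\<mu> = ksemi MXA (distr \<mu> MX fst) \<phi>"
    and f: "killed f"
  shows "(\<integral>\<^sup>+z. f (fst z) \<partial>\<mu>) = c * (\<Sum>k. \<integral>\<^sup>+x. (one_step \<phi> ^^ k) f x \<partial>\<eta>)"
proof -
  obtain C \<Phi>1 \<Phi>2 where \<Phi>: "markov \<Phi>1" "markov \<Phi>2" and C: "C < top"
    and le: "\<And>\<Gamma>. \<Gamma> \<in> sets MXA \<Longrightarrow> emeasure \<mu> \<Gamma> \<le> C * (emeasure (occ \<Phi>1) \<Gamma> + emeasure (occ \<Phi>2) \<Gamma>)"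
    using \<mu>(1) unfolding dominated_def by blast
  show ?thesis by (rule dominated_balanced[OF dominatedD(1)[OF \<mu>(1)] \<mu>(2) \<phi> \<Phi> C le f \<mu>(3)])
qed

text \<open>\<open>\<mu>\<close> and the occupation measure of \<open>\<phi>\<close> obey the same
  closed formula on test functions; the indicators of \<open>D - \<Delta>\<close> identify their
  state marginals, and the kernel is common to both.\<close>

lemma dominated_eq_occ:
  assumes \<mu>: "dominated \<mu>" "balanced 1 \<mu>" and \<phi>: "\<phi> \<in> kernels" "\<mu> = ksemi MXA (distr \<mu> MX fst) \<phi>"
  shows "\<mu> = occ (\<lambda>_. \<phi>)"
proof -
  have m: "markov (\<lambda>_. \<phi>)" using \<phi> by (simp add: markov_def)
  have "distr \<mu> MX fst = distr (occ (\<lambda>_. \<phi>)) MX fst"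
  proof (rule measure_eqI)
    fix D assume "D \<in> sets (distr \<mu> MX fst)"
    then have [measurable]: "D \<in> sets MX" by simp
    have k: "killed (indicator (D - \<Delta>))"
      using sets.sets_into_space[OF \<open>D \<in> sets MX\<close>] by (auto simp: killed_def split: split_indicator)
    have e: "emeasure (distr N MX fst) D = (\<integral>\<^sup>+z. indicator (D - \<Delta>) (fst z) \<partial>N)" if N: "dominated N" for N
    proof -
      have [measurable]: "fst \<in> N \<rightarrow>\<^sub>M MX" using measurable_fst[of MX MA] dominatedD(1)[OF N] by (simp cong: measurable_cong_sets)
      have "emeasure (distr N MX fst) D = (\<integral>\<^sup>+x. indicator D x \<partial>distr N MX fst)" by simp
      also have "\<dots> = (\<integral>\<^sup>+z. indicator D (fst z) \<partial>N)" by (subst nn_integral_distr) auto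
      also have "\<dots> = (\<integral>\<^sup>+z. indicator (D - \<Delta>) (fst z) \<partial>N)"
        using dominatedD(4)[OF N] by (intro nn_integral_cong_AE) (auto split: split_indicator)
      finally show ?thesis .
    qed
    show "emeasure (distr \<mu> MX fst) D = emeasure (distr (occ (\<lambda>_. \<phi>)) MX fst) D"
      by (simp add: e \<mu> dominated_occ[OF m] dominated_killed[OF \<mu> _ \<phi> k]
          dominated_killed[OF dominated_occ[OF m] balanced_occ[OF m] _ \<phi>(1) occ_stationary_ksemi[OF \<phi>(1)] k])
  qed simp
  then show ?thesis using \<phi>(2) occ_stationary_ksemi[OF \<phi>(1)] by simp
qed

text \<open>With \<open>c = 0\<close> the closed formula is identically zero. This is what excludes
  an occupation measure strictly below another one.\<close>

lemma dominated_homogeneous_null: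
  assumes \<mu>: "dominated \<mu>" "balanced 0 \<mu>"
  shows "emeasure \<mu> (space MXA) = 0"
proof -
  obtain \<phi> where \<phi>: "\<phi> \<in> kernels" "\<mu> = ksemi MXA (distr \<mu> MX fst) \<phi>" by (rule dominated_kernel[OF \<mu>(1)])
  have "emeasure \<mu> (space MXA) = (\<integral>\<^sup>+z. 1 \<partial>\<mu>)" by (simp add: dominatedD(2)[OF \<mu>(1)])
  also have "\<dots> = (\<integral>\<^sup>+z. survives (fst z) \<partial>\<mu>)"
    using dominatedD(4)[OF \<mu>(1)] by (intro nn_integral_cong_AE) (auto split: split_indicator)
  also have "\<dots> = 0" using dominated_killed[OF \<mu> _ \<phi> killed_survives] by simp
  finally show ?thesis .
qed

text \<open>Membership becomes a linear equation together with a bound, and both pass to nonnegative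
  affine combinations.\<close>

lemma occ_set_iff: "\<mu> \<in> \<O> \<longleftrightarrow> dominated \<mu> \<and> balanced 1 \<mu>"
proof
  assume "\<mu> \<in> \<O>"
  then show "dominated \<mu> \<and> balanced 1 \<mu>" unfolding occ_set_eq using dominated_occ balanced_occ by blast
next
  assume \<mu>: "dominated \<mu> \<and> balanced 1 \<mu>"
  then obtain \<phi> where "\<phi> \<in> kernels" "\<mu> = ksemi MXA (distr \<mu> MX fst) \<phi>" using dominated_kernel by blast
  then have "\<mu> = occ (\<lambda>_. \<phi>)" "markov (\<lambda>_. \<phi>)" using \<mu> dominated_eq_occ by (auto simp: markov_def)
  then show "\<mu> \<in> \<O>" unfolding occ_set_eq by blast
qed

subsection \<open>Affine combinations of occupation measures\<close>

lemma occ_set_finite: "\<mu> \<in> \<O> \<Longrightarrow> finite_measure \<mu>" and occ_set_sets: "\<mu> \<in> \<O> \<Longrightarrow> sets \<mu> = sets MXA"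
  by (auto simp: occ_set_iff dominatedD)

text \<open>Supplies the finiteness that is required to cancel terms in
  \<open>ennreal\<close>.\<close>

lemma balanced_finite:
  assumes \<mu>: "finite_measure \<mu>" "balanced 1 \<mu>" and f: "killed f" and s: "space \<mu> = space MXA"
  shows "(\<integral>\<^sup>+x. f x \<partial>\<eta>) < top" "(\<integral>\<^sup>+z. \<integral>\<^sup>+y. f y \<partial>Q z \<partial>\<mu>) < top"
proof -
  interpret finite_measure \<mu> by fact
  have "(\<integral>\<^sup>+z. f (fst z) \<partial>\<mu>) \<le> (\<integral>\<^sup>+z. 1 \<partial>\<mu>)"
  proof (rule nn_integral_mono)
    fix z assume "z \<in> space \<mu>"
    then have "fst z \<in> space MX" by (auto simp: s space_pair_measure)
    then have "f (fst z) \<le> survives (fst z)" by (rule killedD(3)[OF f])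
    also have "\<dots> \<le> 1" by (auto split: split_indicator)
    finally show "f (fst z) \<le> 1" .
  qed
  also have "\<dots> < top" using emeasure_finite[of "space \<mu>"] by (simp add: less_top[symmetric])
  finally have "(\<integral>\<^sup>+x. f x \<partial>\<eta>) + (\<integral>\<^sup>+z. \<integral>\<^sup>+y. f y \<partial>Q z \<partial>\<mu>) < top"
    using balancedD[OF \<mu>(2) f] by simp
  then show "(\<integral>\<^sup>+x. f x \<partial>\<eta>) < top" "(\<integral>\<^sup>+z. \<integral>\<^sup>+y. f y \<partial>Q z \<partial>\<mu>) < top" by auto
qed

lemma dominated_measure:
  assumes \<kappa>: "sets \<kappa> = sets MXA" "finite_measure \<kappa>" and \<mu>: "\<mu> \<in> \<O>" and \<nu>: "\<nu> \<in> \<O>"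
    and le: "\<And>\<Gamma>. \<Gamma> \<in> sets MXA \<Longrightarrow> measure \<kappa> \<Gamma> \<le> C * (measure \<mu> \<Gamma> + measure \<nu> \<Gamma>)" and C: "0 \<le> C"
  shows "dominated \<kappa>"
proof -
  obtain \<Phi>1 \<Phi>2 where \<Phi>: "markov \<Phi>1" "markov \<Phi>2" and eq: "\<mu> = occ \<Phi>1" "\<nu> = occ \<Phi>2"
    using \<mu> \<nu> by (auto simp: occ_set_eq)
  interpret \<kappa>: finite_measure \<kappa> by fact
  interpret o1: finite_measure "occ \<Phi>1" by (rule finite_occ[OF \<Phi>(1)])
  interpret o2: finite_measure "occ \<Phi>2" by (rule finite_occ[OF \<Phi>(2)])
  have "emeasure \<kappa> \<Gamma> \<le> ennreal C * (emeasure (occ \<Phi>1) \<Gamma> + emeasure (occ \<Phi>2) \<Gamma>)" if "\<Gamma> \<in> sets MXA" for \<Gamma>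
    using le[OF that] C
    by (simp add: eq \<kappa>.emeasure_eq_measure o1.emeasure_eq_measure o2.emeasure_eq_measure
        ennreal_mult[symmetric] ennreal_plus[symmetric] ennreal_leI del: ennreal_plus)
  moreover have "ennreal C < top" by simp
  ultimately show ?thesis unfolding dominated_def using \<kappa>(1) \<Phi> by blast
qed

text \<open>The case \<open>t > 1\<close> is the point: nonnegativity on sets is the only
  obstruction to extrapolating, since the equation is affine and the combination is bounded by
  \<open>1 + t\<close> times the sum of the two measures.\<close>

lemma occ_set_affine:
  assumes \<mu>: "\<mu> \<in> \<O>" and \<nu>: "\<nu> \<in> \<O>" and t: "0 \<le> t"
    and nonneg: "\<And>\<Gamma>. \<Gamma> \<in> sets MXA \<Longrightarrow> 0 \<le> (1 - t) * measure \<mu> \<Gamma> + t * measure \<nu> \<Gamma>"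
  obtains \<kappa> where "\<kappa> \<in> \<O>" "\<And>\<Gamma>. \<Gamma> \<in> sets MXA \<Longrightarrow> measure \<kappa> \<Gamma> = (1 - t) * measure \<mu> \<Gamma> + t * measure \<nu> \<Gamma>"
proof -
  note fin = occ_set_finite[OF \<mu>] occ_set_finite[OF \<nu>] and s = occ_set_sets[OF \<mu>] occ_set_sets[OF \<nu>]
  obtain \<kappa> where \<kappa>: "sets \<kappa> = sets MXA" "finite_measure \<kappa>"
    and eq: "\<And>\<Gamma>. \<Gamma> \<in> sets MXA \<Longrightarrow> measure \<kappa> \<Gamma> = (1 - t) * measure \<mu> \<Gamma> + t * measure \<nu> \<Gamma>"
    using real_combination_measure[OF fin(1) s(1) fin(2) s(2) nonneg] by blast
  have "dominated \<kappa>"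
  proof (rule dominated_measure[OF \<kappa> \<mu> \<nu>])
    show "measure \<kappa> \<Gamma> \<le> (1 + t) * (measure \<mu> \<Gamma> + measure \<nu> \<Gamma>)" if "\<Gamma> \<in> sets MXA" for \<Gamma>
    proof -
      have "0 \<le> t * measure \<mu> \<Gamma>" using t by simp
      then show ?thesis by (simp add: eq[OF that] algebra_simps)
    qed
  qed (use t in simp)
  moreover have "balanced 1 \<kappa>"
    unfolding balanced_def
  proof (intro allI impI)
    fix f assume f: "killed f"
    have [measurable]: "f \<in> borel_measurable MX" by (rule killedD[OF f])
    have bal: "balanced 1 \<mu>" "balanced 1 \<nu>" using \<mu> \<nu> by (simp_all add: occ_set_iff)
    \<comment> \<open>\<open>b\<close> and \<open>d\<close> are the truncations of
      \<open>t - 1\<close> and \<open>1 - t\<close>. In either case \<open>c + d = 1 + b\<close>,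
      which makes the terms from the initial law balance.\<close>
    define b c d where "b = ennreal (t - 1)" and "c = ennreal t" and "d = ennreal (1 - t)"
    have lt: "(1::ennreal) < top" "b < top" "c < top" "d < top" by (simp_all add: b_def c_def d_def)
    have cd: "c + d = 1 + b"
      using t by (cases "t \<le> 1") (simp_all add: b_def c_def d_def ennreal_neg ennreal_plus[symmetric] ennreal_1[symmetric] del: ennreal_plus ennreal_1)
    note set_eq = emeasure_combination[OF \<kappa>(2) fin t eq, folded b_def c_def d_def]
    note comb = nn_integral_eq_combination[OF \<kappa>(1) s(1) s(2) s(1) lt set_eq]
    define H where "H = (\<integral>\<^sup>+x. f x \<partial>\<eta>)"
    define G where "G N = (\<integral>\<^sup>+z. \<integral>\<^sup>+y. f y \<partial>Q z \<partial>N)" for N :: "('x \<times> 'a) measure"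
    define F where "F N = (\<integral>\<^sup>+z. f (fst z) \<partial>N)" for N :: "('x \<times> 'a) measure"
    have FG: "F \<mu> = H + G \<mu>" "F \<nu> = H + G \<nu>"
      using balancedD[OF bal(1) f] balancedD[OF bal(2) f] by (simp_all add: F_def G_def H_def)
    have F: "F \<kappa> + b * F \<mu> = c * F \<nu> + d * F \<mu>" using comb[of "\<lambda>z. f (fst z)"] by (simp add: F_def)
    have G: "G \<kappa> + b * G \<mu> = c * G \<nu> + d * G \<mu>" using comb[of "\<lambda>z. \<integral>\<^sup>+y. f y \<partial>Q z"] by (simp add: G_def)
    have "(b * H + b * G \<mu>) + F \<kappa> = (c + d) * H + (c * G \<nu> + d * G \<mu>)"
      using F by (simp add: FG distrib_left distrib_right add_ac)
    also have "\<dots> = (b * H + b * G \<mu>) + (H + G \<kappa>)"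
      unfolding cd G[symmetric] by (simp add: distrib_right add_ac)
    finally have "F \<kappa> = H + G \<kappa>"
      using balanced_finite[OF fin(1) bal(1) f sets_eq_imp_space_eq[OF s(1)]] lt
      by (simp add: ennreal_add_left_cancel ennreal_mult_eq_top_iff H_def G_def less_top[symmetric])
    then show "(\<integral>\<^sup>+z. f (fst z) \<partial>\<kappa>) = 1 * (\<integral>\<^sup>+x. f x \<partial>\<eta>) + (\<integral>\<^sup>+z. \<integral>\<^sup>+y. f y \<partial>Q z \<partial>\<kappa>)"
      by (simp add: F_def G_def H_def)
  qed
  ultimately have "\<kappa> \<in> \<O>" by (simp add: occ_set_iff)
  then show thesis using eq by (rule that)
qed

text \<open>The difference is a dominated measure, and it solves the homogeneous equation because
  the terms from the initial law cancel; hence it is null.\<close>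

lemma occ_set_le_imp_eq:
  assumes \<mu>: "\<mu> \<in> \<O>" and \<nu>: "\<nu> \<in> \<O>" and le: "\<And>\<Gamma>. \<Gamma> \<in> sets MXA \<Longrightarrow> measure \<mu> \<Gamma> \<le> measure \<nu> \<Gamma>"
  shows "\<mu> = \<nu>"
proof -
  note fin = occ_set_finite[OF \<mu>] occ_set_finite[OF \<nu>] and s = occ_set_sets[OF \<mu>] occ_set_sets[OF \<nu>]
  interpret \<mu>: finite_measure \<mu> by (rule fin)
  interpret \<nu>: finite_measure \<nu> by (rule fin)
  obtain \<kappa> where \<kappa>: "sets \<kappa> = sets MXA" "finite_measure \<kappa>"
    and eq: "\<And>\<Gamma>. \<Gamma> \<in> sets MXA \<Longrightarrow> measure \<kappa> \<Gamma> = (-1) * measure \<mu> \<Gamma> + 1 * measure \<nu> \<Gamma>"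
    by (rule real_combination_measure[OF fin(1) s(1) fin(2) s(2), of "-1" 1]) (auto simp: le)
  interpret \<kappa>: finite_measure \<kappa> by fact
  have "dominated \<kappa>"
    by (rule dominated_measure[OF \<kappa> \<mu> \<nu>, of 1]) (auto simp: eq)
  moreover have "balanced 0 \<kappa>"
    unfolding balanced_def
  proof (intro allI impI)
    fix f assume f: "killed f"
    have [measurable]: "f \<in> borel_measurable MX" by (rule killedD[OF f])
    have bal: "balanced 1 \<mu>" "balanced 1 \<nu>" using \<mu> \<nu> by (simp_all add: occ_set_iff)
    have "1 * emeasure \<kappa> \<Gamma> + 1 * emeasure \<mu> \<Gamma> = 1 * emeasure \<nu> \<Gamma> + 0 * emeasure \<nu> \<Gamma>" if "\<Gamma> \<in> sets MXA" for \<Gamma>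
    proof -
      have "measure \<nu> \<Gamma> = measure \<kappa> \<Gamma> + measure \<mu> \<Gamma>" using eq[OF that] by simp
      then show ?thesis
        by (simp add: \<kappa>.emeasure_eq_measure \<mu>.emeasure_eq_measure \<nu>.emeasure_eq_measure)
    qed
    note comb = nn_integral_eq_combination[OF \<kappa>(1) s(1) s(2) s(2) _ _ _ _ this]
    define H where "H = (\<integral>\<^sup>+x. f x \<partial>\<eta>)"
    define G where "G N = (\<integral>\<^sup>+z. \<integral>\<^sup>+y. f y \<partial>Q z \<partial>N)" for N :: "('x \<times> 'a) measure"
    define F where "F N = (\<integral>\<^sup>+z. f (fst z) \<partial>N)" for N :: "('x \<times> 'a) measure"
    have FG: "F \<mu> = H + G \<mu>" "F \<nu> = H + G \<nu>"
      using balancedD[OF bal(1) f] balancedD[OF bal(2) f] by (simp_all add: F_def G_def H_def)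
    have F: "F \<kappa> + F \<mu> = F \<nu>" using comb[of "\<lambda>z. f (fst z)"] by (simp add: F_def)
    have G: "G \<kappa> + G \<mu> = G \<nu>" using comb[of "\<lambda>z. \<integral>\<^sup>+y. f y \<partial>Q z"] by (simp add: G_def)
    have "(H + G \<mu>) + F \<kappa> = (H + G \<mu>) + G \<kappa>" using F G FG by (simp add: add_ac)
    then have "F \<kappa> = G \<kappa>"
      using balanced_finite[OF fin(1) bal(1) f sets_eq_imp_space_eq[OF s(1)]]
      by (simp add: ennreal_add_left_cancel H_def G_def less_top[symmetric])
    then show "(\<integral>\<^sup>+z. f (fst z) \<partial>\<kappa>) = 0 * (\<integral>\<^sup>+x. f x \<partial>\<eta>) + (\<integral>\<^sup>+z. \<integral>\<^sup>+y. f y \<partial>Q z \<partial>\<kappa>)"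
      by (simp add: F_def G_def)
  qed
  ultimately have 0: "emeasure \<kappa> (space MXA) = 0" by (rule dominated_homogeneous_null)
  show ?thesis
  proof (rule measure_eqI)
    fix \<Gamma> assume "\<Gamma> \<in> sets \<mu>"
    then have \<Gamma>: "\<Gamma> \<in> sets MXA" by (simp add: s)
    then have "emeasure \<kappa> \<Gamma> \<le> emeasure \<kappa> (space MXA)" using \<kappa>(1) by (intro emeasure_mono sets.sets_into_space) auto
    then have "measure \<kappa> \<Gamma> = 0" using 0 by (simp add: measure_def)
    then show "emeasure \<mu> \<Gamma> = emeasure \<nu> \<Gamma>"
      using eq[OF \<Gamma>] by (simp add: \<mu>.emeasure_eq_measure \<nu>.emeasure_eq_measure)
  qed (simp add: s)
qed

text \<open>Rays inside the set of occupation measures are bounded because one occupation measure cannot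
  strictly dominate another; they are closed because dominated solutions of the characteristic
  equation are occupation measures.\<close>

lemma occ_set_last_point:
  assumes \<mu>: "\<mu> \<in> \<O>" and \<nu>: "\<nu> \<in> \<O>" and ne: "\<mu> \<noteq> \<nu>"
  obtains t where "1 \<le> t" "\<And>\<Gamma>. \<Gamma> \<in> sets MXA \<Longrightarrow> 0 \<le> (1 - t) * measure \<mu> \<Gamma> + t * measure \<nu> \<Gamma>"
    "\<And>s. t < s \<Longrightarrow> \<exists>\<Gamma>\<in>sets MXA. (1 - s) * measure \<mu> \<Gamma> + s * measure \<nu> \<Gamma> < 0"
proof -
  define S where "S = {t. 1 \<le> t \<and> (\<forall>\<Gamma>\<in>sets MXA. 0 \<le> (1 - t) * measure \<mu> \<Gamma> + t * measure \<nu> \<Gamma>)}"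
  have 1: "1 \<in> S" by (simp add: S_def)
  have "S = {t. 1 \<le> t} \<inter> (\<Inter>\<Gamma>\<in>sets MXA. {t. 0 \<le> (1 - t) * measure \<mu> \<Gamma> + t * measure \<nu> \<Gamma>})"
    by (auto simp: S_def)
  also have "closed \<dots>"
    by (intro closed_Int closed_INT ballI closed_Collect_le continuous_intros)
  finally have "closed S" .
  moreover have bdd: "bdd_above S"
  proof (rule ccontr)
    assume unb: "\<not> bdd_above S"
    have "measure \<mu> \<Gamma> \<le> measure \<nu> \<Gamma>" if \<Gamma>: "\<Gamma> \<in> sets MXA" for \<Gamma>
    proof (rule ccontr)
      assume "\<not> ?thesis"
      then have pos: "0 < measure \<mu> \<Gamma> - measure \<nu> \<Gamma>" by simp
      \<comment> \<open>For \<open>t\<close> beyond this ratio the combination is negative on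
        \<open>\<Gamma>\<close>.\<close>
      obtain t where t: "t \<in> S" "measure \<mu> \<Gamma> / (measure \<mu> \<Gamma> - measure \<nu> \<Gamma>) < t"
        using unb by (auto simp: bdd_above_def not_le)
      then have "measure \<mu> \<Gamma> < t * (measure \<mu> \<Gamma> - measure \<nu> \<Gamma>)"
        using pos by (simp add: pos_divide_less_eq)
      moreover have "0 \<le> (1 - t) * measure \<mu> \<Gamma> + t * measure \<nu> \<Gamma>" using t(1) \<Gamma> by (simp add: S_def)
      ultimately show False by (simp add: algebra_simps)
    qed
    then show False using occ_set_le_imp_eq[OF \<mu> \<nu>] ne by blast
  qed
  ultimately have "Sup S \<in> S" using 1 by (intro closed_contains_Sup) auto
  show thesis
  proof (rule that[of "Sup S"])
    show "\<exists>\<Gamma>\<in>sets MXA. (1 - s) * measure \<mu> \<Gamma> + s * measure \<nu> \<Gamma> < 0" if s: "Sup S < s" for s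
    proof (rule ccontr)
      assume "\<not> ?thesis"
      then have "s \<in> S" using s \<open>Sup S \<in> S\<close> by (force simp: S_def not_less)
      then show False using cSup_upper[OF _ bdd] s by fastforce
    qed
  qed (use \<open>Sup S \<in> S\<close> in \<open>auto simp: S_def\<close>)
qed

subsection \<open>Extreme points under finitely many constraints\<close>

text \<open>A measure is represented by the vector of its values on measurable sets, extended by its
  \<open>p\<close> constraint integrals, so that the constraints become coordinate functionals.\<close>

definition coords :: "nat \<Rightarrow> (nat \<Rightarrow> 'x \<times> 'a \<Rightarrow> real) \<Rightarrow> ('x \<times> 'a) measure \<Rightarrow> ('x \<times> 'a) set + nat \<Rightarrow> real" where
  "coords p g \<mu> s = (case s of Inl \<Gamma> \<Rightarrow> if \<Gamma> \<in> sets MXA then measure \<mu> \<Gamma> else 0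
     | Inr i \<Rightarrow> if i < p then (\<integral>z. g i z \<partial>\<mu>) else 0)"

lemma coords_Inl: "\<Gamma> \<in> sets MXA \<Longrightarrow> coords p g \<mu> (Inl \<Gamma>) = measure \<mu> \<Gamma>"
  by (simp add: coords_def)

lemma measure_eq_imp_eq:
  assumes "\<mu> \<in> \<O>" "\<nu> \<in> \<O>" "\<And>\<Gamma>. \<Gamma> \<in> sets MXA \<Longrightarrow> measure \<mu> \<Gamma> = measure \<nu> \<Gamma>"
  shows "\<mu> = \<nu>"
  using assms by (intro occ_set_le_imp_eq) auto

lemma coords_inj:
  assumes "\<mu> \<in> \<O>" "\<nu> \<in> \<O>" "coords p g \<mu> = coords p g \<nu>"
  shows "\<mu> = \<nu>"
  using assms by (intro measure_eq_imp_eq) (auto simp: coords_Inl[of _ p g, symmetric])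

context
  fixes p :: nat and g :: "nat \<Rightarrow> 'x \<times> 'a \<Rightarrow> real" and \<alpha> :: "nat \<Rightarrow> real"
  assumes g_meas: "\<And>i. i < p \<Longrightarrow> g i \<in> borel_measurable MXA"
    and g_bdd: "\<And>i. i < p \<Longrightarrow> \<exists>c. \<forall>z\<in>space MXA. \<bar>g i z\<bar> \<le> c"
begin

text \<open>Integrals of the bounded constraint functions are affine in the measure, so a relation
  between set values extends to the full coordinate vector.\<close>

lemma coords_combination:
  assumes \<kappa>: "\<kappa> \<in> \<O>" and \<mu>: "\<mu> \<in> \<O>" and \<nu>: "\<nu> \<in> \<O>" and t: "0 \<le> t"
    and eq: "\<And>\<Gamma>. \<Gamma> \<in> sets MXA \<Longrightarrow> measure \<kappa> \<Gamma> = (1 - t) * measure \<mu> \<Gamma> + t * measure \<nu> \<Gamma>"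
  shows "coords p g \<kappa> = (1 - t) *\<^sub>R coords p g \<mu> + t *\<^sub>R coords p g \<nu>"
proof
  fix s :: "('x \<times> 'a) set + nat"
  show "coords p g \<kappa> s = ((1 - t) *\<^sub>R coords p g \<mu> + t *\<^sub>R coords p g \<nu>) s"
  proof (cases s)
    case (Inr i)
    show ?thesis
    proof (cases "i < p")
      case True
      obtain c where c: "\<And>z. z \<in> space MXA \<Longrightarrow> \<bar>g i z\<bar> \<le> c" using g_bdd[OF True] by blast
      have "(\<integral>z. g i z \<partial>\<kappa>) = (1 - t) * (\<integral>z. g i z \<partial>\<mu>) + t * (\<integral>z. g i z \<partial>\<nu>)"
        by (rule integral_combination[OF occ_set_finite[OF \<kappa>] occ_set_sets[OF \<kappa>] occ_set_finite[OF \<mu>]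
              occ_set_sets[OF \<mu>] occ_set_finite[OF \<nu>] occ_set_sets[OF \<nu>] t eq g_meas[OF True] c])
      then show ?thesis using True by (simp add: Inr coords_def plus_fun_def scaleR_fun_def)
    qed (simp add: Inr coords_def plus_fun_def scaleR_fun_def)
  qed (simp add: coords_def plus_fun_def scaleR_fun_def eq)
qed

lemma convex_coords_occ_set: "convex (coords p g ` \<O>)"
  unfolding convex_alt
proof safe
  fix \<mu> \<nu> and t :: real assume *: "\<mu> \<in> \<O>" "\<nu> \<in> \<O>" and t: "0 \<le> t" "t \<le> 1"
  obtain \<kappa> where \<kappa>: "\<kappa> \<in> \<O>" "\<And>\<Gamma>. \<Gamma> \<in> sets MXA \<Longrightarrow> measure \<kappa> \<Gamma> = (1 - t) * measure \<mu> \<Gamma> + t * measure \<nu> \<Gamma>"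
  proof -
    have "0 \<le> (1 - t) * measure \<mu> \<Gamma> + t * measure \<nu> \<Gamma>" for \<Gamma> using t by simp
    from occ_set_affine[OF * t(1) this] show thesis using that by blast
  qed
  then show "(1 - t) *\<^sub>R coords p g \<mu> + t *\<^sub>R coords p g \<nu> \<in> coords p g ` \<O>"
    using coords_combination[OF \<kappa>(1) * t(1) \<kappa>(2)] by (metis imageI)
qed

lemma coords_occ_set_last_point:
  assumes "x \<in> coords p g ` \<O>" "y \<in> coords p g ` \<O>" "x \<noteq> y"
  shows "\<exists>t\<ge>1. x + t *\<^sub>R (y - x) \<in> coords p g ` \<O> \<and> (\<forall>s>t. x + s *\<^sub>R (y - x) \<notin> coords p g ` \<O>)"
proof -
  obtain \<mu> \<nu> where \<mu>: "\<mu> \<in> \<O>" "x = coords p g \<mu>" and \<nu>: "\<nu> \<in> \<O>" "y = coords p g \<nu>" using assms by blast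
  then have ne: "\<mu> \<noteq> \<nu>" using assms by blast
  have xy: "x + t *\<^sub>R (y - x) = (1 - t) *\<^sub>R x + t *\<^sub>R y" for t by (simp add: algebra_simps)
  obtain t where t: "1 \<le> t" "\<And>\<Gamma>. \<Gamma> \<in> sets MXA \<Longrightarrow> 0 \<le> (1 - t) * measure \<mu> \<Gamma> + t * measure \<nu> \<Gamma>"
    "\<And>s. t < s \<Longrightarrow> \<exists>\<Gamma>\<in>sets MXA. (1 - s) * measure \<mu> \<Gamma> + s * measure \<nu> \<Gamma> < 0"
    by (rule occ_set_last_point[OF \<mu>(1) \<nu>(1) ne]) blast
  have t0: "0 \<le> t" using t(1) by simp
  obtain \<kappa> where \<kappa>: "\<kappa> \<in> \<O>" "\<And>\<Gamma>. \<Gamma> \<in> sets MXA \<Longrightarrow> measure \<kappa> \<Gamma> = (1 - t) * measure \<mu> \<Gamma> + t * measure \<nu> \<Gamma>"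
    by (rule occ_set_affine[OF \<mu>(1) \<nu>(1) t0 t(2)]) blast+
  have "x + t *\<^sub>R (y - x) = coords p g \<kappa>"
    using coords_combination[OF \<kappa>(1) \<mu>(1) \<nu>(1) t0 \<kappa>(2)] by (subst xy) (simp add: \<mu>(2) \<nu>(2))
  then have "x + t *\<^sub>R (y - x) \<in> coords p g ` \<O>" using \<kappa>(1) by blast
  \<comment> \<open>Past \<open>t\<close> some set coordinate is negative, which no measure
    realises.\<close>
  moreover have "x + s *\<^sub>R (y - x) \<notin> coords p g ` \<O>" if "t < s" for s
  proof
    assume "x + s *\<^sub>R (y - x) \<in> coords p g ` \<O>"
    then obtain \<kappa> where \<kappa>: "(1 - s) *\<^sub>R x + s *\<^sub>R y = coords p g \<kappa>" unfolding xy by blast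
    obtain \<Gamma> where \<Gamma>: "\<Gamma> \<in> sets MXA" "(1 - s) * measure \<mu> \<Gamma> + s * measure \<nu> \<Gamma> < 0" using t(3)[OF \<open>t < s\<close>] by blast
    have "measure \<kappa> \<Gamma> = (1 - s) * measure \<mu> \<Gamma> + s * measure \<nu> \<Gamma>"
      using fun_cong[OF \<kappa>, of "Inl \<Gamma>"] \<Gamma>(1) by (simp add: \<mu> \<nu> coords_def plus_fun_def scaleR_fun_def)
    then show False using \<Gamma>(2) measure_nonneg[of \<kappa> \<Gamma>] by simp
  qed
  ultimately show ?thesis using t(1) by blast
qed

text \<open>Coordinates are injective on occupation measures, so a proper mixture of distinct
  measures becomes an open segment between distinct vectors.\<close>

lemma extreme_coords_imp_ext_point:
  assumes \<nu>: "\<nu> \<in> \<O>" and ext: "coords p g \<nu> extreme_point_of (coords p g ` \<O>)"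
  shows "\<nu> \<in> ext_points MXA \<O>"
  unfolding ext_points_def
proof (safe intro!: \<nu>)
  fix \<mu>1 \<mu>2 and t :: real
  assume \<mu>: "\<mu>1 \<in> \<O>" "\<mu>2 \<in> \<O>" "\<mu>1 \<noteq> \<mu>2" and t: "0 < t" "t < 1" and mix: "is_mix MXA \<nu> t \<mu>1 \<mu>2"
  interpret \<nu>: finite_measure \<nu> by (rule occ_set_finite[OF \<nu>])
  interpret \<mu>1: finite_measure \<mu>1 by (rule occ_set_finite[OF \<mu>(1)])
  interpret \<mu>2: finite_measure \<mu>2 by (rule occ_set_finite[OF \<mu>(2)])
  \<comment> \<open>\<open>is_mix\<close> puts the weight \<open>t\<close> on its first measure
    while the affine form puts it on the second; hence the exchanged order of \<open>\<mu>1\<close>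
    and \<open>\<mu>2\<close>.\<close>
  have "measure \<nu> \<Gamma> = (1 - t) * measure \<mu>2 \<Gamma> + t * measure \<mu>1 \<Gamma>" if "\<Gamma> \<in> sets MXA" for \<Gamma>
  proof -
    have "emeasure \<nu> \<Gamma> = ennreal t * emeasure \<mu>1 \<Gamma> + ennreal (1 - t) * emeasure \<mu>2 \<Gamma>"
      using mix that by (simp add: is_mix_def)
    then have "ennreal (measure \<nu> \<Gamma>) = ennreal ((1 - t) * measure \<mu>2 \<Gamma> + t * measure \<mu>1 \<Gamma>)"
      using t by (simp add: \<nu>.emeasure_eq_measure \<mu>1.emeasure_eq_measure \<mu>2.emeasure_eq_measure ennreal_mult add.commute)
    then show ?thesis using t by (subst (asm) ennreal_inj) auto
  qed
  then have "coords p g \<nu> = (1 - t) *\<^sub>R coords p g \<mu>2 + t *\<^sub>R coords p g \<mu>1"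
    using t by (intro coords_combination \<nu> \<mu>) auto
  moreover have "coords p g \<mu>2 \<noteq> coords p g \<mu>1" using coords_inj \<mu> by metis
  ultimately have "coords p g \<nu> \<in> open_segment (coords p g \<mu>2) (coords p g \<mu>1)" using t by (auto simp: in_segment)
  then show False using ext \<mu> by (auto simp: extreme_point_of_def)
qed

text \<open>Dubins' theorem is applied to the unconstrained set with the \<open>p\<close> constraint
  coordinates as functionals. Extremality in the constrained set gives the separation hypothesis: a
  vector \<open>v\<close> with vanishing constraint coordinates yields two feasible points with
  midpoint \<open>\<mu>\<close>.\<close>

lemma ext_point_constrained_combination:
  assumes \<mu>: "\<mu> \<in> ext_points MXA (\<O> \<inter> constr_set p g \<alpha>)"
  shows "\<exists>n\<le>p + 1. \<exists>\<nu> w. (\<forall>i<n. \<nu> i \<in> ext_points MXA \<O> \<and> 0 \<le> w i) \<and> (\<Sum>i<n. w i) = (1::real) \<and>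
    (\<forall>\<Gamma>\<in>sets MXA. emeasure \<mu> \<Gamma> = (\<Sum>i<n. ennreal (w i) * emeasure (\<nu> i) \<Gamma>))"
proof -
  let ?K = "coords p g ` \<O>"
  have \<mu>O: "\<mu> \<in> \<O>" and \<mu>c: "\<And>i. i < p \<Longrightarrow> (\<integral>z. g i z \<partial>\<mu>) = \<alpha> i"
    using \<mu> by (auto simp: ext_points_def constr_set_def)
  have "convex_comb {e. e extreme_point_of ?K} (card {..<p} + 1) (coords p g \<mu>)"
  proof (rule dubins[where l="\<lambda>i v. v (Inr i)"])
    show "convex ?K" by (rule convex_coords_occ_set)
    show "linear (\<lambda>v :: ('x \<times> 'a) set + nat \<Rightarrow> real. v (Inr i))" for i
      by (rule linearI) (simp_all add: plus_fun_def scaleR_fun_def)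
    show "coords p g \<mu> \<in> ?K" using \<mu>O by blast
    fix v assume v: "coords p g \<mu> + v \<in> ?K" "coords p g \<mu> - v \<in> ?K" and 0: "\<And>i. i \<in> {..<p} \<Longrightarrow> v (Inr i) = 0"
    obtain \<mu>1 \<mu>2 where \<mu>1: "\<mu>1 \<in> \<O>" "coords p g \<mu> + v = coords p g \<mu>1" and \<mu>2: "\<mu>2 \<in> \<O>" "coords p g \<mu> - v = coords p g \<mu>2"
      using v by blast
    have c: "\<mu>1 \<in> constr_set p g \<alpha>" "\<mu>2 \<in> constr_set p g \<alpha>"
    proof -
      have "(\<integral>z. g i z \<partial>\<mu>1) = \<alpha> i \<and> (\<integral>z. g i z \<partial>\<mu>2) = \<alpha> i" if "i < p" for i
        using fun_cong[OF \<mu>1(2), of "Inr i"] fun_cong[OF \<mu>2(2), of "Inr i"] 0[of i] that \<mu>c[OF that]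
        by (simp add: coords_def)
      then show "\<mu>1 \<in> constr_set p g \<alpha>" "\<mu>2 \<in> constr_set p g \<alpha>" by (simp_all add: constr_set_def)
    qed
    have "is_mix MXA \<mu> (1/2) \<mu>1 \<mu>2"
      unfolding is_mix_def
    proof
      fix \<Gamma> assume \<Gamma>: "\<Gamma> \<in> sets MXA"
      have "measure \<mu> \<Gamma> = 1/2 * measure \<mu>1 \<Gamma> + 1/2 * measure \<mu>2 \<Gamma>"
        using fun_cong[OF \<mu>1(2), of "Inl \<Gamma>"] fun_cong[OF \<mu>2(2), of "Inl \<Gamma>"] \<Gamma> by (simp add: coords_def)
      then have "ennreal (measure \<mu> \<Gamma>) = ennreal (1/2) * ennreal (measure \<mu>1 \<Gamma>) + ennreal (1/2) * ennreal (measure \<mu>2 \<Gamma>)"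
        by (simp only:) (subst ennreal_plus, simp, simp, subst (1 2) ennreal_mult, simp_all)
      then show "emeasure \<mu> \<Gamma> = ennreal (1/2) * emeasure \<mu>1 \<Gamma> + ennreal (1 - 1/2) * emeasure \<mu>2 \<Gamma>"
        using occ_set_finite[OF \<mu>O] occ_set_finite[OF \<mu>1(1)] occ_set_finite[OF \<mu>2(1)]
        by (simp add: finite_measure.emeasure_eq_measure)
    qed
    moreover have "\<not> (\<exists>\<mu>1\<in>\<O> \<inter> constr_set p g \<alpha>. \<exists>\<mu>2\<in>\<O> \<inter> constr_set p g \<alpha>. \<exists>t. 0 < t \<and> t < 1 \<and> \<mu>1 \<noteq> \<mu>2 \<and> is_mix MXA \<mu> t \<mu>1 \<mu>2)"
      using \<mu> by (simp add: ext_points_def)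
    ultimately have "\<mu>1 = \<mu>2"
      using \<mu>1(1) \<mu>2(1) c half_gt_zero[of "1::real"] by (metis IntI half_gt_zero_iff less_numeral_extra(1) field_sum_of_halves less_add_same_cancel2)
    then have "v = - v" using \<mu>1(2) \<mu>2(2) by (metis add_left_imp_eq diff_conv_add_uminus)
    then show "v = 0" by (metis neg_equal_iff_equal fun_eq_iff fun_Compl_def uminus_apply equal_neg_zero zero_fun_def)
  qed (use coords_occ_set_last_point in auto)
  then obtain n e w where n: "n \<le> p + 1" and e: "\<And>i. i < n \<Longrightarrow> e i extreme_point_of ?K" and w: "\<And>i. i < n \<Longrightarrow> 0 \<le> w i" "(\<Sum>i<n. w i) = (1::real)"
    and sum: "coords p g \<mu> = (\<Sum>i<n. w i *\<^sub>R e i)"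
    unfolding convex_comb_def by auto
  have "\<exists>\<nu>. \<forall>i<n. \<nu> i \<in> \<O> \<and> e i = coords p g (\<nu> i)"
    using e unfolding extreme_point_of_def by (intro choice) blast
  then obtain \<nu> where \<nu>: "\<And>i. i < n \<Longrightarrow> \<nu> i \<in> \<O>" "\<And>i. i < n \<Longrightarrow> e i = coords p g (\<nu> i)" by blast
  have sum_apply: "(\<Sum>i<m. h i) s = (\<Sum>i<m. h i s)" for m :: nat and h :: "nat \<Rightarrow> ('x \<times> 'a) set + nat \<Rightarrow> real" and s
    by (induction m) (auto simp: zero_fun_def plus_fun_def)
  have "emeasure \<mu> \<Gamma> = (\<Sum>i<n. ennreal (w i) * emeasure (\<nu> i) \<Gamma>)" if \<Gamma>: "\<Gamma> \<in> sets MXA" for \<Gamma>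
  proof -
    have "measure \<mu> \<Gamma> = (\<Sum>i<n. w i * measure (\<nu> i) \<Gamma>)"
      using fun_cong[OF sum, of "Inl \<Gamma>"] \<Gamma> \<nu>(2) by (simp add: sum_apply scaleR_fun_def coords_def)
    then have "emeasure \<mu> \<Gamma> = ennreal (\<Sum>i<n. w i * measure (\<nu> i) \<Gamma>)"
      using occ_set_finite[OF \<mu>O] by (simp add: finite_measure.emeasure_eq_measure)
    also have "\<dots> = (\<Sum>i<n. ennreal (w i * measure (\<nu> i) \<Gamma>))"
      using w(1) by (intro sum_ennreal[symmetric]) auto
    also have "\<dots> = (\<Sum>i<n. ennreal (w i) * emeasure (\<nu> i) \<Gamma>)"
      using w(1) occ_set_finite[OF \<nu>(1)]
      by (intro sum.cong) (auto simp: finite_measure.emeasure_eq_measure ennreal_mult)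
    finally show ?thesis .
  qed
  then show ?thesis
    using n w \<nu> e extreme_coords_imp_ext_point by (intro exI[of _ n] exI[of _ \<nu>] exI[of _ w] conjI) auto
qed

end

subsection \<open>Extreme occupation measures are deterministic\<close>

text \<open>The kernel already gives \<open>Aset x\<close> full mass, so a density of integral one
  keeps it admissible.\<close>

lemma tilted_kernel:
  assumes \<phi>: "\<phi> \<in> kernels" and [measurable]: "(\<lambda>z. w (fst z) (snd z)) \<in> borel_measurable MXA"
    and one: "\<And>x. x \<in> space MX \<Longrightarrow> (\<integral>\<^sup>+a. w x a \<partial>\<phi> x) = (1::ennreal)"
  shows "(\<lambda>x. density (\<phi> x) (w x)) \<in> kernels"
proof -
  note \<phi>m = kernelsD(1)[OF \<phi>]
  have [measurable]: "w x \<in> borel_measurable MA" if "x \<in> space MX" for x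
    using measurable_compose[OF measurable_Pair1'[OF that], of "\<lambda>z. w (fst z) (snd z)"] by simp
  have wm: "w x \<in> borel_measurable (\<phi> x)" if "x \<in> space MX" for x
    using that kernelsD(4)[OF \<phi> that] by (simp cong: measurable_cong_sets)
  have e: "emeasure (density (\<phi> x) (w x)) C = (\<integral>\<^sup>+a. w x a * indicator C a \<partial>\<phi> x)" if "x \<in> space MX" "C \<in> sets MA" for x C
    using wm that kernelsD(4)[OF \<phi>] by (intro emeasure_density) auto
  have prob: "prob_space (density (\<phi> x) (w x))" if x: "x \<in> space MX" for x
  proof
    have "emeasure (density (\<phi> x) (w x)) (space (density (\<phi> x) (w x))) = (\<integral>\<^sup>+a. w x a * indicator (space (\<phi> x)) a \<partial>\<phi> x)"
      using e[OF x] sets_eq_imp_space_eq[OF kernelsD(4)[OF \<phi> x]] by simp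
    also have "\<dots> = (\<integral>\<^sup>+a. w x a \<partial>\<phi> x)" by (intro nn_integral_cong) simp
    finally show "emeasure (density (\<phi> x) (w x)) (space (density (\<phi> x) (w x))) = 1" using one[OF x] by simp
  qed
  have "(\<lambda>x. density (\<phi> x) (w x)) \<in> MX \<rightarrow>\<^sub>M prob_algebra MA"
  proof (rule measurable_prob_algebraI[OF prob measurable_subprob_algebra])
    fix C assume C[measurable]: "C \<in> sets MA"
    have "(\<lambda>x. \<integral>\<^sup>+a. w x a * indicator C a \<partial>\<phi> x) \<in> borel_measurable MX"
      using measurable_prob_algebraD[OF \<phi>m]
      by (intro nn_integral_measurable_subprob_algebra2[where N=MA]) (auto simp: split_beta')
    then show "(\<lambda>x. emeasure (density (\<phi> x) (w x)) C) \<in> borel_measurable MX"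
      by (rule measurable_cong[THEN iffD1, rotated]) (simp add: e)
  qed (auto simp: kernelsD(4)[OF \<phi>] intro: prob_space_imp_subprob_space prob)
  moreover have "emeasure (density (\<phi> x) (w x)) (Aset x) = 1" if x: "x \<in> space MX" for x
  proof -
    interpret p: prob_space "\<phi> x" by (rule kernelsD(3)[OF \<phi> x])
    have "AE a in \<phi> x. a \<in> Aset x"
      using kernelsD(2)[OF \<phi> x] Aset[OF x] kernelsD(4)[OF \<phi> x] by (intro p.AE_prob_1) (simp add: measure_def)
    then have "(\<integral>\<^sup>+a. w x a * indicator (Aset x) a \<partial>\<phi> x) = (\<integral>\<^sup>+a. w x a \<partial>\<phi> x)"
      by (intro nn_integral_cong_AE) auto
    then show ?thesis using e[OF x Aset[OF x]] one[OF x] by simp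
  qed
  ultimately show ?thesis by (simp add: kernels_def)
qed

text \<open>Perturbing the stationary kernel at a single time makes the occupation measure affine in the
  perturbation.\<close>

lemma mjoint_perturb_once:
  assumes \<phi>: "\<phi> \<in> kernels" "\<phi>1 \<in> kernels" "\<phi>2 \<in> kernels"
    and avg: "\<And>x f. x \<in> space MX \<Longrightarrow> f \<in> borel_measurable MA \<Longrightarrow>
      (\<integral>\<^sup>+a. f a \<partial>\<phi>1 x) + (\<integral>\<^sup>+a. f a \<partial>\<phi>2 x) = 2 * (\<integral>\<^sup>+a. f a \<partial>\<phi> x)"
    and f: "f \<in> borel_measurable MXA"
  shows "(\<integral>\<^sup>+z. f z \<partial>mjoint ((\<lambda>_. \<phi>)(n := \<phi>1)) k) + (\<integral>\<^sup>+z. f z \<partial>mjoint ((\<lambda>_. \<phi>)(n := \<phi>2)) k)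
    = 2 * (\<integral>\<^sup>+z. f z \<partial>mjoint (\<lambda>_. \<phi>) k)"
proof -
  let ?A = "(\<lambda>_. \<phi>)(n := \<phi>1)" and ?B = "(\<lambda>_. \<phi>)(n := \<phi>2)" and ?C = "\<lambda>_ :: nat. \<phi>"
  have m: "markov ?A" "markov ?B" "markov ?C" using \<phi> by (auto simp: markov_def)
  have kint: "(\<lambda>x. \<integral>\<^sup>+a. f (x, a) \<partial>\<psi> x) \<in> borel_measurable MX" if "\<psi> \<in> kernels" "f \<in> borel_measurable MXA" for \<psi> and f :: "'x \<times> 'a \<Rightarrow> ennreal"
    using measurable_prob_algebraD[OF kernelsD(1)[OF that(1)]] that(2)
    by (intro nn_integral_measurable_subprob_algebra2[where N=MA]) (auto simp: split_beta')
  have joint: "(\<integral>\<^sup>+z. f z \<partial>mjoint ?A k) + (\<integral>\<^sup>+z. f z \<partial>mjoint ?B k) = 2 * (\<integral>\<^sup>+z. f z \<partial>mjoint ?C k)"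
    if state: "\<And>h. h \<in> borel_measurable MX \<Longrightarrow> (\<integral>\<^sup>+x. h x \<partial>mstate ?A k) + (\<integral>\<^sup>+x. h x \<partial>mstate ?B k) = 2 * (\<integral>\<^sup>+x. h x \<partial>mstate ?C k)"
      and f: "f \<in> borel_measurable MXA" for k f
  proof (cases "k = n")
    case False
    then show ?thesis
      using state[OF kint[OF \<phi>(1) f]] by (simp add: nn_integral_mjoint[OF m(1) f] nn_integral_mjoint[OF m(2) f] nn_integral_mjoint[OF m(3) f])
  next
    case True
    \<comment> \<open>Up to time \<open>n\<close> the state law is that of the unperturbed policy,
      so the two kernels are averaged under a common integral. At other times the identity is
      inherited linearly from the state laws.\<close>
    have s: "mstate ?A n = mstate ?C n" "mstate ?B n = mstate ?C n" by (rule mstate_cong, simp)+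
    note sm = sets_mstate[OF m(3), of n]
    have meas: "(\<lambda>x. \<integral>\<^sup>+a. f (x, a) \<partial>\<psi> x) \<in> borel_measurable (mstate ?C n)" if "\<psi> \<in> kernels" for \<psi>
      using kint[OF that f] sm by (simp cong: measurable_cong_sets)
    have "(\<integral>\<^sup>+x. \<integral>\<^sup>+a. f (x, a) \<partial>\<phi>1 x \<partial>mstate ?C n) + (\<integral>\<^sup>+x. \<integral>\<^sup>+a. f (x, a) \<partial>\<phi>2 x \<partial>mstate ?C n)
        = (\<integral>\<^sup>+x. (\<integral>\<^sup>+a. f (x, a) \<partial>\<phi>1 x) + (\<integral>\<^sup>+a. f (x, a) \<partial>\<phi>2 x) \<partial>mstate ?C n)"
      by (rule nn_integral_add[symmetric]) (intro meas \<phi>)+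
    also have "\<dots> = (\<integral>\<^sup>+x. 2 * (\<integral>\<^sup>+a. f (x, a) \<partial>\<phi> x) \<partial>mstate ?C n)"
    proof (rule nn_integral_cong)
      fix x assume "x \<in> space (mstate ?C n)"
      then have x: "x \<in> space MX" by (simp add: space_mstate[OF m(3)])
      have "(\<lambda>a. f (x, a)) \<in> borel_measurable MA" using measurable_compose[OF measurable_Pair1'[OF x] f] .
      then show "(\<integral>\<^sup>+a. f (x, a) \<partial>\<phi>1 x) + (\<integral>\<^sup>+a. f (x, a) \<partial>\<phi>2 x) = 2 * (\<integral>\<^sup>+a. f (x, a) \<partial>\<phi> x)" by (rule avg[OF x])
    qed
    also have "\<dots> = 2 * (\<integral>\<^sup>+x. \<integral>\<^sup>+a. f (x, a) \<partial>\<phi> x \<partial>mstate ?C n)"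
      by (rule nn_integral_cmult) (intro meas \<phi>)
    finally show ?thesis
      unfolding True by (simp add: nn_integral_mjoint[OF m(1) f] nn_integral_mjoint[OF m(2) f] nn_integral_mjoint[OF m(3) f] s)
  qed
  have "(\<integral>\<^sup>+x. h x \<partial>mstate ?A k) + (\<integral>\<^sup>+x. h x \<partial>mstate ?B k) = 2 * (\<integral>\<^sup>+x. h x \<partial>mstate ?C k)" if "h \<in> borel_measurable MX" for h k
    using that
  proof (induction k arbitrary: h)
    case 0
    then show ?case by (simp add: mult_2)
  next
    case (Suc k)
    show ?case
      using joint[OF Suc.IH measurable_integral_Q[OF Suc.prems]]
      by (simp only: nn_integral_mstate_Suc[OF m(1) Suc.prems] nn_integral_mstate_Suc[OF m(2) Suc.prems] nn_integral_mstate_Suc[OF m(3) Suc.prems])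
  qed
  then show ?thesis using f by (rule joint)
qed


lemma ext_point_deterministic:
  assumes \<nu>: "\<nu> \<in> ext_points MXA \<O>"
  obtains f where "f \<in> MX \<rightarrow>\<^sub>M MA" "\<And>x. x \<in> space MX \<Longrightarrow> f x \<in> Aset x"
    "\<nu> = ksemi MXA (distr \<nu> MX fst) (\<lambda>x. return MA (f x))"
proof -
  have \<nu>O: "\<nu> \<in> \<O>" using \<nu> by (simp add: ext_points_def)
  obtain \<phi> where \<phi>: "\<phi> \<in> kernels" and \<nu>\<phi>: "\<nu> = ksemi MXA (distr \<nu> MX fst) \<phi>"
    using dominated_kernel \<nu>O by (auto simp: occ_set_iff)
  define \<Phi> where "\<Phi> = (\<lambda>_ :: nat. \<phi>)"
  have m: "markov \<Phi>" using \<phi> by (simp add: markov_def \<Phi>_def)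
  have \<nu>_occ: "\<nu> = occ \<Phi>" unfolding \<Phi>_def using \<nu>O \<phi> \<nu>\<phi> by (intro dominated_eq_occ) (auto simp: occ_set_iff)
  obtain c :: "'a \<Rightarrow> real" and d where cm[measurable]: "c \<in> borel_measurable MA" and c01: "\<And>a. 0 \<le> c a" "\<And>a. c a \<le> 1"
      and dm[measurable]: "d \<in> borel \<rightarrow>\<^sub>M MA" and dc: "\<And>a. a \<in> space MA \<Longrightarrow> d (c a) = a"
    using coding by blast
  note \<phi>m = kernelsD(1)[OF \<phi>]
  \<comment> \<open>\<open>u\<close> and \<open>V\<close> are the conditional mean and variance of
    the coded action given the state.\<close>
  define u where "u x = (\<integral>a. c a \<partial>\<phi> x)" for x
  define V where "V x = (\<integral>\<^sup>+a. ennreal ((c a - u x)\<^sup>2) \<partial>\<phi> x)" for x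
  have c\<phi>: "c \<in> borel_measurable (\<phi> x)" if "x \<in> space MX" for x
    using kernelsD(4)[OF \<phi> that] cm by (simp cong: measurable_cong_sets)
  have kint: "(\<lambda>x. \<integral>\<^sup>+a. f x a \<partial>\<phi> x) \<in> borel_measurable MX" if "(\<lambda>z. f (fst z) (snd z)) \<in> borel_measurable MXA" for f :: "'x \<Rightarrow> 'a \<Rightarrow> ennreal"
    using measurable_prob_algebraD[OF \<phi>m] that
    by (intro nn_integral_measurable_subprob_algebra2[where N=MA]) (auto simp: split_beta')
  have um[measurable]: "u \<in> borel_measurable MX"
  proof -
    have "(\<lambda>x. enn2real (\<integral>\<^sup>+a. ennreal (c a) \<partial>\<phi> x)) \<in> borel_measurable MX"
      by (intro borel_measurable_enn2real kint) measurable
    then show ?thesis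
      by (rule measurable_cong[THEN iffD1, rotated]) (auto simp: u_def c01 c\<phi> intro!: integral_eq_nn_integral[symmetric])
  qed
  have Vm[measurable]: "V \<in> borel_measurable MX"
    unfolding V_def by (rule kint) measurable
  have mom: "0 \<le> u x" "u x \<le> 1" "(\<integral>\<^sup>+a. ennreal (1 + c a - u x) \<partial>\<phi> x) = 1" "(\<integral>\<^sup>+a. ennreal (1 - c a + u x) \<partial>\<phi> x) = 1"
    "(\<integral>\<^sup>+a. ennreal (1 + c a - u x) * ennreal (c a) \<partial>\<phi> x) = ennreal (u x) + V x"
    "(\<integral>\<^sup>+a. ennreal (1 - c a + u x) * ennreal (c a) \<partial>\<phi> x) + V x = ennreal (u x)" "V x \<le> 1"
    if x: "x \<in> space MX" for x
    using prob_space.tilted_moments[OF kernelsD(3)[OF \<phi> x] c\<phi>[OF x] c01] unfolding u_def V_def by blast+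
  define \<phi>1 where "\<phi>1 x = density (\<phi> x) (\<lambda>a. ennreal (1 + c a - u x))" for x
  define \<phi>2 where "\<phi>2 x = density (\<phi> x) (\<lambda>a. ennreal (1 - c a + u x))" for x
  have k1: "\<phi>1 \<in> kernels" unfolding \<phi>1_def[abs_def] by (rule tilted_kernel[OF \<phi>]) (auto simp: mom)
  have k2: "\<phi>2 \<in> kernels" unfolding \<phi>2_def[abs_def] by (rule tilted_kernel[OF \<phi>]) (auto simp: mom)
  have int1: "(\<integral>\<^sup>+a. f a \<partial>\<phi>1 x) = (\<integral>\<^sup>+a. ennreal (1 + c a - u x) * f a \<partial>\<phi> x)"
    and int2: "(\<integral>\<^sup>+a. f a \<partial>\<phi>2 x) = (\<integral>\<^sup>+a. ennreal (1 - c a + u x) * f a \<partial>\<phi> x)"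
    if x: "x \<in> space MX" and f: "f \<in> borel_measurable MA" for x f
  proof -
    note [measurable_cong] = kernelsD(4)[OF \<phi> x]
    note [measurable] = f
    show "(\<integral>\<^sup>+a. f a \<partial>\<phi>1 x) = (\<integral>\<^sup>+a. ennreal (1 + c a - u x) * f a \<partial>\<phi> x)"
      unfolding \<phi>1_def by (rule nn_integral_density) measurable
    show "(\<integral>\<^sup>+a. f a \<partial>\<phi>2 x) = (\<integral>\<^sup>+a. ennreal (1 - c a + u x) * f a \<partial>\<phi> x)"
      unfolding \<phi>2_def by (rule nn_integral_density) measurable
  qed
  have avg: "(\<integral>\<^sup>+a. f a \<partial>\<phi>1 x) + (\<integral>\<^sup>+a. f a \<partial>\<phi>2 x) = 2 * (\<integral>\<^sup>+a. f a \<partial>\<phi> x)"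
    if x: "x \<in> space MX" and f[measurable]: "f \<in> borel_measurable MA" for x f
  proof -
    note [measurable_cong] = kernelsD(4)[OF \<phi> x]
    have "(\<integral>\<^sup>+a. f a \<partial>\<phi>1 x) + (\<integral>\<^sup>+a. f a \<partial>\<phi>2 x)
        = (\<integral>\<^sup>+a. ennreal (1 + c a - u x) * f a + ennreal (1 - c a + u x) * f a \<partial>\<phi> x)"
      unfolding int1[OF x f] int2[OF x f] by (rule nn_integral_add[symmetric]) measurable
    also have "\<dots> = (\<integral>\<^sup>+a. 2 * f a \<partial>\<phi> x)"
    proof (rule nn_integral_cong)
      fix a
      have "ennreal (1 + c a - u x) + ennreal (1 - c a + u x) = 2"
        using mom(1,2)[OF x] c01(1)[of a] c01(2)[of a] by (simp add: ennreal_plus[symmetric] del: ennreal_plus)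
      then show "ennreal (1 + c a - u x) * f a + ennreal (1 - c a + u x) * f a = 2 * f a"
        by (simp add: distrib_right[symmetric])
    qed
    also have "\<dots> = 2 * (\<integral>\<^sup>+a. f a \<partial>\<phi> x)" by (rule nn_integral_cmult) measurable
    finally show ?thesis .
  qed
  \<comment> \<open>Extremality forces the two policies tilted only at time \<open>n\<close> to
    share one occupation measure, and comparing two integrals against it shows that the variance at
    time \<open>n\<close> vanishes.\<close>
  have var0: "(\<integral>\<^sup>+x. V x * survives x \<partial>mstate \<Phi> n) = 0" for n
  proof -
    let ?A = "\<Phi>(n := \<phi>1)" and ?B = "\<Phi>(n := \<phi>2)"
    have mA: "markov ?A" and mB: "markov ?B" using m k1 k2 by (auto simp: markov_def)
    have sum: "(\<integral>\<^sup>+z. f z \<partial>mjoint ?A k) + (\<integral>\<^sup>+z. f z \<partial>mjoint ?B k) = 2 * (\<integral>\<^sup>+z. f z \<partial>mjoint \<Phi> k)" if "f \<in> borel_measurable MXA" for f k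
      unfolding \<Phi>_def by (rule mjoint_perturb_once[OF \<phi> k1 k2 avg that])
    have occ_sum: "emeasure (occ ?A) \<Gamma> + emeasure (occ ?B) \<Gamma> = 2 * emeasure (occ \<Phi>) \<Gamma>" if \<Gamma>[measurable]: "\<Gamma> \<in> sets MXA" for \<Gamma>
    proof -
      have e: "emeasure (occ \<Psi>) \<Gamma> = (\<Sum>k. \<integral>\<^sup>+z. indicator \<Gamma> z * indicator alive z \<partial>mjoint \<Psi> k)" if \<Psi>: "markov \<Psi>" for \<Psi>
        using nn_integral_occ[OF \<Psi>, of "indicator \<Gamma>"] sets_occ[OF \<Psi>] by simp
      have "emeasure (occ ?A) \<Gamma> + emeasure (occ ?B) \<Gamma>
          = (\<Sum>k. (\<integral>\<^sup>+z. indicator \<Gamma> z * indicator alive z \<partial>mjoint ?A k) + (\<integral>\<^sup>+z. indicator \<Gamma> z * indicator alive z \<partial>mjoint ?B k))"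
        unfolding e[OF mA] e[OF mB] by (rule suminf_add) (rule summableI)+
      also have "\<dots> = (\<Sum>k. 2 * (\<integral>\<^sup>+z. indicator \<Gamma> z * indicator alive z \<partial>mjoint \<Phi> k))"
        by (intro suminf_cong sum) measurable
      finally show ?thesis unfolding e[OF m] by simp
    qed
    interpret E: finite_measure "occ ?A" by (rule finite_occ[OF mA])
    have "is_mix MXA \<nu> (1/2) (occ ?A) (occ ?B)"
      unfolding is_mix_def
    proof
      fix \<Gamma> assume \<Gamma>: "\<Gamma> \<in> sets MXA"
      have "ennreal (1/2) * (emeasure (occ ?A) \<Gamma> + emeasure (occ ?B) \<Gamma>) = ennreal (1/2) * (ennreal 2 * emeasure \<nu> \<Gamma>)"
        unfolding occ_sum[OF \<Gamma>] \<nu>_occ by simp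
      also have "\<dots> = (ennreal (1/2) * ennreal 2) * emeasure \<nu> \<Gamma>" by (simp only: mult.assoc)
      also have "ennreal (1/2) * ennreal 2 = 1" by (subst ennreal_mult[symmetric]) auto
      finally show "emeasure \<nu> \<Gamma> = ennreal (1/2) * emeasure (occ ?A) \<Gamma> + ennreal (1 - 1/2) * emeasure (occ ?B) \<Gamma>"
        by (simp add: distrib_left fun_upd_def)
    qed
    moreover have "occ ?A \<in> \<O>" "occ ?B \<in> \<O>" using mA mB by (auto simp: occ_set_eq)
    moreover have "\<not> (\<exists>\<mu>1\<in>\<O>. \<exists>\<mu>2\<in>\<O>. \<exists>t. 0 < t \<and> t < 1 \<and> \<mu>1 \<noteq> \<mu>2 \<and> is_mix MXA \<nu> t \<mu>1 \<mu>2)"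
      using \<nu> by (simp add: ext_points_def)
    moreover have "0 < (1/2::real)" "(1/2::real) < 1" by simp_all
    ultimately have eq: "occ ?A = occ ?B" by blast
    define v where "v = (\<integral>\<^sup>+x. V x * survives x \<partial>mstate \<Phi> n)"
    \<comment> \<open>\<open>A\<close> is the expected coded action and \<open>B\<close> the
      expected value of \<open>u\<close> at the state, both on the event of not being absorbed. They
      agree at times when the kernel is \<open>\<phi>\<close>; at time \<open>n\<close> they differ
      by \<open>v\<close>, with opposite signs for the two tilts.\<close>
    define A where "A \<Psi> k = (\<integral>\<^sup>+z. ennreal (c (snd z)) * indicator alive z \<partial>mjoint \<Psi> k)" for \<Psi> k
    define B where "B \<Psi> k = (\<integral>\<^sup>+z. ennreal (u (fst z)) * indicator alive z \<partial>mjoint \<Psi> k)" for \<Psi> k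
    have B_eq: "B \<Psi> k = (\<integral>\<^sup>+x. ennreal (u x) * survives x \<partial>mstate \<Psi> k)" if \<Psi>: "markov \<Psi>" for \<Psi> k
    proof -
      have "B \<Psi> k = (\<integral>\<^sup>+z. ennreal (u (fst z)) * survives (fst z) \<partial>mjoint \<Psi> k)"
        unfolding B_def by (intro nn_integral_cong) (auto simp: space_mjoint[OF \<Psi>] space_pair_measure split: split_indicator)
      also have "\<dots> = (\<integral>\<^sup>+x. ennreal (u x) * survives x \<partial>mstate \<Psi> k)" by (rule nn_integral_mjoint_fst[OF \<Psi>]) measurable
      finally show ?thesis .
    qed
    have A_eq: "A \<Psi> k = (\<integral>\<^sup>+x. (\<integral>\<^sup>+a. ennreal (c a) \<partial>\<Psi> k x) * survives x \<partial>mstate \<Psi> k)" if \<Psi>: "markov \<Psi>" for \<Psi> k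
    proof -
      have "A \<Psi> k = (\<integral>\<^sup>+x. \<integral>\<^sup>+a. ennreal (c (snd (x, a))) * indicator alive (x, a) \<partial>\<Psi> k x \<partial>mstate \<Psi> k)"
        unfolding A_def by (rule nn_integral_mjoint[OF \<Psi>]) measurable
      also have "\<dots> = (\<integral>\<^sup>+x. (\<integral>\<^sup>+a. ennreal (c a) \<partial>\<Psi> k x) * survives x \<partial>mstate \<Psi> k)"
      proof (rule nn_integral_cong)
        fix x assume "x \<in> space (mstate \<Psi> k)"
        then have x: "x \<in> space MX" by (simp add: space_mstate[OF \<Psi>])
        note sk = kernelsD(4)[OF markovD[OF \<Psi>, of k] x]
        have "(\<integral>\<^sup>+a. ennreal (c (snd (x, a))) * indicator alive (x, a) \<partial>\<Psi> k x) = (\<integral>\<^sup>+a. ennreal (c a) * survives x \<partial>\<Psi> k x)"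
          by (intro nn_integral_cong) (auto simp: sets_eq_imp_space_eq[OF sk] split: split_indicator)
        also have "\<dots> = (\<integral>\<^sup>+a. ennreal (c a) \<partial>\<Psi> k x) * survives x"
          using sk cm by (intro nn_integral_multc) (simp cong: measurable_cong_sets)
        finally show "(\<integral>\<^sup>+a. ennreal (c (snd (x, a))) * indicator alive (x, a) \<partial>\<Psi> k x) = (\<integral>\<^sup>+a. ennreal (c a) \<partial>\<Psi> k x) * survives x" .
      qed
      finally show ?thesis .
    qed
    have cu: "(\<integral>\<^sup>+a. ennreal (c a) \<partial>\<phi> x) = ennreal (u x)" if x: "x \<in> space MX" for x
    proof -
      interpret p: prob_space "\<phi> x" by (rule kernelsD(3)[OF \<phi> x])
      have "integrable (\<phi> x) c" by (rule p.integrable_const_bound[where B=1]) (auto simp: c01 c\<phi>[OF x])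
      then show ?thesis unfolding u_def by (intro nn_integral_eq_integral) (auto simp: c01)
    qed
    have off: "A \<Psi> k = B \<Psi> k" if \<Psi>: "markov \<Psi>" and "\<Psi> k = \<phi>" for \<Psi> k
      unfolding A_eq[OF \<Psi>] B_eq[OF \<Psi>] using that(2) by (intro nn_integral_cong) (simp add: space_mstate[OF \<Psi>] cu)
    have sn: "mstate ?A n = mstate \<Phi> n" "mstate ?B n = mstate \<Phi> n" by (rule mstate_cong, simp)+
    note sms = sets_mstate[OF m, of n]
    have meas1: "(\<lambda>x. ennreal (u x) * survives x) \<in> borel_measurable (mstate \<Phi> n)" "(\<lambda>x. V x * survives x) \<in> borel_measurable (mstate \<Phi> n)"
      using sms by (simp_all cong: measurable_cong_sets)
    have onA: "A ?A n = B ?A n + v"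
    proof -
      have "A ?A n = (\<integral>\<^sup>+x. ennreal (u x) * survives x + V x * survives x \<partial>mstate \<Phi> n)"
        unfolding A_eq[OF mA] sn
        by (intro nn_integral_cong) (simp add: space_mstate[OF m] int1 mom(5) distrib_right)
      also have "\<dots> = B ?A n + v" unfolding B_eq[OF mA] sn v_def by (rule nn_integral_add) (rule meas1)+
      finally show ?thesis .
    qed
    have onB: "A ?B n + v = B ?B n"
    proof -
      have "(\<lambda>x. (\<integral>\<^sup>+a. ennreal (c a) \<partial>\<phi>2 x) * survives x) \<in> borel_measurable MX"
        using measurable_prob_algebraD[OF kernelsD(1)[OF k2]]
        by (intro borel_measurable_times_ennreal nn_integral_measurable_subprob_algebra2[where N=MA]) (auto simp: split_beta')
      then have "(\<lambda>x. (\<integral>\<^sup>+a. ennreal (c a) \<partial>\<phi>2 x) * survives x) \<in> borel_measurable (mstate \<Phi> n)"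
        using sms by (simp cong: measurable_cong_sets)
      then have "A ?B n + v = (\<integral>\<^sup>+x. (\<integral>\<^sup>+a. ennreal (c a) \<partial>\<phi>2 x) * survives x + V x * survives x \<partial>mstate \<Phi> n)"
        unfolding A_eq[OF mB] sn v_def using meas1(2) by (simp add: nn_integral_add)
      also have "\<dots> = B ?B n"
        unfolding B_eq[OF mB] sn
        by (intro nn_integral_cong) (simp add: space_mstate[OF m] int2 mom(6) distrib_right[symmetric])
      finally show ?thesis .
    qed
    have offA: "A ?A k = B ?A k" if "k \<noteq> n" for k
      by (rule off[OF mA]) (use that in \<open>simp add: \<Phi>_def\<close>)
    have offB: "A ?B k = B ?B k" if "k \<noteq> n" for k
      by (rule off[OF mB]) (use that in \<open>simp add: \<Phi>_def\<close>)
    have sA: "(\<integral>\<^sup>+z. ennreal (c (snd z)) \<partial>occ \<Psi>) = (\<Sum>k. A \<Psi> k)" and sB: "(\<integral>\<^sup>+z. ennreal (u (fst z)) \<partial>occ \<Psi>) = (\<Sum>k. B \<Psi> k)"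
      if "markov \<Psi>" for \<Psi>
      unfolding A_def B_def by (rule nn_integral_occ[OF that], measurable)+
    have vs: "(\<Sum>k. if k = n then v else 0) = v" using sums_If_finite_set[of "{n}" "\<lambda>_. v"] by (simp add: sums_iff)
    have "(\<integral>\<^sup>+z. ennreal (c (snd z)) \<partial>occ ?A) = (\<Sum>k. B ?A k + (if k = n then v else 0))"
      unfolding sA[OF mA] using offA onA by (intro suminf_cong) auto
    also have "\<dots> = (\<integral>\<^sup>+z. ennreal (u (fst z)) \<partial>occ ?A) + v"
      unfolding sB[OF mA] by (subst suminf_add[symmetric]) (auto intro: summableI simp: vs)
    finally have 1: "(\<integral>\<^sup>+z. ennreal (c (snd z)) \<partial>occ ?A) = (\<integral>\<^sup>+z. ennreal (u (fst z)) \<partial>occ ?A) + v" .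
    have "(\<integral>\<^sup>+z. ennreal (c (snd z)) \<partial>occ ?B) + v = (\<Sum>k. A ?B k + (if k = n then v else 0))"
      unfolding sA[OF mB] by (subst suminf_add[symmetric]) (auto intro: summableI simp: vs)
    also have "\<dots> = (\<integral>\<^sup>+z. ennreal (u (fst z)) \<partial>occ ?B)"
      unfolding sB[OF mB] using offB onB by (intro suminf_cong) auto
    finally have 2: "(\<integral>\<^sup>+z. ennreal (c (snd z)) \<partial>occ ?A) + v = (\<integral>\<^sup>+z. ennreal (u (fst z)) \<partial>occ ?A)" unfolding eq .
    have "(\<integral>\<^sup>+z. ennreal (c (snd z)) \<partial>occ ?A) \<le> (\<integral>\<^sup>+z. 1 \<partial>occ ?A)"
      by (intro nn_integral_mono) (simp add: c01 ennreal_le_1)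
    also have "\<dots> < top" using E.emeasure_finite[of "space (occ ?A)"] by (simp add: less_top[symmetric])
    finally have fin: "(\<integral>\<^sup>+z. ennreal (c (snd z)) \<partial>occ ?A) < top" .
    \<comment> \<open>With S and U the integrals of \<open>c\<close> and \<open>u\<close> against
      the common occupation measure, S = U + v and S + v = U; finiteness of S gives v + v =
      0.\<close>
    have "(\<integral>\<^sup>+z. ennreal (c (snd z)) \<partial>occ ?A) + (v + v) = ((\<integral>\<^sup>+z. ennreal (c (snd z)) \<partial>occ ?A) + v) + v"
      by (simp only: add.assoc)
    also have "\<dots> = (\<integral>\<^sup>+z. ennreal (c (snd z)) \<partial>occ ?A) + 0"
      unfolding 2 by (simp only: 1[symmetric] add_0_right)
    finally have "(\<integral>\<^sup>+z. ennreal (c (snd z)) \<partial>occ ?A) + (v + v) = (\<integral>\<^sup>+z. ennreal (c (snd z)) \<partial>occ ?A) + 0" .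
    then have "v + v = 0" using fin by (subst (asm) ennreal_add_left_cancel) auto
    then show ?thesis by (simp add: v_def)
  qed
  have Vk: "killed (\<lambda>x. V x * survives x)"
    unfolding killed_def using mom(7) by (auto split: split_indicator)
  have "(\<integral>\<^sup>+z. V (fst z) * survives (fst z) \<partial>\<nu>) = 0"
    unfolding \<nu>_occ nn_integral_occ_killed[OF m Vk] by (simp add: var0)
  define mg where "mg = distr \<nu> MX fst"
  have smg: "sets mg = sets MX" "space mg = space MX" by (simp_all add: mg_def)
  have dom: "dominated \<nu>" using \<nu>O by (simp add: occ_set_iff)
  have fst_m: "fst \<in> \<nu> \<rightarrow>\<^sub>M MX" using measurable_fst[of MX MA] dominatedD(1)[OF dom] by (simp cong: measurable_cong_sets)
  have "(\<integral>\<^sup>+x. V x \<partial>mg) = (\<integral>\<^sup>+z. V (fst z) \<partial>\<nu>)" unfolding mg_def using fst_m by (subst nn_integral_distr) auto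
  also have "\<dots> = (\<integral>\<^sup>+z. V (fst z) * survives (fst z) \<partial>\<nu>)"
    using dominatedD(4)[OF dom] by (intro nn_integral_cong_AE) (auto split: split_indicator)
  also have "\<dots> = 0" by fact
  finally have "AE x in mg. V x = 0"
    using Vm smg by (subst (asm) nn_integral_0_iff_AE) (auto cong: measurable_cong_sets)
  \<comment> \<open>Vanishing variance makes \<open>c\<close> equal to its mean almost surely, so
    the action is the decoded mean \<open>d (u x)\<close>.\<close>
  then have AE\<phi>: "AE x in mg. \<phi> x = return MA (d (u x)) \<and> d (u x) \<in> Aset x"
    using AE_space
  proof eventually_elim
    case (elim x)
    then have x: "x \<in> space MX" by (simp add: smg)
    interpret p: prob_space "\<phi> x" by (rule kernelsD(3)[OF \<phi> x])
    note sp = sets_eq_imp_space_eq[OF kernelsD(4)[OF \<phi> x]]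
    have "AE a in \<phi> x. ennreal ((c a - u x)\<^sup>2) = 0"
      using elim(1) c\<phi>[OF x] unfolding V_def by (subst (asm) nn_integral_0_iff_AE) auto
    then have "AE a in \<phi> x. c a = u x" by eventually_elim simp
    then have "AE a in \<phi> x. a = d (u x)"
      using AE_space by eventually_elim (metis dc sp)
    from p.AE_eq_constD[OF this] have ret: "\<phi> x = return (\<phi> x) (d (u x))" "d (u x) \<in> space MA" by (auto simp: sp)
    have r: "return (\<phi> x) (d (u x)) = return MA (d (u x))" using return_sets_cong[OF kernelsD(4)[OF \<phi> x]] by simp
    have "emeasure (return MA (d (u x))) (Aset x) = 1" using kernelsD(2)[OF \<phi> x] ret r by simp
    then have "d (u x) \<in> Aset x" using Aset[OF x] by (simp add: indicator_def split: if_splits)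
    then show ?case using ret r by simp
  qed
  obtain \<theta> where \<theta>[measurable]: "\<theta> \<in> MX \<rightarrow>\<^sub>M MA" and \<theta>_mem: "\<And>x. x \<in> space MX \<Longrightarrow> \<theta> x \<in> Aset x"
    using selector by blast
  \<comment> \<open>The decoded mean is known to be admissible only almost everywhere; where it is
    not, the selector takes over.\<close>
  define f where "f x = (if (x, d (u x)) \<in> Sigma (space MX) Aset then d (u x) else \<theta> x)" for x
  have fm[measurable]: "f \<in> MX \<rightarrow>\<^sub>M MA" unfolding f_def by measurable
  have "ksemi MXA mg \<phi> = ksemi MXA mg (\<lambda>x. return MA (f x))"
  proof (rule ksemi_cong_AE[OF smg(1) \<phi>m])
    show "(\<lambda>x. return MA (f x)) \<in> MX \<rightarrow>\<^sub>M prob_algebra MA" by measurable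
    show "AE x in mg. \<phi> x = return MA (f x)"
      using AE\<phi> AE_space by eventually_elim (auto simp: f_def smg)
  qed
  then have "\<nu> = ksemi MXA (distr \<nu> MX fst) (\<lambda>x. return MA (f x))" using \<nu>\<phi> by (simp add: mg_def)
  moreover have "f x \<in> Aset x" if "x \<in> space MX" for x using \<theta>_mem[OF that] by (auto simp: f_def)
  ultimately show thesis using fm that by blast
qed


text \<open>The state marginals of the \<open>\<nu> i\<close> may differ, so the mixing weights must
  depend on the state: they are the densities of the weighted state marginals of the
  \<open>\<nu> i\<close> with respect to the state marginal of \<open>\<mu>\<close>.\<close>

lemma chattering_combination:
  assumes \<mu>: "\<mu> \<in> \<O>" and nq: "n \<le> q"
    and \<nu>: "\<And>i. i < n \<Longrightarrow> \<nu> i \<in> ext_points MXA \<O>" and w: "\<And>i. i < n \<Longrightarrow> 0 \<le> w i" "(\<Sum>i<n. w i) = (1::real)"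
    and mix: "\<And>\<Gamma>. \<Gamma> \<in> sets MXA \<Longrightarrow> emeasure \<mu> \<Gamma> = (\<Sum>i<n. ennreal (w i) * emeasure (\<nu> i) \<Gamma>)"
  shows "\<mu> \<in> occ_set_chattering MX MA Aset Q \<eta> \<Delta> q"
proof -
  have "n \<noteq> 0" using w(2) by (cases n) auto
  have \<nu>O: "\<nu> i \<in> \<O>" if "i < n" for i using \<nu>[OF that] by (simp add: ext_points_def)
  have "\<exists>f. i < n \<longrightarrow> f \<in> MX \<rightarrow>\<^sub>M MA \<and> (\<forall>x\<in>space MX. f x \<in> Aset x) \<and>
      \<nu> i = ksemi MXA (distr (\<nu> i) MX fst) (\<lambda>x. return MA (f x))" for i
  proof (cases "i < n")
    case True
    show ?thesis by (rule ext_point_deterministic[OF \<nu>[OF True]]) blast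
  qed simp
  then obtain f where f: "\<And>i. i < n \<Longrightarrow> f i \<in> MX \<rightarrow>\<^sub>M MA" "\<And>i x. i < n \<Longrightarrow> x \<in> space MX \<Longrightarrow> f i x \<in> Aset x"
    "\<And>i. i < n \<Longrightarrow> \<nu> i = ksemi MXA (distr (\<nu> i) MX fst) (\<lambda>x. return MA (f i x))" by metis
  obtain \<theta> where \<theta>: "\<theta> \<in> MX \<rightarrow>\<^sub>M MA" "\<And>x. x \<in> space MX \<Longrightarrow> \<theta> x \<in> Aset x"
    using selector by blast
  \<comment> \<open>Indices from \<open>n\<close> up to \<open>q\<close> are filled with the
    selector and will receive weight 0, which pads the kernel to order \<open>q\<close>.\<close>
  define F where "F i = (if i < n then f i else \<theta>)" for i
  have Fm[measurable]: "F i \<in> MX \<rightarrow>\<^sub>M MA" and F_mem: "x \<in> space MX \<Longrightarrow> F i x \<in> Aset x" for i x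
    using f \<theta> by (auto simp: F_def)
  have fin: "finite_measure \<mu>" by (rule occ_set_finite[OF \<mu>])
  have sets_fst: "fst \<in> N \<rightarrow>\<^sub>M MX" if "N \<in> \<O>" for N
    using measurable_fst[of MX MA] occ_set_sets[OF that] by (simp cong: measurable_cong_sets)
  define m where "m = distr \<mu> MX fst"
  have sm[simp, measurable_cong]: "sets m = sets MX" and spm[simp]: "space m = space MX" by (simp_all add: m_def)
  interpret m: finite_measure m unfolding m_def by (rule finite_measure.finite_measure_distr[OF fin sets_fst[OF \<mu>]])
  define \<rho> where "\<rho> i = scale_measure (ennreal (w i)) (distr (\<nu> i) MX fst)" for i
  have s\<rho>: "sets (\<rho> i) = sets MX" for i by (simp add: \<rho>_def)
  have em: "emeasure m D = (\<Sum>i<n. emeasure (\<rho> i) D)" if D: "D \<in> sets MX" for D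
  proof -
    have pre: "fst -` D \<inter> space N = D \<times> space MA" if "N \<in> \<O>" for N
      using sets.sets_into_space[OF D] sets_eq_imp_space_eq[OF occ_set_sets[OF that]] by (auto simp: space_pair_measure)
    have "emeasure m D = emeasure \<mu> (D \<times> space MA)"
      unfolding m_def using D sets_fst[OF \<mu>] by (simp add: emeasure_distr pre[OF \<mu>])
    also have "\<dots> = (\<Sum>i<n. ennreal (w i) * emeasure (\<nu> i) (D \<times> space MA))" using D by (intro mix) auto
    also have "\<dots> = (\<Sum>i<n. emeasure (\<rho> i) D)"
      using D by (intro sum.cong) (simp_all add: \<rho>_def emeasure_distr sets_fst[OF \<nu>O] pre[OF \<nu>O])
    finally show ?thesis .
  qed
  define h where "h i = RN_deriv m (\<rho> i)" for i
  have hm[measurable]: "h i \<in> borel_measurable MX" for i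
    using borel_measurable_RN_deriv[of m "\<rho> i"] by (simp add: h_def)
  have dens: "density m (h i) = \<rho> i" if "i < n" for i
    unfolding h_def
  proof (rule m.density_RN_deriv)
    show "absolutely_continuous m (\<rho> i)"
      unfolding absolutely_continuous_def
    proof
      fix D assume "D \<in> null_sets m"
      then have "D \<in> sets MX" "(\<Sum>i<n. emeasure (\<rho> i) D) = 0" using em by (auto simp: null_sets_def)
      then show "D \<in> null_sets (\<rho> i)" using that by (auto simp: null_sets_def s\<rho>)
    qed
  qed (simp add: s\<rho>)
  have hint: "(\<integral>\<^sup>+x. g x \<partial>\<rho> i) = (\<integral>\<^sup>+x. h i x * g x \<partial>m)" if "i < n" "g \<in> borel_measurable MX" for i g
    unfolding dens[OF that(1), symmetric] using that(2) by (intro nn_integral_density) auto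
  have sumD: "(\<integral>\<^sup>+x. (\<Sum>i<n. h i x) * indicator D x \<partial>m) = (\<integral>\<^sup>+x. 1 * indicator D x \<partial>m)" if D[measurable]: "D \<in> sets MX" for D
  proof -
    have "(\<integral>\<^sup>+x. (\<Sum>i<n. h i x) * indicator D x \<partial>m) = (\<Sum>i<n. \<integral>\<^sup>+x. h i x * indicator D x \<partial>m)"
      unfolding sum_distrib_right by (rule nn_integral_sum) measurable
    also have "\<dots> = (\<Sum>i<n. emeasure (\<rho> i) D)"
      using D by (intro sum.cong) (simp_all add: hint[symmetric] s\<rho>)
    finally show ?thesis using em[OF D] D by simp
  qed
  have total: "(\<integral>\<^sup>+x. 1 \<partial>m) < \<infinity>" using m.emeasure_finite[of "space m"] by (simp add: less_top[symmetric])
  have "AE x in m. (\<Sum>i<n. h i x) = 1"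
  proof -
    have "(\<integral>\<^sup>+x. (\<Sum>i<n. h i x) \<partial>m) = (\<integral>\<^sup>+x. (\<Sum>i<n. h i x) * indicator (space MX) x \<partial>m)"
      by (intro nn_integral_cong) simp
    also have "\<dots> = (\<integral>\<^sup>+x. 1 * indicator (space MX) x \<partial>m)" by (rule sumD) simp
    also have "\<dots> = (\<integral>\<^sup>+x. 1 \<partial>m)" by (intro nn_integral_cong) simp
    finally have fin': "(\<integral>\<^sup>+x. (\<Sum>i<n. h i x) \<partial>m) < \<infinity>" using total by simp
    have "AE x in m. (\<Sum>i<n. h i x) \<le> 1"
      by (rule AE_le_of_set_nn_integral_le[OF _ _ fin']) (auto simp only: sumD sm intro: order_refl, measurable)
    moreover have "AE x in m. 1 \<le> (\<Sum>i<n. h i x)"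
      by (rule AE_le_of_set_nn_integral_le[OF _ _ total]) (auto simp only: sumD sm intro: order_refl, measurable)
    ultimately show ?thesis by eventually_elim (rule antisym)
  qed
  define good where "good x \<longleftrightarrow> (\<Sum>i<n. h i x) = 1" for x
  have AE_good: "AE x in m. good x" unfolding good_def by fact
  have [measurable]: "Measurable.pred MX good" unfolding good_def by measurable
  \<comment> \<open>On the null set where the densities do not sum to one, all weight goes to index
    0; \<open>n \<noteq> 0\<close> ensures that this index is below \<open>q\<close>.\<close>
  define \<beta> where "\<beta> i x = (if good x then (if i < n then enn2real (h i x) else 0) else of_bool (i = 0))" for i x
  have \<beta>m[measurable]: "\<beta> i \<in> borel_measurable MX" for i unfolding \<beta>_def by measurable
  have \<beta>0: "0 \<le> \<beta> i x" for i x by (simp add: \<beta>_def)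
  have h_fin: "h i x < top" if "good x" "i < n" for i x
  proof -
    have "h i x \<le> (\<Sum>i<n. h i x)" using that(2) by (intro member_le_sum) auto
    then show ?thesis using that(1) by (auto simp: good_def intro: le_less_trans)
  qed
  have \<beta>1: "(\<Sum>i<q. \<beta> i x) = 1" for x
  proof (cases "good x")
    case True
    have "(\<Sum>i<q. \<beta> i x) = (\<Sum>i<n. \<beta> i x)"
      using nq True by (intro sum.mono_neutral_right) (auto simp: \<beta>_def)
    also have "\<dots> = (\<Sum>i<n. enn2real (h i x))" using True by (intro sum.cong) (auto simp: \<beta>_def)
    also have "\<dots> = enn2real (\<Sum>i<n. h i x)"
      using enn2real_sum[of "{..<n}" "\<lambda>i. h i x"] h_fin[OF True] by (simp add: comp_def)
    finally show ?thesis using True by (simp add: good_def)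
  next
    case False
    then have "(\<Sum>i<q. \<beta> i x) = (\<Sum>i<q. if i = 0 then 1 else 0)" by (intro sum.cong) (auto simp: \<beta>_def)
    then show ?thesis using nq \<open>n \<noteq> 0\<close> by simp
  qed
  \<comment> \<open>Image of a weighted counting measure on the indices, so that coinciding actions
    simply add their weights.\<close>
  define \<phi> where "\<phi> x = distr (point_measure {..<q} (\<lambda>i. ennreal (\<beta> i x))) MA (\<lambda>i. F i x)" for x
  have \<phi>C: "emeasure (\<phi> x) C = (\<Sum>i<q. ennreal (\<beta> i x) * indicator C (F i x))" if x: "x \<in> space MX" and C: "C \<in> sets MA" for x C
  proof -
    have "emeasure (\<phi> x) C = emeasure (point_measure {..<q} (\<lambda>i. ennreal (\<beta> i x))) {i\<in>{..<q}. F i x \<in> C}"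
      unfolding \<phi>_def using C measurable_space[OF Fm x]
      by (subst emeasure_distr) (auto simp: space_point_measure vimage_def Int_def conj_commute)
    also have "\<dots> = (\<Sum>i\<in>{i\<in>{..<q}. F i x \<in> C}. ennreal (\<beta> i x))"
      by (rule emeasure_point_measure_finite) auto
    also have "\<dots> = (\<Sum>i<q. ennreal (\<beta> i x) * indicator C (F i x))"
      by (rule sum.mono_neutral_cong_left) (auto split: split_indicator)
    finally show ?thesis .
  qed
  have sum1: "(\<Sum>i<q. ennreal (\<beta> i x)) = 1" for x using \<beta>1 \<beta>0 by (simp add: sum_ennreal)
  have s\<phi>: "sets (\<phi> x) = sets MA" for x by (simp add: \<phi>_def)
  have p\<phi>: "prob_space (\<phi> x)" if x: "x \<in> space MX" for x
  proof
    have "emeasure (\<phi> x) (space MA) = (\<Sum>i<q. ennreal (\<beta> i x))"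
      unfolding \<phi>C[OF x sets.top] using measurable_space[OF Fm x] by (intro sum.cong) auto
    then show "emeasure (\<phi> x) (space (\<phi> x)) = 1" using sets_eq_imp_space_eq[OF s\<phi>] by (simp add: sum1)
  qed
  have \<phi>m: "\<phi> \<in> MX \<rightarrow>\<^sub>M prob_algebra MA"
  proof (rule measurable_prob_algebraI[OF p\<phi> measurable_subprob_algebra])
    fix C assume [measurable]: "C \<in> sets MA"
    have "(\<lambda>x. \<Sum>i<q. ennreal (\<beta> i x) * indicator C (F i x)) \<in> borel_measurable MX" by measurable
    then show "(\<lambda>x. emeasure (\<phi> x) C) \<in> borel_measurable MX"
      by (rule measurable_cong[THEN iffD1, rotated]) (simp add: \<phi>C)
  qed (auto simp: s\<phi> intro: prob_space_imp_subprob_space p\<phi>)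
  have \<phi>A: "emeasure (\<phi> x) (Aset x) = 1" if x: "x \<in> space MX" for x
    unfolding \<phi>C[OF x Aset[OF x]] using F_mem[OF x] by (simp add: sum1)
  have \<phi>k: "\<phi> \<in> kernels" using \<phi>m \<phi>A by (simp add: kernels_def)
  have "is_chattering MX MA Aset q \<phi>"
    unfolding is_chattering_def
  proof (intro conjI ballI exI[of _ F] exI[of _ \<beta>] allI impI)
    fix x C assume x: "x \<in> space MX" and C: "C \<in> sets MA"
    have "emeasure (\<phi> x) C = ennreal (\<Sum>i<q. \<beta> i x * indicator C (F i x))"
      unfolding \<phi>C[OF x C] using \<beta>0
      by (subst sum_ennreal[symmetric]) (auto intro!: sum.cong split: split_indicator)
    then show "measure (\<phi> x) C = (\<Sum>i<q. \<beta> i x * indicator C (F i x))"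
      using \<beta>0 by (simp add: measure_def sum_nonneg)
  qed (auto simp: \<phi>m \<phi>A \<beta>0 \<beta>1)
  moreover have "\<mu> = ksemi MXA m \<phi>"
  proof (rule ksemi_eqI[OF sm \<phi>m space_MX_ne occ_set_sets[OF \<mu>] fin])
    fix D C assume D[measurable]: "D \<in> sets MX" and C[measurable]: "C \<in> sets MA"
    have "emeasure \<mu> (D \<times> C) = (\<Sum>i<n. ennreal (w i) * emeasure (\<nu> i) (D \<times> C))" by (rule mix) measurable
    also have "\<dots> = (\<Sum>i<n. \<integral>\<^sup>+x. h i x * (indicator D x * indicator C (F i x)) \<partial>m)"
    proof (rule sum.cong[OF refl])
      fix i assume "i \<in> {..<n}"
      then have i: "i < n" by simp
      have g: "(\<lambda>x. indicator D x * indicator C (F i x) :: ennreal) \<in> borel_measurable MX" by measurable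
      have k: "(\<lambda>x. return MA (f i x)) \<in> MX \<rightarrow>\<^sub>M prob_algebra MA"
        using measurable_compose[OF f(1)[OF i] measurable_return_prob_space] .
      have "emeasure (\<nu> i) (D \<times> C) = (\<integral>\<^sup>+x. emeasure (return MA (f i x)) {a \<in> space MA. (x, a) \<in> D \<times> C} \<partial>distr (\<nu> i) MX fst)"
        by (subst f(3)[OF i], rule emeasure_ksemi[OF _ k space_MX_ne]) auto
      also have "\<dots> = (\<integral>\<^sup>+x. indicator D x * indicator C (F i x) \<partial>distr (\<nu> i) MX fst)"
      proof (rule nn_integral_cong)
        fix x assume "x \<in> space (distr (\<nu> i) MX fst)"
        have "{a \<in> space MA. (x, a) \<in> D \<times> C} = (if x \<in> D then C else {})"
          using sets.sets_into_space[OF C] by auto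
        then show "emeasure (return MA (f i x)) {a \<in> space MA. (x, a) \<in> D \<times> C} = indicator D x * indicator C (F i x)"
          using i C by (simp add: F_def)
      qed
      finally have "ennreal (w i) * emeasure (\<nu> i) (D \<times> C) = (\<integral>\<^sup>+x. indicator D x * indicator C (F i x) \<partial>\<rho> i)"
        unfolding \<rho>_def using g by (simp add: nn_integral_scale_measure)
      then show "ennreal (w i) * emeasure (\<nu> i) (D \<times> C) = (\<integral>\<^sup>+x. h i x * (indicator D x * indicator C (F i x)) \<partial>m)"
        using hint[OF i g] by simp
    qed
    also have "\<dots> = (\<integral>\<^sup>+x. (\<Sum>i<n. h i x * (indicator D x * indicator C (F i x))) \<partial>m)"
      by (rule nn_integral_sum[symmetric]) measurable
    also have "\<dots> = (\<integral>\<^sup>+x. indicator D x * emeasure (\<phi> x) C \<partial>m)"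
    proof (rule nn_integral_cong_AE, use AE_good AE_space in eventually_elim)
      case (elim x)
      then have x: "x \<in> space MX" by simp
      have "(\<Sum>i<n. h i x * (indicator D x * indicator C (F i x))) = (\<Sum>i<n. ennreal (\<beta> i x) * (indicator D x * indicator C (F i x)))"
        using elim(1) h_fin[OF elim(1)] by (intro sum.cong) (auto simp: \<beta>_def)
      also have "\<dots> = (\<Sum>i<q. ennreal (\<beta> i x) * (indicator D x * indicator C (F i x)))"
        using nq elim(1) by (intro sum.mono_neutral_left) (auto simp: \<beta>_def)
      also have "\<dots> = indicator D x * emeasure (\<phi> x) C"
        unfolding \<phi>C[OF x C] sum_distrib_left by (simp only: mult_ac)
      finally show ?case .
    qed
    finally show "emeasure \<mu> (D \<times> C) = (\<integral>\<^sup>+x. indicator D x * emeasure (\<phi> x) C \<partial>m)" .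
  qed
  \<comment> \<open>An occupation measure is that of the stationary policy given by any admissible
    kernel along which it disintegrates.\<close>
  then have "\<mu> = occ (\<lambda>_. \<phi>)"
    using \<mu> \<phi>k by (intro dominated_eq_occ) (auto simp: occ_set_iff m_def)
  ultimately show ?thesis using chattering_occ by simp
qed

end

theorem mainTheorem6:
  fixes MX :: "'x measure" and Asp :: "'a::polish_space set" and Aset :: "'x \<Rightarrow> 'a set"
    and Q :: "'x \<times> 'a \<Rightarrow> 'x measure" and \<eta> :: "'x measure" and r :: "'x \<times> 'a \<Rightarrow> real ^ 'd"
    and \<Delta> :: "'x set" and p :: nat and g :: "nat \<Rightarrow> 'x \<times> 'a \<Rightarrow> real" and \<alpha> :: "nat \<Rightarrow> real"
  defines "MA \<equiv> restrict_space borel Asp"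
  assumes model: "is_model MX Asp Aset Q \<eta> r"
    and absorbing: "is_absorbing MX Asp Aset Q \<eta> r \<Delta>"
    and p_pos: "1 \<le> p"
    and g_meas: "\<And>i. i < p \<Longrightarrow> g i \<in> borel_measurable (MX \<Otimes>\<^sub>M MA)"
    and g_bdd: "\<And>i. i < p \<Longrightarrow> \<exists>c. \<forall>z\<in>space (MX \<Otimes>\<^sub>M MA). \<bar>g i z\<bar> \<le> c"
    and g_Delta: "\<And>i x a. i < p \<Longrightarrow> x \<in> \<Delta> \<Longrightarrow> a \<in> Asp \<Longrightarrow> g i (x, a) = 0"
  shows "(\<forall>\<mu>\<in>ext_points (MX \<Otimes>\<^sub>M MA) (occ_set MX MA Aset Q \<eta> \<Delta> \<inter> constr_set p g \<alpha>).
            \<exists>n \<le> p + 1. \<exists>\<nu> :: nat \<Rightarrow> ('x \<times> 'a) measure. \<exists>w :: nat \<Rightarrow> real.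
              (\<forall>i<n. \<nu> i \<in> ext_points (MX \<Otimes>\<^sub>M MA) (occ_set MX MA Aset Q \<eta> \<Delta>) \<and> 0 \<le> w i) \<and>
              (\<Sum>i<n. w i) = 1 \<and>
              (\<forall>\<Gamma>\<in>sets (MX \<Otimes>\<^sub>M MA). emeasure \<mu> \<Gamma> = (\<Sum>i<n. ennreal (w i) * emeasure (\<nu> i) \<Gamma>)))
       \<and> ext_points (MX \<Otimes>\<^sub>M MA) (occ_set MX MA Aset Q \<eta> \<Delta> \<inter> constr_set p g \<alpha>)
           \<subseteq> occ_set_chattering MX MA Aset Q \<eta> \<Delta> (p + 1) \<inter> constr_set p g \<alpha>"
proof -
  have model': "Asp \<in> sets borel" "\<And>x. x \<in> space MX \<Longrightarrow> Aset x \<noteq> {} \<and> Aset x \<subseteq> Asp \<and> Aset x \<in> sets borel"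
    "Q \<in> MX \<Otimes>\<^sub>M MA \<rightarrow>\<^sub>M prob_algebra MX" "prob_space \<eta>" "sets \<eta> = sets MX"
    "{(x, a). x \<in> space MX \<and> a \<in> Aset x} \<in> sets (MX \<Otimes>\<^sub>M MA)"
    "\<exists>\<theta>. \<theta> \<in> MX \<rightarrow>\<^sub>M MA \<and> (\<forall>x\<in>space MX. \<theta> x \<in> Aset x)"
    using model unfolding is_model_def MA_def by blast+
  have space_MA: "space MA = Asp" by (simp add: MA_def space_restrict_space)
  have "space MX \<noteq> {}"
    using prob_space.not_empty[OF model'(4)] sets_eq_imp_space_eq[OF model'(5)] by simp
  then have "Asp \<noteq> {}" using model'(2) by blast
  interpret mdp MX MA Aset Q \<eta> \<Delta>
  proof (rule mdp.intro)
    show "Aset x \<in> sets MA" if "x \<in> space MX" for x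
      using model'(1) model'(2)[OF that] by (simp add: MA_def sets_restrict_space_iff)
    have "Sigma (space MX) Aset = {(x, a). x \<in> space MX \<and> a \<in> Aset x}" by auto
    then show "Sigma (space MX) Aset \<in> sets (MX \<Otimes>\<^sub>M MA)" using model'(6) by simp
    \<comment> \<open>The Polish structure of the action space enters the locale through this
      coding.\<close>
    obtain c :: "'a \<Rightarrow> real" and d where "c \<in> borel_measurable (restrict_space borel Asp)" "\<And>a. 0 \<le> c a" "\<And>a. c a \<le> 1"
      "d \<in> borel \<rightarrow>\<^sub>M restrict_space borel Asp" "\<And>a. a \<in> Asp \<Longrightarrow> d (c a) = a"
      using polish_real_coding[OF model'(1) \<open>Asp \<noteq> {}\<close>] by blast
    then show "\<exists>(c :: 'a \<Rightarrow> real) d. c \<in> borel_measurable MA \<and> (\<forall>a. 0 \<le> c a \<and> c a \<le> 1) \<and>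
      d \<in> borel \<rightarrow>\<^sub>M MA \<and> (\<forall>a\<in>space MA. d (c a) = a)"
      unfolding MA_def by (intro exI[of _ c] exI[of _ d]) (auto simp: space_restrict_space)
    show "\<Delta> \<in> sets MX" using absorbing by (simp add: is_absorbing_def)
    show "emeasure (Q (x, a)) \<Delta> = 1" if "x \<in> \<Delta>" "a \<in> space MA" for x a
      using absorbing that by (simp add: is_absorbing_def space_MA)
    show "(\<integral>\<^sup>+\<omega>. ennreal_of_enat (hit_time \<Delta> \<omega>) \<partial>P) < \<infinity>"
      if "is_policy MX MA Aset \<pi>" "is_strategic_measure MX MA Q \<eta> \<pi> P" for \<pi> P
      using absorbing that unfolding is_absorbing_def MA_def by blast
  qed (use model' in auto)
  note comb = ext_point_constrained_combination[OF g_meas g_bdd]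
  show ?thesis
  proof (intro conjI ballI subsetI)
    fix \<mu> assume \<mu>: "\<mu> \<in> ext_points (MX \<Otimes>\<^sub>M MA) (occ_set MX MA Aset Q \<eta> \<Delta> \<inter> constr_set p g \<alpha>)"
    show c: "\<exists>n \<le> p + 1. \<exists>\<nu> :: nat \<Rightarrow> ('x \<times> 'a) measure. \<exists>w :: nat \<Rightarrow> real.
        (\<forall>i<n. \<nu> i \<in> ext_points (MX \<Otimes>\<^sub>M MA) (occ_set MX MA Aset Q \<eta> \<Delta>) \<and> 0 \<le> w i) \<and>
        (\<Sum>i<n. w i) = 1 \<and>
        (\<forall>\<Gamma>\<in>sets (MX \<Otimes>\<^sub>M MA). emeasure \<mu> \<Gamma> = (\<Sum>i<n. ennreal (w i) * emeasure (\<nu> i) \<Gamma>))"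
      by (rule comb[OF _ _ \<mu>])
    then obtain n and \<nu> :: "nat \<Rightarrow> ('x \<times> 'a) measure" and w :: "nat \<Rightarrow> real" where n: "n \<le> p + 1"
      and \<nu>: "\<And>i. i < n \<Longrightarrow> \<nu> i \<in> ext_points (MX \<Otimes>\<^sub>M MA) (occ_set MX MA Aset Q \<eta> \<Delta>)"
      and w: "\<And>i. i < n \<Longrightarrow> 0 \<le> w i" "(\<Sum>i<n. w i) = 1"
      and mix: "\<And>\<Gamma>. \<Gamma> \<in> sets (MX \<Otimes>\<^sub>M MA) \<Longrightarrow> emeasure \<mu> \<Gamma> = (\<Sum>i<n. ennreal (w i) * emeasure (\<nu> i) \<Gamma>)"
      by blast
    have "\<mu> \<in> occ_set MX MA Aset Q \<eta> \<Delta>" "\<mu> \<in> constr_set p g \<alpha>" using \<mu> by (auto simp: ext_points_def)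
    then show "\<mu> \<in> occ_set_chattering MX MA Aset Q \<eta> \<Delta> (p + 1) \<inter> constr_set p g \<alpha>"
      using chattering_combination[OF _ n \<nu> w mix] by blast
  qed
qed

end
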